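(* Let $\mathbb K$ be a field. If $(\kappa_n)_{n\geq 1}$ is a sequence of free cumulants in $\mathbb K$, then the corresponding classical cumulants $(c_n)_{n\ge1}$ are given, for all $n\ge1$, by \[-c_n=\sum_{\mathcal H\in\mathrm{VHC}(\mathrm{Av}_{n-1}(231))}\mathscr T_{\mathcal H}\,(-\kappa_\bullet)_{\underline{\mathcal H}}.\]
   Context: Cumulants. $\Pi(n)$ is the set of set partitions of $[n]=\{1,\ldots,n\}$, and $\mathrm{NC}(n)$ is the set of those that are noncrossing (there are no distinct blocks $B,B'$ and $i,j\in B$, $i',j'\in B'$ with $i<i'<j<j'$ or $i>i'>j>j'$). For a sequence $(u_n)_{n\ge1}$ in $\mathbb K$ and a set partition $\rho$, put $(u_\bullet)_\rho=\prod_{B\in\rho}u_{|B|}$; thus $(-\kappa_\bullet)_\rho=\prod_{B\in\rho}(-\kappa_{|B|})$. A sequence $(\kappa_n)$ of free cumulants and a sequence $(c_n)$ of classical cumulants correspond to each other if they have the same moment sequence $(m_n)_{n\ge1}$, i.e. $m_n=\sum_{\rho\in\Pi(n)}(c_\bullet)_\rho=\sum_{\eta\in\mathrm{NC}(n)}(\kappa_\bullet)_\eta$ for all $n\ge1$. Each sequence determines the others. Permutations. $S_n$ is the set of permutations $\pi=\pi_1\cdots\pi_n$ of $[n]$ ($S_0$ contains only the empty permutation). $\mathrm{Av}_n(231)$ is the set of $\pi\in S_n$ for which there are no indices $i_1<i_2<i_3$ with $\pi_{i_3}<\pi_{i_1}<\pi_{i_2}$. A descent of $\pi$ is an index $i\in[n-1]$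 with $\pi_i>\pi_{i+1}$; the plot of $\pi$ is the set of points $(i,\pi_i)$. Valid hook configurations. A hook of $\pi$ with southwest endpoint $(i,\pi_i)$ and northeast endpoint $(j,\pi_j)$, where $i<j$ and $\pi_i<\pi_j$, is the union of the vertical segment from $(i,\pi_i)$ to $(i,\pi_j)$ and the horizontal segment from $(i,\pi_j)$ to $(j,\pi_j)$. If $d_1<\cdots<d_k$ are the descents of $\pi$, a valid hook configuration of $\pi$ is a tuple $\mathcal H=(H_1,\ldots,H_k)$ of hooks of $\pi$ such that: (1) the southwest endpoint of $H_i$ is $(d_i,\pi_{d_i})$ for each $i$; (2) no point of the plot lies directly above a hook (i.e. if $H_m$ has northeast endpoint $(j_m,\pi_{j_m})$, then $\pi_x<\pi_{j_m}$ for all $d_m<x<j_m$); (3) no two hooks intersect or overlap unless the northeast endpoint of one is the southwest endpoint of the other. $\mathrm{VHC}(\pi)$ is the set of valid hook configurations of $\pi$ (a single empty configuration if $\pi$ has no descents). A valid hook configuration includes its underlying permutation as part of its identity, and $\mathrm{VHC}(S)=\bigcup_{\pi\in S}\mathrm{VHC}(\pi)$ for a set $S$ of permutations (a disjoint union). The partition $\underline{\mathcal H}$. Let $\pi\in S_{n-1}$ and $\mathcal H=(H_1,\dots,H_k)\in\mathrm{VHC}(\pi)$, with $H_m$ having northeast endpoint $(j_m,\pi_{j_m})$. Give the hooks distinct colors and the "sky" another color (blue). The northeast endpoint of a hook gets the color of that hook; any other point $(i,\pi_i)$ gets the color of the hook $H_m$ with $d_m<i<j_m$ for which $\pi_{j_m}$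 is smallest (the first hook seen looking straight up, where a southwest endpoint looks around the left side of its own hook), or blue if there is no such $m$. The set partition $\underline{\mathcal H}\in\Pi(n)$ is defined by: $i,i'\in[n-1]$ are in the same block iff $(i,\pi_i)$ and $(i',\pi_{i'})$ have the same color, and $n$ is added to the block of those $i$ for which $(i,\pi_i)$ is blue (for $n=1$, $\underline{\mathcal H}=\{\{1\}\}$). The number $\mathscr T_{\mathcal H}$. A binary plane tree is a finite (possibly empty) rooted tree in which every vertex has at most two children, every child is designated as a left or right child (not both), and no vertex has two left or two right children. A standardized decreasing binary plane tree with $m$ vertices is a binary plane tree with vertices bijectively labeled by $1,\dots,m$ so that every nonroot vertex has a smaller label than its parent; its skeleton is the underlying unlabeled tree. The in-order reading $\mathcal I(\mathcal T)=\mathcal I(\mathcal T_L)\,r\,\mathcal I(\mathcal T_R)$ (where $r$ is the root label, $\mathcal T_L,\mathcal T_R$ the left and right subtrees of the root, and the empty tree has empty reading) is a bijection from standardized decreasing binary plane trees with $m$ vertices to $S_m$. For $\mathcal H\in\mathrm{VHC}(\pi)$ with $\pi\in S_{n-1}$, let $T_\pi$ be the skeleton of $\mathcal I^{-1}(\pi)$; then $\mathscr T_{\mathcal H}$ is the number of standardized decreasing binary plane trees with skeleton $T_\pi$. *)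

theory Defs
  imports
    Complex_Main
    "HOL-Library.Disjoint_Sets"
    "HOL-Library.Tree"
    "HOL-Combinatorics.Multiset_Permutations"
begin

definition set_partitions :: "nat \<Rightarrow> nat set set set" where
  "set_partitions n = {P. partition_on {1..n} P}"

definition noncrossing :: "nat set set \<Rightarrow> bool" where
  "noncrossing P \<longleftrightarrow>
     \<not> (\<exists>B\<in>P. \<exists>B'\<in>P. B \<noteq> B' \<and>
          (\<exists>i\<in>B. \<exists>j\<in>B. \<exists>i'\<in>B'. \<exists>j'\<in>B'.
             (i < i' \<and> i' < j \<and> j < j') \<or> (i > i' \<and> i' > j \<and> j > j')))"

definition nc_partitions :: "nat \<Rightarrow> nat set set set" where
  "nc_partitions n = {P \<in> set_partitions n. noncrossing P}"

(* Sequences (u_n) with n >= 1 are functions on nat; the value at 0 is never used,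
   since blocks of a partition are nonempty. *)
definition partition_weight :: "(nat \<Rightarrow> 'a::field) \<Rightarrow> nat set set \<Rightarrow> 'a" where
  "partition_weight u P = (\<Prod>B\<in>P. u (card B))"

definition classical_cumulants_of :: "(nat \<Rightarrow> 'a::field) \<Rightarrow> (nat \<Rightarrow> 'a) \<Rightarrow> bool" where
  "classical_cumulants_of m c \<longleftrightarrow>
     (\<forall>n\<ge>1. m n = (\<Sum>P\<in>set_partitions n. partition_weight c P))"

definition free_cumulants_of :: "(nat \<Rightarrow> 'a::field) \<Rightarrow> (nat \<Rightarrow> 'a) \<Rightarrow> bool" where
  "free_cumulants_of m \<kappa> \<longleftrightarrow>
     (\<forall>n\<ge>1. m n = (\<Sum>P\<in>nc_partitions n. partition_weight \<kappa> P))"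

definition corresponding_cumulants :: "(nat \<Rightarrow> 'a::field) \<Rightarrow> (nat \<Rightarrow> 'a) \<Rightarrow> bool" where
  "corresponding_cumulants \<kappa> c \<longleftrightarrow>
     (\<exists>m. free_cumulants_of m \<kappa> \<and> classical_cumulants_of m c)"

(* Permutations of [n] are words, i.e. the lists in permutations_of_set {1..n}.
   Positions are counted from 1, as in the mathematical notation. *)
definition entry :: "nat list \<Rightarrow> nat \<Rightarrow> nat" where
  "entry \<pi> i = \<pi> ! (i - 1)"

definition Av231 :: "nat \<Rightarrow> nat list set" where
  "Av231 n = {\<pi> \<in> permutations_of_set {1..n}.
     \<not> (\<exists>i1 i2 i3. 1 \<le> i1 \<and> i1 < i2 \<and> i2 < i3 \<and> i3 \<le> n \<and>
          entry \<pi> i3 < entry \<pi> i1 \<and> entry \<pi> i1 < entry \<pi> i2)}"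

definition descents :: "nat list \<Rightarrow> nat set" where
  "descents \<pi> = {i. 1 \<le> i \<and> i < length \<pi> \<and> entry \<pi> i > entry \<pi> (i + 1)}"

(* A hook is encoded by the pair (i, j) of the positions of its southwest and northeast
   endpoints; hook_points is the corresponding subset of the plane. *)
definition is_hook :: "nat list \<Rightarrow> nat \<times> nat \<Rightarrow> bool" where
  "is_hook \<pi> = (\<lambda>(i, j). 1 \<le> i \<and> i < j \<and> j \<le> length \<pi> \<and> entry \<pi> i < entry \<pi> j)"

definition hook_points :: "nat list \<Rightarrow> nat \<times> nat \<Rightarrow> (real \<times> real) set" where
  "hook_points \<pi> = (\<lambda>(i, j).
     {real i} \<times> {real (entry \<pi> i)..real (entry \<pi> j)} \<union>
     {real i..real j} \<times> {real (entry \<pi> j)})"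

definition VHC :: "nat list \<Rightarrow> (nat \<times> nat) list set" where
  "VHC \<pi> = {H.
     (\<forall>h\<in>set H. is_hook \<pi> h) \<and>
     map fst H = sorted_list_of_set (descents \<pi>) \<and>
     (\<forall>(d, j)\<in>set H. \<forall>x. d < x \<and> x < j \<longrightarrow> entry \<pi> x < entry \<pi> j) \<and>
     (\<forall>a<length H. \<forall>b<length H. a \<noteq> b \<longrightarrow>
        hook_points \<pi> (H ! a) \<inter> hook_points \<pi> (H ! b) = {} \<or>
        snd (H ! a) = fst (H ! b) \<or> snd (H ! b) = fst (H ! a))}"

definition VHC_on :: "nat list set \<Rightarrow> (nat list \<times> (nat \<times> nat) list) set" where
  "VHC_on S = (SIGMA \<pi>:S. VHC \<pi>)"

(* The colour of the point at position i: Some h is the colour of the hook h, None is the sky.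
   In a valid hook configuration distinct hooks have distinct northeast endpoints, so both
   choices below are uniquely determined. *)
definition colour :: "nat list \<Rightarrow> (nat \<times> nat) list \<Rightarrow> nat \<Rightarrow> (nat \<times> nat) option" where
  "colour \<pi> H i =
     (if \<exists>h\<in>set H. snd h = i then Some (THE h. h \<in> set H \<and> snd h = i)
      else if \<exists>h\<in>set H. fst h < i \<and> i < snd h
      then Some (ARG_MIN (\<lambda>h. entry \<pi> (snd h)) h. h \<in> set H \<and> fst h < i \<and> i < snd h)
      else None)"

(* For a permutation of [n-1], where n = length \<pi> + 1; the extra element n is blue. *)
definition hook_partition :: "nat list \<Rightarrow> (nat \<times> nat) list \<Rightarrow> nat set set" where
  "hook_partition \<pi> H =
     (let n = length \<pi> + 1;
          col = (\<lambda>i. if i = n then None else colour \<pi> H i)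
      in {1..n} // {(i, i'). i \<in> {1..n} \<and> i' \<in> {1..n} \<and> col i = col i'})"

(* A binary plane tree is a value of the library type of binary trees, with Leaf the empty
   tree and Node a vertex. *)
fun label_below :: "nat tree \<Rightarrow> nat \<Rightarrow> bool" where
  "label_below Leaf r \<longleftrightarrow> True"
| "label_below (Node l a t) r \<longleftrightarrow> a < r"

fun decreasing_tree :: "nat tree \<Rightarrow> bool" where
  "decreasing_tree Leaf \<longleftrightarrow> True"
| "decreasing_tree (Node l r t) \<longleftrightarrow>
     label_below l r \<and> label_below t r \<and> decreasing_tree l \<and> decreasing_tree t"

(* With m vertices, having label set [m] means that the labelling is bijective. *)
definition std_decreasing_trees :: "nat \<Rightarrow> nat tree set" where
  "std_decreasing_trees m = {t. size t = m \<and> set_tree t = {1..m} \<and> decreasing_tree t}"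

definition skeleton :: "'a tree \<Rightarrow> unit tree" where
  "skeleton t = map_tree (\<lambda>_. ()) t"

definition perm_skeleton :: "nat list \<Rightarrow> unit tree" where
  "perm_skeleton \<pi> = skeleton (inv_into (std_decreasing_trees (length \<pi>)) inorder \<pi>)"

(* The number attached to a valid hook configuration depends only on its permutation. *)
definition tree_number :: "nat list \<Rightarrow> nat" where
  "tree_number \<pi> =
     card {t \<in> std_decreasing_trees (length \<pi>). skeleton t = perm_skeleton \<pi>}"

end

theory Submission
  imports Defs "HOL-Library.Poly_Mapping"
begin

text \<open>
  Put \<open>k j = - \<kappa> j\<close>.  Both families of objects in the theorem are built by a process with a
  stack of unfinished blocks.  A noncrossing partition, read from left to right, keeps a stack of
  blocks that have started but not ended, and each new point opens a block, joins the block on top,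
  closes it, or does both.  A valid hook configuration, read from left to right, keeps a stack of
  hooks whose northeast endpoint has not been reached; the colour of a point is the hook on top of
  the stack just before the point (the sky if the stack is empty), whether or not the point ends
  that hook.  A stack is recorded as a word in two letters, where \<open>Y\<close> opens a block and \<open>X\<close> adds a
  point to the block on top, and weighted sums of stacks are elements of the free algebra on \<open>X\<close> and
  \<open>Y\<close>.  The linear operator \<open>pop k\<close> adds a last point to the block on top and pays its weight,
  \<open>w Y X\<^sup>b \<mapsto> k (b + 1) w\<close>; the functional \<open>eps k\<close> does the same for the block at the bottom,
  \<open>X\<^sup>b \<mapsto> k (b + 1)\<close>.

  Let \<open>\<Upsilon>\<close> be the exponential generating function of the stacks of partially read noncrossing
  partitions, with weight \<open>\<kappa>\<close> for each finished block and sign \<open>-1\<close> for each unfinished one.  Its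
  part \<open>M\<close> with empty stack is the generating function of the moments, and one reading step gives the
  linear equation
  \<open>\<Upsilon>' = pop \<Upsilon> - k\<^sub>1 \<Upsilon> + (\<Upsilon> - M) X - \<Upsilon> Y X\<close>.
  Let \<open>\<Phi>\<close> be the generating function of the stacks of partial hook configurations on decreasing
  binary trees.  A hook must end at a vertex that has its start in the left subtree, so a tree with
  root \<open>a\<close> is processed in the order left subtree, \<open>a\<close>, right subtree, and \<open>a\<close> may only end a hook
  that starts in the left subtree.  Hence \<open>\<Phi>' = (\<Phi> X + pop \<Phi>) \<Psi>\<close> with \<open>\<Psi> = 1 + Y (\<Phi> - 1)\<close>, where the
  factor \<open>Y\<close> is the hook that starts at \<open>a\<close> when the right subtree is nonempty.  For \<open>\<Psi>\<close> this is a
  Riccati equation, and \<open>\<Upsilon>\<close> linearises it: the product \<open>\<Upsilon> \<Psi>\<close> is the scalar series \<open>M\<close>, and comparing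
  derivatives gives \<open>M' = - (eps \<Phi>) M\<close> (lemma \<open>free_moment_convolution\<close>).  The exponential formula
  for classical cumulants is \<open>M' = C' M\<close> (lemma \<open>classical_moment\<close>), so \<open>- C' = eps \<Phi>\<close>, and the
  coefficients of \<open>eps \<Phi>\<close> are the sums over valid hook configurations (lemma \<open>eps_tree_series\<close>).
  Generating functions are written as sequences with binomial convolution, so that no factorial is
  inverted and the characteristic of the field is arbitrary.

  The conditions on hooks depend on a permutation only through the skeleton of its decreasing tree:
  the vertex at position \<open>j\<close> exceeds all entries at positions \<open>d, \<dots>, j - 1\<close> iff position \<open>d\<close> lies in
  its left subtree, and \<open>d\<close> is a descent iff its vertex has a right child.  Each skeleton belongs to
  exactly one permutation avoiding 231, the one whose labels are in postorder, and the number of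
  permutations with that skeleton is the number of labellings of the tree.  This turns the sum over
  decreasing trees into the sum of the theorem.
\<close>

section \<open>The free algebra on two letters\<close>

datatype letter = X | Y

text \<open>The wrapper makes concatenation available as the addition of a monoid, so that the convolution
  product of finitely supported functions on words is the product of the free algebra.\<close>

datatype word = Word (letters: "letter list")

instantiation word :: monoid_add
begin
definition zero_word where "0 = Word []"
definition plus_word where "u + v = Word (letters u @ letters v)"
instance by standard (auto simp: zero_word_def plus_word_def)
end

type_synonym 'a ncpoly = "word \<Rightarrow>\<^sub>0 'a"

definition wd :: "letter list \<Rightarrow> 'a::comm_ring_1 ncpoly" where
  "wd w = Poly_Mapping.single (Word w) 1"

definition sc :: "'a::comm_ring_1 \<Rightarrow> 'a ncpoly" where
  "sc c = Poly_Mapping.single 0 c"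

lemma wd_mult: "wd u * wd v = wd (u @ v)"
  by (simp add: wd_def mult_single plus_word_def)

lemma wd_Nil [simp]: "wd [] = 1"
  by (simp add: wd_def flip: zero_word_def)

lemma sc_simps:
  "sc (a + b) = sc a + sc b" "sc (a - b) = sc a - sc b" "sc (- a) = - sc a"
  "sc (a * b) = sc a * sc b" "sc 0 = 0" "sc 1 = 1" "sc (of_nat m) = of_nat m"
  by (simp_all add: sc_def mult_single single_add single_diff single_uminus)

lemma sc_sum: "sc (sum f A) = (\<Sum>i\<in>A. sc (f i))"
  by (induction A rule: infinite_finite_induct) (auto simp: sc_simps)

lemma sc_wd: "sc c * wd w = Poly_Mapping.single (Word w) c"
  by (simp add: sc_def wd_def mult_single)

lemma lookup_sc: "Poly_Mapping.lookup (sc c) 0 = c"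
  by (simp add: sc_def)

lemma ncpoly_expand:
  "f = (\<Sum>w\<in>Poly_Mapping.keys f. sc (Poly_Mapping.lookup f w) * wd (letters w))"
  by (rule poly_mapping_eqI)
     (auto simp: lookup_sum sc_wd lookup_single when_def in_keys_iff sum.delta)

lemma ncpoly_induct [case_names monom add]:
  assumes "\<And>c w. P (sc c * wd w)" and "\<And>f g. P f \<Longrightarrow> P g \<Longrightarrow> P (f + g)"
  shows "P f"
proof -
  have "P (\<Sum>w\<in>A. sc (Poly_Mapping.lookup f w) * wd (letters w))" if "finite A" for A
    using that
    by (induction A) (use assms assms(1)[of 0] in \<open>auto simp: sc_simps\<close>)
  from this[OF finite_keys[of f]] show ?thesis
    using ncpoly_expand[of f] by simp
qed

lemma sc_commute: "sc c * f = f * sc c"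
  by (induction f rule: ncpoly_induct)
     (auto simp: sc_wd algebra_simps, auto simp: sc_def mult_single mult.commute)

lemma monom_mult: "(sc c * wd u) * (sc d * wd v) = sc (c * d) * wd (u @ v)"
  by (simp add: sc_def wd_def mult_single plus_word_def zero_word_def)

lemma lookup_monom_0: "Poly_Mapping.lookup (sc c * wd w) 0 = (if w = [] then c else 0)"
  by (simp add: sc_wd lookup_single zero_word_def when_def)

lemma lookup_mult_0:
  fixes f g :: "'a::comm_ring_1 ncpoly"
  shows "Poly_Mapping.lookup (f * g) 0 = Poly_Mapping.lookup f 0 * Poly_Mapping.lookup g (0::word)"
proof (induction f rule: ncpoly_induct)
  case (monom c w)
  show ?case
  proof (induction g rule: ncpoly_induct)
    case (monom d v)
    show ?case
      by (simp add: monom_mult lookup_monom_0)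
  qed (auto simp: algebra_simps lookup_add)
qed (auto simp: algebra_simps lookup_add)

definition lin_ext :: "(letter list \<Rightarrow> 'a::comm_ring_1 ncpoly) \<Rightarrow> 'a ncpoly \<Rightarrow> 'a ncpoly" where
  "lin_ext h f = (\<Sum>w\<in>Poly_Mapping.keys f. sc (Poly_Mapping.lookup f w) * h (letters w))"

lemma lin_ext_superset:
  assumes "finite A" "Poly_Mapping.keys f \<subseteq> A"
  shows "lin_ext h f = (\<Sum>w\<in>A. sc (Poly_Mapping.lookup f w) * h (letters w))"
  unfolding lin_ext_def using assms
  by (intro sum.mono_neutral_left) (auto simp: in_keys_iff sc_simps)

lemma lin_ext_add: "lin_ext h (f + g) = lin_ext h f + lin_ext h g"
proof -
  have "Poly_Mapping.keys (f + g) \<subseteq> Poly_Mapping.keys f \<union> Poly_Mapping.keys g" by (rule keys_add)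
  then show ?thesis
    by (simp add: lin_ext_superset[of "Poly_Mapping.keys f \<union> Poly_Mapping.keys g"] lookup_add sc_simps
        algebra_simps sum.distrib)
qed

lemma lin_ext_0: "lin_ext h 0 = 0"
  by (simp add: lin_ext_def)

lemma lin_ext_monom: "lin_ext h (sc c * wd w) = sc c * h w"
  by (cases "c = 0") (auto simp: lin_ext_def sc_wd sc_simps)

lemma lin_ext_sum: "lin_ext h (sum f A) = (\<Sum>i\<in>A. lin_ext h (f i))"
  by (induction A rule: infinite_finite_induct) (auto simp: lin_ext_add lin_ext_0)

lemma lin_ext_sc: "lin_ext h (sc c * f) = sc c * lin_ext h f"
proof (induction f rule: ncpoly_induct)
  case (monom d w)
  have "sc c * (sc d * wd w) = sc (c * d) * wd w"
    by (simp add: sc_simps mult.assoc)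
  then show ?case
    by (simp only: lin_ext_monom) (simp add: sc_simps mult.assoc)
qed (auto simp: lin_ext_add algebra_simps)

lemma lin_ext_wd: "lin_ext h (wd w) = h w"
  using lin_ext_monom[of h 1 w] by (simp add: sc_simps)

text \<open>On a word \<open>w Y X\<^sup>b\<close> the value is \<open>k (b + 1) w\<close>, and it is zero on words without \<open>Y\<close>.  The recursion
  runs up from the bottom of the stack: the additional summand appears at the one \<open>Y\<close> that has no
  other \<open>Y\<close> above it, which is the top block.\<close>

fun pop_word :: "(nat \<Rightarrow> 'a::comm_ring_1) \<Rightarrow> letter list \<Rightarrow> 'a ncpoly" where
  "pop_word k [] = 0"
| "pop_word k (X # w) = wd [X] * pop_word k w"
| "pop_word k (Y # w) =
     wd [Y] * pop_word k w + (if Y \<in> set w then 0 else sc (k (Suc (length w))))"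

definition pop :: "(nat \<Rightarrow> 'a::comm_ring_1) \<Rightarrow> 'a ncpoly \<Rightarrow> 'a ncpoly" where
  "pop k = lin_ext (pop_word k)"

definition eps_word :: "(nat \<Rightarrow> 'a::comm_ring_1) \<Rightarrow> letter list \<Rightarrow> 'a" where
  "eps_word k w = (if Y \<in> set w then 0 else k (Suc (length w)))"

definition eps :: "(nat \<Rightarrow> 'a::comm_ring_1) \<Rightarrow> 'a ncpoly \<Rightarrow> 'a ncpoly" where
  "eps k = lin_ext (\<lambda>w. sc (eps_word k w))"

lemma pop_1 [simp]: "pop k 1 = 0"
  using lin_ext_wd[of "pop_word k" "[]"] by (simp add: pop_def)

lemma eps_1: "eps k 1 = sc (k 1)"
  using lin_ext_wd[of "\<lambda>w. sc (eps_word k w)" "[]"] by (simp add: eps_def eps_word_def)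

lemma eps_sc: "eps k f = sc (Poly_Mapping.lookup (eps k f) 0)"
  unfolding eps_def lin_ext_def
  by (simp add: lookup_sum lookup_mult_0 lookup_sc sc_simps sc_sum)

lemma eps_commute: "eps k f * g = g * eps k f"
  by (metis eps_sc sc_commute)

text \<open>Under a stack from \<open>f\<close> a further block \<open>Y\<close> is laid.  Popping still affects the top block of \<open>f\<close>,
  except for the stacks of \<open>f\<close> that consist of their bottom block only: its points now belong to
  the new block, and this is paid as in \<open>eps\<close>.\<close>

lemma pop_Y_mult: "pop k (wd [Y] * f) = wd [Y] * pop k f + eps k f"
proof (induction f rule: ncpoly_induct)
  case (monom c w)
  have 1: "wd [Y] * (sc c * wd w) = sc c * wd (Y # w)"
    using monom_mult[of 1 "[Y]" c w] by (simp add: sc_simps)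
  have 2: "wd [Y] * (sc c * f) = sc c * (wd [Y] * f)" for f
    by (metis mult.assoc sc_commute)
  show ?case
    unfolding 1 pop_def eps_def lin_ext_monom
    by (simp add: eps_word_def distrib_left sc_simps 2)
qed (auto simp: algebra_simps pop_def eps_def lin_ext_add)

lemma pop_word_append_Y: "pop_word k (u @ Y # v) = wd u * pop_word k (Y # v)"
proof (induction u)
  case (Cons a u)
  then show ?case
    by (cases a) (simp_all add: wd_mult flip: mult.assoc)
qed simp

text \<open>The letter \<open>Y\<close> between the two factors shields the blocks of \<open>u\<close> from the operator.\<close>

lemma pop_mult_Y: "pop k (u * (wd [Y] * f)) = u * pop k (wd [Y] * f)"
proof (induction u rule: ncpoly_induct)
  case (monom c w)
  show ?case
  proof (induction f rule: ncpoly_induct)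
    case (monom d v)
    have 1: "wd [Y] * (sc d * wd v) = sc d * wd (Y # v)"
      using monom_mult[of 1 "[Y]" d v] by (simp add: sc_simps)
    have "sc c * wd w * (sc d * pop_word k (Y # v)) = sc c * sc d * (wd w * pop_word k (Y # v))"
      by (metis mult.assoc sc_commute)
    then show ?case
      unfolding 1 monom_mult pop_def lin_ext_monom pop_word_append_Y by (simp only: sc_simps)
  qed (auto simp: algebra_simps pop_def lin_ext_add)
qed (auto simp: algebra_simps pop_def lin_ext_add)

lemma pop_word_top: "pop_word k (w @ Y # replicate b X) = sc (k (Suc b)) * wd w"
proof -
  have "pop_word k (replicate b X) = 0" by (induction b) auto
  then show ?thesis
    by (simp add: pop_word_append_Y sc_commute)
qed

lemma pop_word_no_Y: "Y \<notin> set w \<Longrightarrow> pop_word k w = 0"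
proof (induction w)
  case (Cons a w) then show ?case by (cases a) auto
qed simp

section \<open>Binomial convolution and the moments of free cumulants\<close>

definition binomial_conv :: "(nat \<Rightarrow> 'r::ring_1) \<Rightarrow> (nat \<Rightarrow> 'r) \<Rightarrow> nat \<Rightarrow> 'r" where
  "binomial_conv f g n = (\<Sum>i\<le>n. of_nat (n choose i) * (f i * g (n - i)))"

lemma binomial_conv_0 [simp]: "binomial_conv f g 0 = f 0 * g 0"
  by (simp add: binomial_conv_def)

lemma binomial_conv_add_left: "binomial_conv (\<lambda>i. f i + f' i) g n = binomial_conv f g n + binomial_conv f' g n"
  by (simp add: binomial_conv_def algebra_simps sum.distrib)

lemma binomial_conv_add_right: "binomial_conv f (\<lambda>i. g i + g' i) n = binomial_conv f g n + binomial_conv f g' n"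
  by (simp add: binomial_conv_def algebra_simps sum.distrib)

lemma binomial_conv_minus_right: "binomial_conv f (\<lambda>i. g i - g' i) n = binomial_conv f g n - binomial_conv f g' n"
  by (simp add: binomial_conv_def algebra_simps sum_subtractf)

lemma binomial_conv_uminus_left: "binomial_conv (\<lambda>i. - f i) g n = - binomial_conv f g n"
  by (simp add: binomial_conv_def sum_negf)

lemma binomial_conv_cong:
  "(\<And>i. i \<le> n \<Longrightarrow> f i = f' i) \<Longrightarrow> (\<And>i. i \<le> n \<Longrightarrow> g i = g' i) \<Longrightarrow> binomial_conv f g n = binomial_conv f' g' n"
  by (simp add: binomial_conv_def)

text \<open>The shift is the derivative of a sequence of exponential coefficients, so this is the Leibniz
  rule; it also yields associativity by induction, without any binomial identity.\<close>

lemma binomial_conv_Suc: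
  "binomial_conv f g (Suc n) = binomial_conv (\<lambda>i. f (Suc i)) g n + binomial_conv f (\<lambda>i. g (Suc i)) n"
proof -
  have "binomial_conv f g (Suc n) = f 0 * g (Suc n) + (\<Sum>i\<le>n. of_nat (Suc n choose Suc i) * (f (Suc i) * g (n - i)))"
    unfolding binomial_conv_def by (subst sum.atMost_Suc_shift) simp
  also have "(\<Sum>i\<le>n. of_nat (Suc n choose Suc i) * (f (Suc i) * g (n - i)))
     = binomial_conv (\<lambda>i. f (Suc i)) g n + (\<Sum>i\<le>n. of_nat (n choose Suc i) * (f (Suc i) * g (n - i)))"
    by (simp add: binomial_conv_def algebra_simps sum.distrib)
  also have "f 0 * g (Suc n) + (binomial_conv (\<lambda>i. f (Suc i)) g n + (\<Sum>i\<le>n. of_nat (n choose Suc i) * (f (Suc i) * g (n - i))))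
     = binomial_conv (\<lambda>i. f (Suc i)) g n + (\<Sum>i\<le>Suc n. of_nat (n choose i) * (f i * g (Suc n - i)))"
    by (subst sum.atMost_Suc_shift) (simp add: algebra_simps)
  also have "(\<Sum>i\<le>Suc n. of_nat (n choose i) * (f i * g (Suc n - i))) = binomial_conv f (\<lambda>i. g (Suc i)) n"
    by (simp add: binomial_conv_def Suc_diff_le binomial_eq_0)
  finally show ?thesis .
qed

lemma binomial_conv_assoc: "binomial_conv (binomial_conv f g) h n = binomial_conv f (binomial_conv g h) n"
proof (induction n arbitrary: f g h)
  case 0
  then show ?case by (simp add: mult.assoc)
next
  case (Suc n)
  then show ?case
    by (simp add: binomial_conv_Suc binomial_conv_add_left binomial_conv_add_right add.assoc)
qed

lemma binomial_conv_commute: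
  assumes "\<And>i j. f i * g j = g j * f i"
  shows "binomial_conv f g n = binomial_conv g f n"
  unfolding binomial_conv_def
  by (rule sum.reindex_bij_witness[of _ "\<lambda>i. n - i" "\<lambda>i. n - i"])
     (use assms in \<open>auto simp: binomial_symmetric[symmetric]\<close>)

text \<open>The relation \<open>M' = - (eps \<Phi>) M\<close>.  The product \<open>E = \<Upsilon> \<Psi>\<close> satisfies
  \<open>E' = (pop E + (E - M) X) \<Psi> - (eps \<Phi>) E\<close>, because the extra terms in the equations of \<open>\<Upsilon>\<close> and
  \<open>\<Psi>\<close> cancel.  If \<open>E = M\<close> holds up to degree \<open>n\<close>, the first summand vanishes and the next
  coefficient of \<open>E\<close> is a scalar; since \<open>\<Psi>\<close> has constant coefficient 1 and otherwise starts with
  \<open>Y\<close>, the coefficients of the empty word in \<open>E\<close> and in \<open>\<Upsilon>\<close> agree, so this scalar is the next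
  coefficient of \<open>M\<close>.\<close>

theorem free_moment_convolution:
  fixes k :: "nat \<Rightarrow> 'a::comm_ring_1"
    and \<Phi> \<Upsilon> :: "nat \<Rightarrow> 'a ncpoly" and m e :: "nat \<Rightarrow> 'a"
  defines "\<Psi> \<equiv> (\<lambda>n. if n = 0 then 1 else wd [Y] * \<Phi> n)"
  assumes Phi_0: "\<Phi> 0 = 1"
    and Phi_Suc: "\<And>n. \<Phi> (Suc n) = binomial_conv (\<lambda>i. \<Phi> i * wd [X] + pop k (\<Phi> i)) \<Psi> n"
    and Ups_0: "\<Upsilon> 0 = 1"
    and Ups_Suc: "\<And>n. \<Upsilon> (Suc n) = pop k (\<Upsilon> n) - \<Upsilon> n * sc (k 1)
        + (\<Upsilon> n - sc (m n)) * wd [X] - \<Upsilon> n * wd [Y] * wd [X]"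
    and m: "\<And>n. m n = Poly_Mapping.lookup (\<Upsilon> n) 0"
    and e: "\<And>n. eps k (\<Phi> n) = sc (e n)"
  shows "m (Suc n) = - binomial_conv e m n"
proof -
  define A where "A i = pop k (\<Psi> i) + \<Psi> i * wd [X]
      + (if i = 0 then (wd [Y] - 1) * wd [X] + sc (k 1) else 0) - eps k (\<Phi> i)" for i
  define E where "E = binomial_conv \<Upsilon> \<Psi>"
  have lookup_Psi: "Poly_Mapping.lookup (\<Psi> i) 0 = (if i = 0 then 1 else 0)" for i
  proof -
    have "Poly_Mapping.lookup (wd [Y] :: 'a ncpoly) 0 = 0"
      by (simp add: wd_def lookup_single zero_word_def)
    then show ?thesis by (simp add: \<Psi>_def lookup_mult_0)
  qed
  have E_lookup: "Poly_Mapping.lookup (E n) 0 = m n" for n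
  proof -
    have "Poly_Mapping.lookup (E n) 0 = (\<Sum>i\<le>n. Poly_Mapping.lookup (of_nat (n choose i)) (0::word) * (Poly_Mapping.lookup (\<Upsilon> i) 0 * Poly_Mapping.lookup (\<Psi> (n - i)) 0))"
      by (simp add: E_def binomial_conv_def lookup_sum lookup_mult_0)
    also have "\<dots> = (\<Sum>i\<le>n. if i = n then m n else 0)"
      by (intro sum.cong refl) (auto simp: lookup_Psi m)
    finally show ?thesis by simp
  qed
  \<comment> \<open>The Riccati equation: the constant term of \<open>\<Psi>\<close> is not a multiple of \<open>Y\<close>, hence the correction of \<open>A\<close> at 0.\<close>
  have Psi_Suc: "\<Psi> (Suc n) = binomial_conv A \<Psi> n" for n
  proof -
    have A: "wd [Y] * (\<Phi> i * wd [X] + pop k (\<Phi> i)) = A i" for i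
    proof (cases "i = 0")
      case True
      then show ?thesis by (simp add: A_def \<Psi>_def Phi_0 eps_1 algebra_simps)
    next
      case False
      then show ?thesis by (simp add: A_def \<Psi>_def pop_Y_mult algebra_simps)
    qed
    have "\<Psi> (Suc n) = wd [Y] * binomial_conv (\<lambda>i. \<Phi> i * wd [X] + pop k (\<Phi> i)) \<Psi> n"
      by (simp add: \<Psi>_def Phi_Suc)
    also have "\<dots> = binomial_conv (\<lambda>i. wd [Y] * (\<Phi> i * wd [X] + pop k (\<Phi> i))) \<Psi> n"
      unfolding binomial_conv_def sum_distrib_left
      by (intro sum.cong refl) (metis (no_types, lifting) mult.assoc mult_of_nat_commute)
    finally show ?thesis by (simp add: A)
  qed
  \<comment> \<open>Popping the product acts on \<open>\<Psi>\<close>, which starts with \<open>Y\<close>, except for its constant term 1, where it acts on \<open>\<Upsilon>\<close>.\<close>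
  have pop_E: "pop k (E i) = binomial_conv \<Upsilon> (\<lambda>j. pop k (\<Psi> j)) i + pop k (\<Upsilon> i)" for i
  proof -
    have 1: "pop k (\<Upsilon> j * \<Psi> (i - j)) = \<Upsilon> j * pop k (\<Psi> (i - j)) + (if j = i then pop k (\<Upsilon> i) else 0)"
      if "j \<le> i" for j
      using that by (auto simp: \<Psi>_def pop_mult_Y)
    have 2: "pop k (of_nat c * f) = of_nat c * pop k f" for c f
      using lin_ext_sc[of "pop_word k" "of_nat c" f] by (simp add: pop_def sc_simps)
    have "pop k (E i) = (\<Sum>j\<le>i. of_nat (i choose j) * pop k (\<Upsilon> j * \<Psi> (i - j)))"
      by (simp add: E_def binomial_conv_def 2[symmetric]) (simp add: pop_def lin_ext_sum)
    also have "\<dots> = (\<Sum>j\<le>i. of_nat (i choose j) * (\<Upsilon> j * pop k (\<Psi> (i - j)))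
                + (if j = i then pop k (\<Upsilon> i) else 0))"
      by (intro sum.cong refl) (auto simp: 1 algebra_simps)
    finally show ?thesis by (simp add: binomial_conv_def sum.distrib)
  qed
  have binomial_conv_delta: "binomial_conv f (\<lambda>i. if i = 0 then d else 0) n = f n * d" for f :: "nat \<Rightarrow> 'a ncpoly" and d n
  proof -
    have "binomial_conv f (\<lambda>i. if i = 0 then d else 0) n = (\<Sum>i\<le>n. if i = n then f n * d else 0)"
      unfolding binomial_conv_def by (intro sum.cong refl) auto
    then show ?thesis by simp
  qed
  have E_x: "binomial_conv \<Upsilon> (\<lambda>i. \<Psi> i * wd [X]) n = E n * wd [X]" for n
    by (simp add: E_def binomial_conv_def sum_distrib_right mult.assoc)
  have B: "\<Upsilon> (Suc i) + binomial_conv \<Upsilon> A i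
      = pop k (E i) + (E i - sc (m i)) * wd [X] - binomial_conv (\<lambda>i. eps k (\<Phi> i)) \<Upsilon> i" for i
  proof -
    have "binomial_conv \<Upsilon> A i = binomial_conv \<Upsilon> (\<lambda>j. pop k (\<Psi> j)) i + E i * wd [X]
        + \<Upsilon> i * ((wd [Y] - 1) * wd [X] + sc (k 1)) - binomial_conv \<Upsilon> (\<lambda>i. eps k (\<Phi> i)) i"
      unfolding A_def binomial_conv_minus_right binomial_conv_add_right E_x binomial_conv_delta ..
    also have "binomial_conv \<Upsilon> (\<lambda>i. eps k (\<Phi> i)) i = binomial_conv (\<lambda>i. eps k (\<Phi> i)) \<Upsilon> i"
      by (intro binomial_conv_commute) (simp add: eps_commute)
    finally show ?thesis
      by (simp add: Ups_Suc pop_E algebra_simps)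
  qed
  have main: "E n = sc (m n) \<and> m (Suc n) = - binomial_conv e m n" for n
  proof (induction n rule: less_induct)
    case (less n)
    \<comment> \<open>As long as \<open>E\<close> equals the scalar \<open>m\<close>, both \<open>pop E\<close> and \<open>(E - m) X\<close> vanish.\<close>
    have E_step: "E (Suc j) = sc (- binomial_conv e m j)" if "\<And>i. i \<le> j \<Longrightarrow> E i = sc (m i)" for j
    proof -
      have "E (Suc j) = binomial_conv (\<lambda>i. \<Upsilon> (Suc i)) \<Psi> j + binomial_conv \<Upsilon> (binomial_conv A \<Psi>) j"
        by (simp add: E_def binomial_conv_Suc Psi_Suc cong: binomial_conv_cong)
      also have "\<dots> = binomial_conv (\<lambda>i. \<Upsilon> (Suc i) + binomial_conv \<Upsilon> A i) \<Psi> j"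
        by (simp add: binomial_conv_add_left binomial_conv_assoc)
      also have "\<dots> = binomial_conv (\<lambda>i. - binomial_conv (\<lambda>i. eps k (\<Phi> i)) \<Upsilon> i) \<Psi> j"
      proof (rule binomial_conv_cong)
        fix i assume "i \<le> j"
        have "pop k (sc (m i)) = 0"
          using lin_ext_monom[of "pop_word k" "m i" "[]"] by (simp add: pop_def)
        then show "\<Upsilon> (Suc i) + binomial_conv \<Upsilon> A i = - binomial_conv (\<lambda>i. eps k (\<Phi> i)) \<Upsilon> i"
          by (simp add: B that \<open>i \<le> j\<close>)
      qed simp
      also have "\<dots> = - binomial_conv (\<lambda>i. eps k (\<Phi> i)) E j"
        by (simp add: binomial_conv_uminus_left binomial_conv_assoc E_def)
      also have "binomial_conv (\<lambda>i. eps k (\<Phi> i)) E j = sc (binomial_conv e m j)"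
        unfolding binomial_conv_def sc_sum
        by (intro sum.cong refl) (simp add: that e sc_simps)
      finally show ?thesis by (simp add: sc_simps)
    qed
    have En: "E n = sc (m n)"
    proof (cases n)
      case 0
      then show ?thesis by (simp add: E_def \<Psi>_def Ups_0 m sc_simps)
    next
      case (Suc j)
      have "E (Suc j) = sc (- binomial_conv e m j)"
        using less Suc by (intro E_step) auto
      then show ?thesis
        using Suc less[of j] by simp
    qed
    have "E (Suc n) = sc (- binomial_conv e m n)"
      using less En by (intro E_step) (auto simp: le_less)
    then show ?case
      using En E_lookup[of "Suc n"] by (simp add: lookup_sc)
  qed
  then show ?thesis by blast
qed

section \<open>Set partitions and the moments of classical cumulants\<close>

lemma sum_subsets_by_card:
  fixes f :: "nat \<Rightarrow> 'b::ring_1"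
  assumes "finite A"
  shows "(\<Sum>B\<in>Pow A. f (card B)) = (\<Sum>i\<le>card A. of_nat (card A choose i) * f i)"
proof -
  have "(\<Sum>B\<in>Pow A. f (card B)) = (\<Sum>i\<le>card A. \<Sum>B\<in>{B \<in> Pow A. card B = i}. f (card B))"
    using assms by (intro sum.group[symmetric]) (auto intro: card_mono)
  also have "\<dots> = (\<Sum>i\<le>card A. of_nat (card A choose i) * f i)"
  proof (intro sum.cong refl)
    fix i
    have "card {B \<in> Pow A. card B = i} = card A choose i"
      using n_subsets[OF assms, of i] by simp
    then show "(\<Sum>B\<in>{B \<in> Pow A. card B = i}. f (card B)) = of_nat (card A choose i) * f i"
      by simp
  qed
  finally show ?thesis .
qed

text \<open>The recursion is the coefficient form of \<open>M' = C' M\<close>.\<close>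

fun moment :: "(nat \<Rightarrow> 'a::field) \<Rightarrow> nat \<Rightarrow> 'a" where
  "moment c 0 = 1"
| "moment c (Suc n) = (\<Sum>i\<le>n. of_nat (n choose i) * (c (Suc i) * moment c (n - i)))"

lemma partition_on_same_block:
  assumes "partition_on A Q" "C \<in> Q" "D \<in> Q" "x \<in> C" "x \<in> D"
  shows "C = D"
  using partition_onD2[OF assms(1)] assms(2-5) unfolding disjoint_def by (metis IntI empty_iff)

lemma partition_on_remove:
  assumes "partition_on A Q" "C \<in> Q"
  shows "partition_on (A - C) (Q - {C})"
proof -
  have "disjnt C (\<Union>(Q - {C}))"
    using partition_on_same_block[OF assms(1,2)] by (auto simp: disjnt_def)
  then show ?thesis
    using partition_on_insert[of C "Q - {C}" A] assms by (simp add: insert_absorb)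
qed

lemma partition_on_add:
  assumes "partition_on (A - C) P" "C \<subseteq> A" "C \<noteq> {}"
  shows "partition_on A (insert C P)" and "C \<notin> P"
proof -
  have "disjnt C (\<Union>P)"
    using partition_onD1[OF assms(1)] by (auto simp: disjnt_def)
  then show "partition_on A (insert C P)" "C \<notin> P"
    using assms by (auto simp: partition_on_insert disjnt_def)
qed

text \<open>A partition of \<open>insert a A\<close> is determined by the other elements \<open>B\<close> of the block of \<open>a\<close> and a
  partition of the rest.\<close>

lemma sum_partitions_insert:
  fixes c :: "nat \<Rightarrow> 'a::field"
  assumes "finite A" "a \<notin> A"
  shows "(\<Sum>Q\<in>{Q. partition_on (insert a A) Q}. partition_weight c Q)
       = (\<Sum>B\<in>Pow A. c (Suc (card B)) * (\<Sum>P\<in>{P. partition_on (A - B) P}. partition_weight c P))"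
proof -
  let ?C = "\<lambda>Q. THE C. C \<in> Q \<and> a \<in> C"
  let ?S = "SIGMA B:Pow A. {P. partition_on (A - B) P}"
  have fin: "finite {P. partition_on (A - B) P}" for B
    using assms by (intro finitely_many_partition_on) auto
  have "(\<Sum>Q\<in>{Q. partition_on (insert a A) Q}. partition_weight c Q)
      = (\<Sum>(B, P)\<in>?S. c (Suc (card B)) * partition_weight c P)"
  proof (rule sum.reindex_bij_witness[of _ "\<lambda>(B, P). insert (insert a B) P"
        "\<lambda>Q. (?C Q - {a}, Q - {?C Q})"])
    fix Q assume Q: "Q \<in> {Q. partition_on (insert a A) Q}"
    then obtain C where C: "C \<in> Q" "a \<in> C" by (auto simp: partition_on_def)
    have The: "(THE C. C \<in> Q \<and> a \<in> C) = C"
      using C Q by (intro the_equality) (auto dest: partition_on_same_block)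
    have "insert a A - C = A - (C - {a})" using C assms by auto
    then have r: "C - {a} \<subseteq> A" "partition_on (A - (C - {a})) (Q - {C})" "insert a (C - {a}) = C"
      using partition_on_remove[of "insert a A" Q C] partition_onD1[of "insert a A" Q] Q C by auto
    show "(case (?C Q - {a}, Q - {?C Q}) of (B, P) \<Rightarrow> insert (insert a B) P) = Q"
      unfolding The using r(3) C by auto
    show "(?C Q - {a}, Q - {?C Q}) \<in> ?S"
      unfolding The using r by simp
    have "finite Q" using Q finite_elements[of "insert a A" Q] assms by auto
    then have "partition_weight c Q = c (card C) * partition_weight c (Q - {C})"
      unfolding partition_weight_def using C by (simp add: prod.remove)
    moreover have "finite C" using r(1) assms finite_subset[of "C - {a}" A] by simp
    then have "card C = Suc (card (C - {a}))" using C by (metis card_Suc_Diff1)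
    ultimately show "(case (?C Q - {a}, Q - {?C Q}) of
        (B, P) \<Rightarrow> c (Suc (card B)) * partition_weight c P) = partition_weight c Q"
      unfolding The by simp
  next
    fix BP assume "BP \<in> ?S"
    then obtain B P where BP: "BP = (B, P)" "B \<subseteq> A" "partition_on (A - B) P" by auto
    have "insert a A - insert a B = A - B" using assms by auto
    then have i: "partition_on (insert a A) (insert (insert a B) P)" "insert a B \<notin> P"
      using partition_on_add[of "insert a A" "insert a B" P] BP by auto
    show "(case BP of (B, P) \<Rightarrow> insert (insert a B) P) \<in> {Q. partition_on (insert a A) Q}"
      using i BP by simp
    have "(THE C. C \<in> insert (insert a B) P \<and> a \<in> C) = insert a B"
      using i(1) by (intro the_equality) (auto dest: partition_on_same_block)
    then show "(?C (case BP of (B, P) \<Rightarrow> insert (insert a B) P) - {a},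
        (case BP of (B, P) \<Rightarrow> insert (insert a B) P) - {?C (case BP of (B, P) \<Rightarrow> insert (insert a B) P)}) = BP"
      using i BP assms by auto
  qed
  also have "\<dots> = (\<Sum>B\<in>Pow A. c (Suc (card B)) * (\<Sum>P\<in>{P. partition_on (A - B) P}. partition_weight c P))"
    using assms fin by (subst sum.Sigma[symmetric]) (auto simp: sum_distrib_left)
  finally show ?thesis .
qed

lemma sum_partitions_eq_moment:
  assumes "finite A"
  shows "(\<Sum>P\<in>{P. partition_on A P}. partition_weight c P) = moment c (card A)"
  using assms
proof (induction "card A" arbitrary: A rule: less_induct)
  case less
  show ?case
  proof (cases "A = {}")
    case True
    then have "{P. partition_on A P} = {{}}" by (auto simp: partition_on_empty)
    then show ?thesis using True by (simp add: partition_weight_def)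
  next
    case False
    then obtain a A' where A: "A = insert a A'" "a \<notin> A'" "finite A'"
      using less.prems by (metis finite_insert mk_disjoint_insert ex_in_conv)
    have "(\<Sum>P\<in>{P. partition_on A P}. partition_weight c P)
        = (\<Sum>B\<in>Pow A'. c (Suc (card B)) * moment c (card A' - card B))"
      unfolding A(1) sum_partitions_insert[OF A(3,2)]
    proof (intro sum.cong refl)
      fix B assume B: "B \<in> Pow A'"
      have "card (A' - B) = card A' - card B"
        using B A by (simp add: card_Diff_subset finite_subset)
      moreover have "card (A' - B) < card A"
        using A card_mono[of A' "A' - B"] by simp
      ultimately show "c (Suc (card B)) * (\<Sum>P\<in>{P. partition_on (A' - B) P}. partition_weight c P)
           = c (Suc (card B)) * moment c (card A' - card B)"
        using less.hyps[of "A' - B"] A by simp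
    qed
    also have "\<dots> = moment c (card A)"
      using A sum_subsets_by_card[OF A(3), of "\<lambda>i. c (Suc i) * moment c (card A' - i)"] by simp
    finally show ?thesis .
  qed
qed

lemma classical_moment:
  assumes "classical_cumulants_of m c" "n \<ge> 1"
  shows "m n = moment c n"
  using assms sum_partitions_eq_moment[of "{1..n}" c]
  by (simp add: classical_cumulants_of_def set_partitions_def)

section \<open>Noncrossing partitions read from left to right\<close>

text \<open>The second crossing pattern is the first one with the two blocks exchanged, so over all ordered
  pairs of blocks one pattern suffices.\<close>

lemma noncrossing_iff:
  "noncrossing P \<longleftrightarrow> (\<forall>B\<in>P. \<forall>D\<in>P. B \<noteq> D \<longrightarrow>
     (\<forall>i\<in>B. \<forall>j\<in>B. \<forall>d\<in>D. \<forall>e\<in>D. \<not> (i < d \<and> d < j \<and> j < e)))"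
proof
  assume L: "noncrossing P"
  show "\<forall>B\<in>P. \<forall>D\<in>P. B \<noteq> D \<longrightarrow>
     (\<forall>i\<in>B. \<forall>j\<in>B. \<forall>d\<in>D. \<forall>e\<in>D. \<not> (i < d \<and> d < j \<and> j < e))"
  proof (intro ballI impI notI)
    fix B D i j d e
    assume *: "B \<in> P" "D \<in> P" "B \<noteq> D" "i \<in> B" "j \<in> B" "d \<in> D" "e \<in> D" "i < d \<and> d < j \<and> j < e"
    show False
      using L unfolding noncrossing_def
    proof (elim notE)
      show "\<exists>B\<in>P. \<exists>B'\<in>P. B \<noteq> B' \<and> (\<exists>i\<in>B. \<exists>j\<in>B. \<exists>i'\<in>B'. \<exists>j'\<in>B'.
          i < i' \<and> i' < j \<and> j < j' \<or> i' < i \<and> j < i' \<and> j' < j)"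
        by (rule bexI[of _ B], rule bexI[of _ D], rule conjI[OF *(3)], rule bexI[of _ i],
            rule bexI[of _ j], rule bexI[of _ d], rule bexI[of _ e], rule disjI1)
          (rule *)+
    qed
  qed
next
  assume R: "\<forall>B\<in>P. \<forall>D\<in>P. B \<noteq> D \<longrightarrow>
     (\<forall>i\<in>B. \<forall>j\<in>B. \<forall>d\<in>D. \<forall>e\<in>D. \<not> (i < d \<and> d < j \<and> j < e))"
  show "noncrossing P"
    unfolding noncrossing_def
  proof (rule notI, elim bexE conjE)
    fix B D i j d e
    assume *: "B \<in> P" "D \<in> P" "B \<noteq> D" "i \<in> B" "j \<in> B" "d \<in> D" "e \<in> D"
    assume "i < d \<and> d < j \<and> j < e \<or> d < i \<and> j < d \<and> e < j"
    then show False
    proof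
      assume "i < d \<and> d < j \<and> j < e"
      then show False using R[rule_format, OF *] by simp
    next
      assume "d < i \<and> j < d \<and> e < j"
      then show False using R[rule_format, OF *(2,1) *(3)[symmetric] *(7,6,5,4)] by simp
    qed
  qed
qed

lemma noncrossingD:
  assumes "noncrossing P" "B \<in> P" "D \<in> P" "B \<noteq> D" "i \<in> B" "j \<in> B" "d \<in> D" "e \<in> D"
  shows "\<not> (i < d \<and> d < j \<and> j < e)"
  by (rule assms(1)[unfolded noncrossing_iff, rule_format, OF assms(2-8)])

lemma noncrossingI:
  assumes "\<And>B D i j d e. B \<in> P \<Longrightarrow> D \<in> P \<Longrightarrow> B \<noteq> D \<Longrightarrow> i \<in> B \<Longrightarrow> j \<in> B \<Longrightarrow> d \<in> D \<Longrightarrow> e \<in> D \<Longrightarrow>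
    i < d \<Longrightarrow> d < j \<Longrightarrow> j < e \<Longrightarrow> False"
  shows "noncrossing P"
  unfolding noncrossing_iff
proof (intro ballI impI notI)
  fix B D i j d e
  assume *: "B \<in> P" "D \<in> P" "B \<noteq> D" "i \<in> B" "j \<in> B" "d \<in> D" "e \<in> D" "i < d \<and> d < j \<and> j < e"
  show False
    by (rule assms[OF *(1-7)]) (use *(8) in simp_all)
qed

lemma noncrossing_replace:
  assumes "noncrossing P" "B \<in> P" "B' \<subseteq> B"
  shows "noncrossing (insert B' (P - {B}))"
proof (rule noncrossingI)
  fix D E i j d e
  assume *: "D \<in> insert B' (P - {B})" "E \<in> insert B' (P - {B})" "D \<noteq> E"
    "i \<in> D" "j \<in> D" "d \<in> E" "e \<in> E" "i < d" "d < j" "j < e"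
  have "\<exists>D'\<in>P. \<exists>E'\<in>P. D' \<noteq> E' \<and> D \<subseteq> D' \<and> E \<subseteq> E'"
    using *(1-3) assms(2,3) by (metis DiffE insertE order_refl singletonI)
  then obtain D' E' where "D' \<in> P" "E' \<in> P" "D' \<noteq> E'" "D \<subseteq> D'" "E \<subseteq> E'" by blast
  then show False
    using noncrossingD[OF assms(1), of D' E' i j d e] * by auto
qed

lemma noncrossing_insert:
  assumes "noncrossing P"
    and "\<And>D i j d e. D \<in> P \<Longrightarrow> i \<in> B \<Longrightarrow> j \<in> B \<Longrightarrow> d \<in> D \<Longrightarrow> e \<in> D \<Longrightarrow>
      i < d \<Longrightarrow> d < j \<Longrightarrow> j < e \<Longrightarrow> False"
    and "\<And>D i j d e. D \<in> P \<Longrightarrow> i \<in> D \<Longrightarrow> j \<in> D \<Longrightarrow> d \<in> B \<Longrightarrow> e \<in> B \<Longrightarrow>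
      i < d \<Longrightarrow> d < j \<Longrightarrow> j < e \<Longrightarrow> False"
  shows "noncrossing (insert B P)"
proof (rule noncrossingI)
  fix D E i j d e
  assume *: "D \<in> insert B P" "E \<in> insert B P" "D \<noteq> E"
    "i \<in> D" "j \<in> D" "d \<in> E" "e \<in> E" "i < d" "d < j" "j < e"
  then consider "D = B" "E \<in> P" | "E = B" "D \<in> P" | "D \<in> P" "E \<in> P" by auto
  then show False
  proof cases
    case 1
    show ?thesis by (rule assms(2)[of E i j d e]) (use 1 * in simp_all)
  next
    case 2
    show ?thesis by (rule assms(3)[of D i j d e]) (use 2 * in simp_all)
  next
    case 3
    show ?thesis using noncrossingD[OF assms(1) 3 *(3-7)] * by simp
  qed
qed

lemma noncrossing_subset: "noncrossing P \<Longrightarrow> Q \<subseteq> P \<Longrightarrow> noncrossing Q"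
proof (rule noncrossingI)
  fix B D i j d e
  assume *: "noncrossing P" "Q \<subseteq> P" "B \<in> Q" "D \<in> Q" "B \<noteq> D" "i \<in> B" "j \<in> B" "d \<in> D" "e \<in> D"
    "i < d" "d < j" "j < e"
  have "B \<in> P" "D \<in> P" using *(2-4) by auto
  from noncrossingD[OF *(1) this *(5-9)] show False using *(10-12) by simp
qed

definition set_less :: "nat set \<Rightarrow> nat set \<Rightarrow> bool" where
  "set_less A B \<longleftrightarrow> (\<forall>a\<in>A. \<forall>b\<in>B. a < b)"

definition under_arch :: "nat set \<Rightarrow> nat set \<Rightarrow> bool" where
  "under_arch B D \<longleftrightarrow> (\<exists>i\<in>D. \<exists>j\<in>D. \<exists>b\<in>B. i < b \<and> b < j)"

text \<open>The snapshots of a noncrossing partition after its first \<open>n\<close> points have been read.  \<open>C\<close> holds the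
  finished blocks and \<open>os\<close> the started ones, oldest first.  A later block lies above an earlier one
  and has to be finished before the earlier one receives another point; thus all points of an
  earlier open block precede those of a later one, and an open block, which will get a point beyond
  \<open>n\<close>, cannot have points below an arch of a finished block.\<close>

definition open_partitions :: "nat \<Rightarrow> (nat set set \<times> nat set list) set" where
  "open_partitions n = {(C, os).
     partition_on {1..n} (C \<union> set os) \<and> C \<inter> set os = {} \<and> noncrossing (C \<union> set os) \<and>
     sorted_wrt set_less os \<and> (\<forall>D\<in>C. \<forall>B\<in>set os. \<not> under_arch B D)}"

text \<open>The next point \<open>N\<close> is a finished singleton, starts a block, joins the top block, or finishes it.\<close>

fun extensions :: "nat \<Rightarrow> nat set set \<times> nat set list \<Rightarrow> (nat set set \<times> nat set list) set" where
  "extensions N (C, os) = {(insert {N} C, os), (C, os @ [{N}])} \<union>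
     (if os = [] then {} else
       {(C, butlast os @ [insert N (last os)]), (insert (insert N (last os)) C, butlast os)})"

definition restriction :: "nat \<Rightarrow> nat set set \<times> nat set list \<Rightarrow> nat set set \<times> nat set list" where
  "restriction N = (\<lambda>(C, os).
     if N \<in> \<Union>C then
       (let B = THE B. B \<in> C \<and> N \<in> B in
        if B = {N} then (C - {B}, os) else (C - {B}, os @ [B - {N}]))
     else if last os = {N} then (C, butlast os) else (C, butlast os @ [last os - {N}]))"

lemma open_partitionsD:
  assumes "(C, os) \<in> open_partitions n"
  shows "partition_on {1..n} (C \<union> set os)" "C \<inter> set os = {}" "noncrossing (C \<union> set os)"
    "sorted_wrt set_less os" "\<And>D B. D \<in> C \<Longrightarrow> B \<in> set os \<Longrightarrow> \<not> under_arch B D"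
    "\<And>B i. B \<in> C \<union> set os \<Longrightarrow> i \<in> B \<Longrightarrow> i \<le> n" "{} \<notin> C \<union> set os"
  using assms partition_onD1[of "{1..n}" "C \<union> set os"] partition_onD3[of "{1..n}" "C \<union> set os"]
  by (auto simp: open_partitions_def)

lemma open_partitionsI:
  assumes "partition_on {1..n} (C \<union> set os)" "C \<inter> set os = {}" "noncrossing (C \<union> set os)"
    "sorted_wrt set_less os" "\<And>D B. D \<in> C \<Longrightarrow> B \<in> set os \<Longrightarrow> \<not> under_arch B D"
  shows "(C, os) \<in> open_partitions n"
  using assms by (simp add: open_partitions_def)

lemma distinct_if_sorted_set_less: "sorted_wrt set_less os \<Longrightarrow> {} \<notin> set os \<Longrightarrow> distinct os"
  by (induction os) (auto simp: set_less_def)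

lemma restriction_closed:
  assumes "partition_on A C" "B \<in> C" "N \<in> B"
  shows "restriction N (C, os) =
    (if B = {N} then (C - {B}, os) else (C - {B}, os @ [B - {N}]))"
proof -
  have "(THE B. B \<in> C \<and> N \<in> B) = B"
    using assms by (intro the_equality) (auto dest: partition_on_same_block)
  then show ?thesis
    using assms by (auto simp: restriction_def Let_def)
qed

lemma restriction_open:
  assumes "N \<notin> \<Union>C"
  shows "restriction N (C, os @ [L]) =
    (if L = {N} then (C, os) else (C, os @ [L - {N}]))"
  using assms by (simp add: restriction_def)

lemma partition_on_subset: "partition_on A P \<Longrightarrow> Q \<subseteq> P \<Longrightarrow> partition_on (\<Union>Q) Q"
  unfolding partition_on_def using pairwise_subset[of disjnt P Q] by blast

lemma atLeastAtMost_Suc_Diff: "{1..Suc n} - insert (Suc n) B = {1..n} - B"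
  by auto

lemma partition_on_add_singleton:
  "partition_on {1..n} P \<Longrightarrow> partition_on {1..Suc n} (insert {Suc n} P)"
  using partition_on_add(1)[of "{1..Suc n}" "{Suc n}" P] atLeastAtMost_Suc_Diff[of n "{}"] by simp

lemma partition_on_enlarge:
  assumes "partition_on {1..n} P" "B \<in> P"
  shows "partition_on {1..Suc n} (insert (insert (Suc n) B) (P - {B}))"
proof (rule partition_on_add(1))
  show "partition_on ({1..Suc n} - insert (Suc n) B) (P - {B})"
    unfolding atLeastAtMost_Suc_Diff by (rule partition_on_remove[OF assms])
  have "B \<subseteq> {1..n}" using partition_onD1[OF assms(1)] assms(2) by auto
  then show "insert (Suc n) B \<subseteq> {1..Suc n}" by auto
qed simp

lemma partition_on_shrink:
  assumes "partition_on {1..Suc n} P" "B \<in> P" "Suc n \<in> B"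
  shows "B \<noteq> {Suc n} \<Longrightarrow> partition_on {1..n} (insert (B - {Suc n}) (P - {B}))"
    and "B = {Suc n} \<Longrightarrow> partition_on {1..n} (P - {B})"
proof -
  have B: "insert (Suc n) (B - {Suc n}) = B" using assms by auto
  have 1: "partition_on ({1..n} - (B - {Suc n})) (P - {B})"
    using partition_on_remove[OF assms(1,2)] atLeastAtMost_Suc_Diff[of n "B - {Suc n}"]
    unfolding B by simp
  have "B \<subseteq> {1..Suc n}"
    using partition_onD1[OF assms(1)] assms(2) by auto
  then show "B \<noteq> {Suc n} \<Longrightarrow> partition_on {1..n} (insert (B - {Suc n}) (P - {B}))"
    using 1 assms by (intro partition_on_add(1)) auto
  show "B = {Suc n} \<Longrightarrow> partition_on {1..n} (P - {B})"
    using 1 by simp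
qed

text \<open>The top block may receive the next point: no finished block arches over any of its points, and all
  older open blocks lie entirely to its left.\<close>

lemma noncrossing_enlarge_last:
  assumes "(C, os @ [L]) \<in> open_partitions n"
  shows "noncrossing (insert (insert (Suc n) L) (C \<union> set os))"
proof (rule noncrossing_insert)
  note D = open_partitionsD[OF assms]
  have dist: "distinct (os @ [L])"
    using distinct_if_sorted_set_less[OF D(4)] D(7) by simp
  show "noncrossing (C \<union> set os)"
    by (rule noncrossing_subset[OF D(3)]) auto
  fix B i j d e
  assume B: "B \<in> C \<union> set os"
  then have neq: "L \<noteq> B" using dist D(2) by auto
  have small: "x < Suc n" if "x \<in> B" for x
    using D(6)[of B x] B that by auto
  {
    assume *: "i \<in> insert (Suc n) L" "j \<in> insert (Suc n) L" "d \<in> B" "e \<in> B" "i < d" "d < j" "j < e"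
    then have "i \<in> L" "j \<in> L" using small[of d] small[of e] by auto
    then show False
      using noncrossingD[OF D(3) _ _ neq, of i j d e] B * by auto
  }
  {
    assume *: "i \<in> B" "j \<in> B" "d \<in> insert (Suc n) L" "e \<in> insert (Suc n) L" "i < d" "d < j" "j < e"
    then have d: "d \<in> L" using small[of j] by auto
    show False
    proof (cases "B \<in> C")
      case True
      then show ?thesis using D(5)[of B L] * d by (auto simp: under_arch_def)
    next
      case False
      then have "set_less B L" using B D(4) by (auto simp: sorted_wrt_append)
      then have "j < d" using * d by (auto simp: set_less_def)
      then show ?thesis using * by simp
    qed
  }
qed

text \<open>Together with the next lemma this says that \<open>extensions\<close> and \<open>restriction\<close> describe the same
  relation, so each snapshot after \<open>n + 1\<close> points arises from exactly one snapshot after \<open>n\<close> points.\<close>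

lemma extensions_sound:
  assumes s: "s \<in> open_partitions n" and t: "t \<in> extensions (Suc n) s"
  shows "t \<in> open_partitions (Suc n)" and "restriction (Suc n) t = s"
proof -
  obtain C os where s_eq: "s = (C, os)" by (cases s)
  note D = open_partitionsD[OF s[unfolded s_eq]]
  let ?N = "Suc n"
  have small: "i \<le> n" if "i \<in> B" "B \<in> C \<or> B \<in> set os" for i B
    using D(6) that by auto
  have N_notin: "?N \<notin> B" if "B \<in> C \<or> B \<in> set os" for B
    using small[of ?N B] that by auto
  have N_single: "{?N} \<notin> C" "{?N} \<notin> set os"
    using N_notin by blast+
  have nc_single: "noncrossing (insert {?N} (C \<union> set os))"
    by (rule noncrossing_insert[OF D(3)]) auto
  have top_block: "\<And>B. B \<in> set os' \<Longrightarrow> set_less B L" "C \<union> set os - {L} = C \<union> set os'"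
    if os: "os = os' @ [L]" for os' L
  proof -
    show "set_less B L" if "B \<in> set os'" for B
      using D(4) that os by (simp add: sorted_wrt_append)
    have "distinct os"
      using distinct_if_sorted_set_less[OF D(4)] D(7) by simp
    then show "C \<union> set os - {L} = C \<union> set os'"
      using D(2) os by auto
  qed
  consider (closed_single) "t = (insert {?N} C, os)" | (open_single) "t = (C, os @ [{?N}])"
    | (enlarge) L os' where "os = os' @ [L]" "t = (C, os' @ [insert ?N L])"
    | (close) L os' where "os = os' @ [L]" "t = (insert (insert ?N L) C, os')"
    using t unfolding s_eq
    by (cases os rule: rev_cases) (auto simp: butlast_append)
  then show "t \<in> open_partitions ?N" and "restriction ?N t = s"
  proof (atomize(full), cases)
    case closed_single
    have "noncrossing (insert {?N} (C \<union> set os))"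
      by (rule nc_single)
    moreover have "\<not> under_arch B {?N}" for B
      by (simp add: under_arch_def)
    ultimately have 1: "t \<in> open_partitions ?N"
      unfolding closed_single
    proof (intro open_partitionsI)
      show "insert {?N} C \<inter> set os = {}" using D(2) N_single by auto
      show "\<not> under_arch A B" if "B \<in> insert {?N} C" "A \<in> set os"
          "\<And>B. \<not> under_arch B {?N}" for A B
        using that D(5)[of B A] by auto
    qed (use partition_on_add_singleton[OF D(1)] D(4) in simp_all)
    have "partition_on (\<Union>(insert {?N} C)) (insert {?N} C)"
      by (rule partition_on_subset[OF partition_on_add_singleton[OF D(1)]]) auto
    from restriction_closed[OF this, of "{?N}" ?N os]
    have "restriction ?N t = (insert {?N} C - {{?N}}, os)"
      unfolding closed_single by simp
    also have "insert {?N} C - {{?N}} = C" using N_single by auto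
    finally show "t \<in> open_partitions ?N \<and> restriction ?N t = s"
      using 1 s_eq by simp
  next
    case open_single
    have "noncrossing (insert {?N} (C \<union> set os))"
      by (rule nc_single)
    moreover have "\<not> under_arch {?N} B" if "B \<in> C" for B
    proof -
      have "\<not> ?N < j" if "j \<in> B" for j using small[of j B] that \<open>B \<in> C\<close> by simp
      then show ?thesis by (auto simp: under_arch_def)
    qed
    moreover have "sorted_wrt set_less (os @ [{?N}])"
    proof -
      have "b < ?N" if "b \<in> B" "B \<in> set os" for b B
        using small[OF that(1)] that(2) by simp
      then show ?thesis
        using D(4) by (simp add: sorted_wrt_append set_less_def)
    qed
    ultimately have 1: "t \<in> open_partitions ?N"
      unfolding open_single
    proof (intro open_partitionsI)
      show "C \<inter> set (os @ [{?N}]) = {}" using D(2) N_single by auto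
      show "\<not> under_arch A B" if "B \<in> C" "A \<in> set (os @ [{?N}])"
          "\<And>B. B \<in> C \<Longrightarrow> \<not> under_arch {?N} B" for A B
        using that D(5)[of B A] by auto
    qed (use partition_on_add_singleton[OF D(1)] in simp_all)
    then show "t \<in> open_partitions ?N \<and> restriction ?N t = s"
    proof -
      have "?N \<notin> \<Union>C" using N_notin by blast
      from restriction_open[OF this, of os "{?N}"] show ?thesis
        using 1 unfolding open_single s_eq by simp
    qed
  next
    case enlarge
    note top = top_block[OF enlarge(1)]
    have nc: "noncrossing (insert (insert ?N L) (C \<union> set os'))"
      by (rule noncrossing_enlarge_last[OF s[unfolded s_eq enlarge(1)]])
    have "\<not> under_arch (insert ?N L) B" if "B \<in> C" for B
    proof -
      have "\<not> ?N < j" if "j \<in> B" for j using small[of j B] that \<open>B \<in> C\<close> by simp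
      moreover have "\<not> under_arch L B" using D(5) that enlarge(1) by simp
      ultimately show ?thesis unfolding under_arch_def by blast
    qed
    moreover have "sorted_wrt set_less (os' @ [insert ?N L])"
    proof -
      have "set_less B (insert ?N L)" if "B \<in> set os'" for B
      proof -
        have "b < ?N" if "b \<in> B" for b
          using small[OF that] \<open>B \<in> set os'\<close> enlarge(1) by simp
        then show ?thesis using top(1)[OF that] by (simp add: set_less_def)
      qed
      then show ?thesis
        using D(4) enlarge(1) by (simp add: sorted_wrt_append)
    qed
    moreover have "partition_on {1..?N} (insert (insert ?N L) (C \<union> set os'))"
      using partition_on_enlarge[OF D(1), of L] enlarge(1) unfolding top(2) by simp
    ultimately have 1: "t \<in> open_partitions ?N"
      unfolding enlarge(2)
    proof (intro open_partitionsI)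
      show "C \<inter> set (os' @ [insert ?N L]) = {}"
        using D(2) N_notin[of "insert ?N L"] enlarge(1) by auto
      show "\<not> under_arch A B" if "B \<in> C" "A \<in> set (os' @ [insert ?N L])"
          "\<And>B. B \<in> C \<Longrightarrow> \<not> under_arch (insert ?N L) B" for A B
        using that D(5)[of B A] enlarge(1) by auto
    qed (use nc in simp_all)
    have L: "L \<noteq> {}" "?N \<notin> L" using D(7) N_notin[of L] enlarge(1) by auto
    have "?N \<notin> \<Union>C" using N_notin by blast
    from restriction_open[OF this, of os' "insert ?N L"] have "restriction ?N t = s"
      unfolding enlarge(2) s_eq enlarge(1) using L by auto
    then show "t \<in> open_partitions ?N \<and> restriction ?N t = s"
      using 1 by simp
  next
    case close
    note top = top_block[OF close(1)]
    have nc: "noncrossing (insert (insert ?N L) (C \<union> set os'))"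
      by (rule noncrossing_enlarge_last[OF s[unfolded s_eq close(1)]])
    have "\<not> under_arch B (insert ?N L)" if "B \<in> set os'" for B
    proof
      assume "under_arch B (insert ?N L)"
      then obtain i b where *: "i \<in> insert ?N L" "b \<in> B" "i < b"
        unfolding under_arch_def by blast
      have "b \<le> n" using small[of b B] *(2) that close(1) by simp
      then have "i \<in> L" using *(1,3) by auto
      then have "b < i" using top(1)[OF that] *(2) unfolding set_less_def by blast
      then show False using *(3) by simp
    qed
    moreover have part: "partition_on {1..?N} (insert (insert ?N L) (C \<union> set os'))"
      using partition_on_enlarge[OF D(1), of L] close(1) unfolding top(2) by simp
    ultimately have 1: "t \<in> open_partitions ?N"
      unfolding close(2)
    proof (intro open_partitionsI)
      show "insert (insert ?N L) C \<inter> set os' = {}"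
        using D(2) N_notin[of "insert ?N L"] close(1) by auto
      show "sorted_wrt set_less os'"
        using D(4) close(1) by (simp add: sorted_wrt_append)
      show "\<not> under_arch A B" if "B \<in> insert (insert ?N L) C" "A \<in> set os'"
          "\<And>B. B \<in> set os' \<Longrightarrow> \<not> under_arch B (insert ?N L)" for A B
        using that D(5)[of B A] close(1) by auto
    qed (use nc in simp_all)
    have L: "L \<noteq> {}" "?N \<notin> L" using D(7) N_notin[of L] close(1) by auto
    have "partition_on (\<Union>(insert (insert ?N L) C)) (insert (insert ?N L) C)"
      by (rule partition_on_subset[OF part]) auto
    from restriction_closed[OF this, of "insert ?N L" ?N os']
    have "restriction ?N t = (insert (insert ?N L) C - {insert ?N L}, os' @ [insert ?N L - {?N}])"
      unfolding close(2) using L by auto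
    also have "insert (insert ?N L) C - {insert ?N L} = C"
      using N_notin[of "insert ?N L"] by auto
    also have "insert ?N L - {?N} = L"
      using L by auto
    finally show "t \<in> open_partitions ?N \<and> restriction ?N t = s"
      using 1 s_eq close(1) by simp
  qed
qed

text \<open>If the last point lies in a finished block with other points, that block goes back on top of the
  stack.  It belongs there: a point of an open block to the right of one of its points would lie
  below the arch that ends in the last point.\<close>

lemma restriction_sound:
  assumes t: "t \<in> open_partitions (Suc n)"
  shows "restriction (Suc n) t \<in> open_partitions n"
    and "t \<in> extensions (Suc n) (restriction (Suc n) t)"
proof -
  obtain C os where t_eq: "t = (C, os)" by (cases t)
  note D = open_partitionsD[OF t[unfolded t_eq]]
  let ?N = "Suc n"
  have ex: "?N \<in> \<Union>(C \<union> set os)"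
    unfolding partition_onD1[OF D(1), symmetric] by simp
  have less_N: "i < ?N" if "i \<in> B" "B \<in> C \<or> B \<in> set os" "?N \<notin> B" for i B
  proof -
    have "i \<le> ?N" using D(6)[of B i] that(1,2) by blast
    moreover have "i \<noteq> ?N" using that(1,3) by blast
    ultimately show ?thesis by simp
  qed
  show "restriction ?N t \<in> open_partitions n" and "t \<in> extensions ?N (restriction ?N t)"
  proof (atomize(full), cases "?N \<in> \<Union>C")
    case True
    then obtain B where B: "B \<in> C" "?N \<in> B" by auto
    have "partition_on (\<Union>C) C"
      by (rule partition_on_subset[OF D(1)]) auto
    note r = restriction_closed[OF this B, of os]
    have B_os: "B \<notin> set os" using B D(2) by auto
    have other: "?N \<notin> D" if "D \<in> C \<union> set os" "D \<noteq> B" for D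
      using partition_on_same_block[OF D(1) _ that(1) B(2)] that(2) B(1) by blast
    have eq: "C \<union> set os - {B} = C - {B} \<union> set os" using B_os by auto
    show "restriction ?N t \<in> open_partitions n \<and> t \<in> extensions ?N (restriction ?N t)"
    proof (cases "B = {?N}")
      case B1: True
      have "(C - {B}, os) \<in> open_partitions n"
      proof (rule open_partitionsI)
        show "partition_on {1..n} (C - {B} \<union> set os)"
          using partition_on_shrink(2)[OF D(1) _ B(2) B1] B(1) eq by simp
        show "noncrossing (C - {B} \<union> set os)"
          by (rule noncrossing_subset[OF D(3)]) blast
        show "(C - {B}) \<inter> set os = {}" using D(2) by blast
        show "sorted_wrt set_less os" by (rule D(4))
        show "\<not> under_arch A E" if "E \<in> C - {B}" "A \<in> set os" for E A
          using D(5) that by simp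
      qed
      moreover have "t \<in> extensions ?N (C - {B}, os)"
        using t_eq B(1) unfolding B1 by (simp add: insert_absorb)
      moreover have "restriction ?N t = (C - {B}, os)"
        unfolding t_eq r using B1 by simp
      ultimately show ?thesis by simp
    next
      case B1: False
      have part: "partition_on {1..n} (insert (B - {?N}) (C - {B} \<union> set os))"
        using partition_on_shrink(1)[OF D(1) _ B(2) B1] B(1) eq by simp
      have nc: "noncrossing (insert (B - {?N}) (C - {B} \<union> set os))"
        using noncrossing_replace[OF D(3), of B "B - {?N}"] B(1) eq by auto
      have B_notin: "B - {?N} \<notin> C"
      proof
        assume "B - {?N} \<in> C"
        moreover obtain b where "b \<in> B" "b \<noteq> ?N" using B B1 by auto
        ultimately show False
          using partition_on_same_block[OF D(1), of B "B - {?N}" b] B by blast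
      qed
      have sorted: "sorted_wrt set_less (os @ [B - {?N}])"
      proof -
        have "d < b" if "E \<in> set os" "d \<in> E" "b \<in> B - {?N}" for E d b
        proof (rule ccontr)
          assume "\<not> d < b"
          moreover have "d \<noteq> b"
            using partition_on_same_block[OF D(1), of B E b] B that B_os by auto
          moreover have "d < ?N"
            using less_N[of d E] other[of E] that B_os by auto
          ultimately have "b < d" by simp
          have "\<exists>i\<in>B. \<exists>j\<in>B. \<exists>b\<in>E. i < b \<and> b < j"
            by (rule bexI[of _ b], rule bexI[of _ ?N], rule bexI[of _ d])
              (use \<open>b < d\<close> \<open>d < ?N\<close> that B in simp_all)
          then have "under_arch E B" by (simp add: under_arch_def)
          then show False using D(5) B that by auto
        qed
        then show ?thesis
          using D(4) by (auto simp: sorted_wrt_append set_less_def)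
      qed
      have arch: "\<not> under_arch (B - {?N}) E" if "E \<in> C - {B}" for E
      proof
        assume "under_arch (B - {?N}) E"
        then obtain i j b where *: "i \<in> E" "j \<in> E" "b \<in> B" "i < b" "b < j"
          by (auto simp: under_arch_def)
        moreover have "j < ?N"
          using less_N[of j E] other[of E] that * by auto
        ultimately show False
          using noncrossingD[OF D(3), of E B i j b ?N] that B by auto
      qed
      have "(C - {B}, os @ [B - {?N}]) \<in> open_partitions n"
      proof (rule open_partitionsI)
        show "partition_on {1..n} (C - {B} \<union> set (os @ [B - {?N}]))"
          using part by simp
        show "noncrossing (C - {B} \<union> set (os @ [B - {?N}]))"
          using nc by simp
        show "(C - {B}) \<inter> set (os @ [B - {?N}]) = {}" using D(2) B_notin by auto
        show "sorted_wrt set_less (os @ [B - {?N}])" by (rule sorted)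
        show "\<not> under_arch A E" if "E \<in> C - {B}" "A \<in> set (os @ [B - {?N}])" for E A
          using D(5) arch that by auto
      qed
      moreover have "t \<in> extensions ?N (C - {B}, os @ [B - {?N}])"
      proof -
        have "insert ?N (B - {?N}) = B" "insert B (C - {B}) = C" using B by auto
        then show ?thesis using t_eq by simp
      qed
      moreover have "restriction ?N t = (C - {B}, os @ [B - {?N}])"
        unfolding t_eq r using B1 by simp
      ultimately show ?thesis by simp
    qed
  next
    case False
    then obtain L where L: "L \<in> set os" "?N \<in> L" using ex by auto
    then obtain os' os'' where os1: "os = os' @ L # os''" by (meson split_list)
    have "os'' = []"
    proof (rule ccontr)
      assume "os'' \<noteq> []"
      then obtain E where E: "E \<in> set os''" by (cases os'') auto
      then have "E \<in> set os" "set_less L E" using D(4) os1 by (auto simp: sorted_wrt_append)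
      moreover obtain e where "e \<in> E" using D(7) \<open>E \<in> set os\<close> by (cases "E = {}") auto
      moreover have "e \<le> ?N" using D(6)[of E e] calculation by simp
      ultimately show False
        using L(2) unfolding set_less_def by (meson leD)
    qed
    then have os: "os = os' @ [L]" using os1 by simp
    note r = restriction_open[OF False, of os' L]
    have "distinct os"
      using distinct_if_sorted_set_less[OF D(4)] D(7) by simp
    then have L': "L \<notin> C" "L \<notin> set os'" using L D(2) os by auto
    have eq: "C \<union> set os - {L} = C \<union> set os'" using L' os by auto
    show "restriction ?N t \<in> open_partitions n \<and> t \<in> extensions ?N (restriction ?N t)"
    proof (cases "L = {?N}")
      case True
      have "(C, os') \<in> open_partitions n"
      proof (rule open_partitionsI)
        show "partition_on {1..n} (C \<union> set os')"
          using partition_on_shrink(2)[OF D(1) _ L(2) True] L(1) eq by simp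
        show "noncrossing (C \<union> set os')"
          by (rule noncrossing_subset[OF D(3)]) (use os in auto)
        show "C \<inter> set os' = {}" using D(2) os by auto
        show "sorted_wrt set_less os'" using D(4) os by (simp add: sorted_wrt_append)
        show "\<not> under_arch A E" if "E \<in> C" "A \<in> set os'" for E A
          using D(5) that os by simp
      qed
      moreover have "t \<in> extensions ?N (C, os')"
        using t_eq os True by simp
      moreover have "restriction ?N t = (C, os')"
        unfolding t_eq os r using True by simp
      ultimately show ?thesis by simp
    next
      case L1: False
      have part: "partition_on {1..n} (insert (L - {?N}) (C \<union> set os'))"
        using partition_on_shrink(1)[OF D(1) _ L(2) L1] L(1) eq by simp
      have nc: "noncrossing (insert (L - {?N}) (C \<union> set os'))"
        using noncrossing_replace[OF D(3), of L "L - {?N}"] L(1) eq by auto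
      have L_notin: "L - {?N} \<notin> C"
      proof
        assume "L - {?N} \<in> C"
        moreover obtain b where "b \<in> L" "b \<noteq> ?N" using L L1 by auto
        ultimately show False
          using partition_on_same_block[OF D(1), of L "L - {?N}" b] L by blast
      qed
      have "(C, os' @ [L - {?N}]) \<in> open_partitions n"
      proof (rule open_partitionsI)
        show "partition_on {1..n} (C \<union> set (os' @ [L - {?N}]))"
          using part by simp
        show "noncrossing (C \<union> set (os' @ [L - {?N}]))"
          using nc by simp
        show "C \<inter> set (os' @ [L - {?N}]) = {}" using D(2) L_notin os by auto
        show "sorted_wrt set_less (os' @ [L - {?N}])"
          using D(4) os by (simp add: sorted_wrt_append set_less_def)
        show "\<not> under_arch A E" if "E \<in> C" "A \<in> set (os' @ [L - {?N}])" for E A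
        proof (cases "A \<in> set os'")
          case True
          then show ?thesis using D(5) that(1) os by simp
        next
          case False
          then have "A = L - {?N}" using that by simp
          moreover have "\<not> under_arch L E" using D(5) that(1) os by simp
          ultimately show ?thesis unfolding under_arch_def by blast
        qed
      qed
      moreover have "t \<in> extensions ?N (C, os' @ [L - {?N}])"
      proof -
        have "insert ?N (L - {?N}) = L" using L by auto
        then show ?thesis using t_eq os by simp
      qed
      moreover have "restriction ?N t = (C, os' @ [L - {?N}])"
        unfolding t_eq os r using L1 by simp
      ultimately show ?thesis by simp
    qed
  qed
qed

lemma open_partitions_0: "open_partitions 0 = {({}, [])}"
  by (auto simp: open_partitions_def partition_on_empty noncrossing_def)

lemma finite_extensions: "finite (extensions N s)"
  by (cases s) auto

lemma finite_open_partitions: "finite (open_partitions n)"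
proof (induction n)
  case 0
  then show ?case by (simp add: open_partitions_0)
next
  case (Suc n)
  have "open_partitions (Suc n) \<subseteq> (\<Union>s\<in>open_partitions n. extensions (Suc n) s)"
    using restriction_sound by blast
  then show ?case
    using Suc finite_extensions by (meson finite_UN_I finite_subset)
qed

lemma sum_open_partitions_Suc:
  "(\<Sum>t\<in>open_partitions (Suc n). f t) = (\<Sum>s\<in>open_partitions n. \<Sum>t\<in>extensions (Suc n) s. f t)"
proof -
  have "(\<Sum>t\<in>open_partitions (Suc n). f t)
      = (\<Sum>s\<in>open_partitions n. \<Sum>t\<in>{t \<in> open_partitions (Suc n). restriction (Suc n) t = s}. f t)"
    by (rule sum.group[symmetric]) (auto simp: finite_open_partitions restriction_sound)
  also have "\<dots> = (\<Sum>s\<in>open_partitions n. \<Sum>t\<in>extensions (Suc n) s. f t)"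
    using extensions_sound restriction_sound by (intro sum.cong refl) blast+
  finally show ?thesis .
qed

definition block_word :: "nat set list \<Rightarrow> letter list" where
  "block_word os = concat (map (\<lambda>B. Y # replicate (card B) X) os)"

fun open_term :: "(nat \<Rightarrow> 'a::field) \<Rightarrow> nat set set \<times> nat set list \<Rightarrow> 'a ncpoly" where
  "open_term \<kappa> (C, os) = sc (partition_weight \<kappa> C * (- 1) ^ length os) * wd (block_word os)"

lemma sc_wd_sc_mult: "sc a * wd u * sc c = sc (a * c) * wd u"
  by (metis mult.assoc sc_commute sc_simps(4))

text \<open>The four extensions are the four summands of the linear equation for \<open>\<Upsilon>\<close>.  An open block carries
  the sign \<open>-1\<close>, so that the weight \<open>- \<kappa>\<close> which \<open>pop\<close> pays for it becomes \<open>\<kappa>\<close>.\<close>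

lemma sum_extensions:
  fixes \<kappa> :: "nat \<Rightarrow> 'a::field"
  assumes s: "(C, os) \<in> open_partitions n"
  shows "(\<Sum>t\<in>extensions (Suc n) (C, os). open_term \<kappa> t)
      = pop (\<lambda>j. - \<kappa> j) (open_term \<kappa> (C, os)) - open_term \<kappa> (C, os) * sc (- \<kappa> 1)
        + (if os = [] then 0 else open_term \<kappa> (C, os) * wd [X]) - open_term \<kappa> (C, os) * wd [Y] * wd [X]"
proof -
  note D = open_partitionsD[OF s]
  let ?N = "Suc n"
  let ?T = "open_term \<kappa>" and ?P = "pop (\<lambda>j. - \<kappa> j)"
  have N_notin: "?N \<notin> B" if "B \<in> C \<or> B \<in> set os" for B
    using D(6)[of B ?N] that by auto
  have "C \<subseteq> Pow {1..n}" using D(6) partition_onD1[OF D(1)] by auto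
  then have finC: "finite C" by (rule finite_subset) simp
  have finB: "finite B" if "B \<in> set os" for B
  proof (rule finite_subset)
    show "B \<subseteq> {..n}" using D(6) that by auto
  qed simp
  have w: "partition_weight \<kappa> (insert (insert ?N B) C) = \<kappa> (card (insert ?N B)) * partition_weight \<kappa> C" for B
    using finC N_notin[of "insert ?N B"] by (subst partition_weight_def, subst prod.insert) (auto simp: partition_weight_def)
  let ?a = "(insert {?N} C, os)" and ?b = "(C, os @ [{?N}])"
  have single: "?T ?a = - (?T (C, os) * sc (- \<kappa> 1))"
  proof -
    have "?T (C, os) * sc (- \<kappa> 1)
        = sc (partition_weight \<kappa> C * (- 1) ^ length os * (- \<kappa> 1)) * wd (block_word os)"
      by (simp only: open_term.simps sc_wd_sc_mult)
    also have "partition_weight \<kappa> C * (- 1) ^ length os * (- \<kappa> 1)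
        = - (partition_weight \<kappa> (insert {?N} C) * (- 1) ^ length os)"
      using w[of "{}"] by simp
    finally show ?thesis
      by (simp only: sc_simps(3) open_term.simps) simp
  qed
  have opened: "?T ?b = - (?T (C, os) * wd [Y] * wd [X])"
    by (simp add: block_word_def sc_simps mult.assoc wd_mult)
  show ?thesis
  proof (cases os rule: rev_cases)
    case Nil
    have "?P (?T (C, [])) = 0"
      using lin_ext_monom[of "pop_word (\<lambda>j. - \<kappa> j)" "partition_weight \<kappa> C" "[]"]
      by (simp add: pop_def block_word_def)
    moreover have "(\<Sum>t\<in>extensions ?N (C, os). ?T t) = ?T ?a + ?T ?b"
      using Nil by simp
    ultimately show ?thesis
      unfolding single opened using Nil by simp
  next
    case (snoc os' L)
    let ?c = "(C, os' @ [insert ?N L])" and ?d = "(insert (insert ?N L) C, os')"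
    have L: "?N \<notin> L" "finite L" using N_notin finB snoc by auto
    have enl: "?T ?c = ?T (C, os) * wd [X]"
      using L snoc by (simp add: block_word_def mult.assoc wd_mult replicate_append_same)
    have "?P (?T (C, os)) = sc (partition_weight \<kappa> C * (- 1) ^ length os) *
        (sc (- \<kappa> (Suc (card L))) * wd (block_word os'))"
      using snoc by (simp only: pop_def open_term.simps lin_ext_monom)
        (simp add: block_word_def pop_word_top)
    also have "\<dots> = sc (partition_weight \<kappa> C * (- 1) ^ length os * - \<kappa> (Suc (card L))) * wd (block_word os')"
      by (simp only: sc_simps(4) mult.assoc)
    also have "partition_weight \<kappa> C * (- 1) ^ length os * - \<kappa> (Suc (card L))
        = partition_weight \<kappa> (insert (insert ?N L) C) * (- 1) ^ length os'"
      using w[of L] L snoc by simp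
    also have "sc \<dots> * wd (block_word os') = ?T ?d"
      by simp
    finally have cl: "?T ?d = ?P (?T (C, os))" ..
    have "L \<noteq> insert ?N L" using L by auto
    then have "(\<Sum>t\<in>extensions ?N (C, os). ?T t) = ?T ?a + (?T ?b + (?T ?c + ?T ?d))"
      using snoc by (simp del: open_term.simps)
    then show ?thesis
      unfolding single opened enl cl using snoc by (simp add: algebra_simps)
  qed
qed

definition open_series :: "(nat \<Rightarrow> 'a::field) \<Rightarrow> nat \<Rightarrow> 'a ncpoly" where
  "open_series \<kappa> n = (\<Sum>s\<in>open_partitions n. open_term \<kappa> s)"

definition free_moment :: "(nat \<Rightarrow> 'a::field) \<Rightarrow> nat \<Rightarrow> 'a" where
  "free_moment \<kappa> n = (\<Sum>P\<in>nc_partitions n. partition_weight \<kappa> P)"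

lemma sum_no_open:
  "(\<Sum>s\<in>open_partitions n. if snd s = [] then f (fst s) else 0) = (\<Sum>P\<in>nc_partitions n. f P)"
proof -
  have "(\<Sum>s\<in>open_partitions n. if snd s = [] then f (fst s) else 0)
      = (\<Sum>s\<in>{s \<in> open_partitions n. snd s = []}. f (fst s))"
    by (rule sum.inter_filter[symmetric]) (rule finite_open_partitions)
  also have "{s \<in> open_partitions n. snd s = []} = (\<lambda>P. (P, [])) ` nc_partitions n"
    by (auto simp: open_partitions_def nc_partitions_def set_partitions_def)
  also have "(\<Sum>s\<in>\<dots>. f (fst s)) = (\<Sum>P\<in>nc_partitions n. f P)"
    by (subst sum.reindex) (auto intro: inj_onI)
  finally show ?thesis .
qed

lemma open_series_0: "open_series \<kappa> 0 = 1"
  by (simp add: open_series_def open_partitions_0 block_word_def partition_weight_def sc_simps)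

lemma block_word_eq_Nil: "block_word os = [] \<longleftrightarrow> os = []"
  by (cases os) (auto simp: block_word_def)

lemma lookup_open_series_0: "Poly_Mapping.lookup (open_series \<kappa> n) 0 = free_moment \<kappa> n"
proof -
  have "Poly_Mapping.lookup (open_series \<kappa> n) 0
      = (\<Sum>s\<in>open_partitions n. if snd s = [] then partition_weight \<kappa> (fst s) else 0)"
    unfolding open_series_def lookup_sum
    by (intro sum.cong refl) (auto simp: lookup_monom_0 block_word_eq_Nil)
  then show ?thesis by (simp add: sum_no_open free_moment_def)
qed

lemma open_series_Suc:
  "open_series \<kappa> (Suc n) = pop (\<lambda>j. - \<kappa> j) (open_series \<kappa> n) - open_series \<kappa> n * sc (- \<kappa> 1)
     + (open_series \<kappa> n - sc (free_moment \<kappa> n)) * wd [X] - open_series \<kappa> n * wd [Y] * wd [X]"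
proof -
  have nonempty: "(\<Sum>s\<in>open_partitions n. if snd s = [] then 0 else open_term \<kappa> s * wd [X])
     = (open_series \<kappa> n - sc (free_moment \<kappa> n)) * wd [X]"
  proof -
    have "sc (free_moment \<kappa> n) = (\<Sum>s\<in>open_partitions n. if snd s = [] then sc (partition_weight \<kappa> (fst s)) else 0)"
      unfolding sum_no_open[where f = "\<lambda>P. sc (partition_weight \<kappa> P)"] free_moment_def sc_sum ..
    then have "open_series \<kappa> n - sc (free_moment \<kappa> n) = (\<Sum>s\<in>open_partitions n. if snd s = [] then 0 else open_term \<kappa> s)"
      by (auto simp: open_series_def block_word_def simp flip: sum_subtractf intro!: sum.cong)
    then show ?thesis
      by (auto simp: sum_distrib_right intro!: sum.cong)
  qed
  have "open_series \<kappa> (Suc n) = (\<Sum>s\<in>open_partitions n. pop (\<lambda>j. - \<kappa> j) (open_term \<kappa> s)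
      - open_term \<kappa> s * sc (- \<kappa> 1) + (if snd s = [] then 0 else open_term \<kappa> s * wd [X])
      - open_term \<kappa> s * wd [Y] * wd [X])"
    unfolding open_series_def sum_open_partitions_Suc
    by (intro sum.cong refl) (auto simp: sum_extensions simp del: extensions.simps open_term.simps)
  then show ?thesis
    by (simp add: sum.distrib sum_subtractf nonempty)
       (simp add: open_series_def pop_def lin_ext_sum sum_distrib_right)
qed

section \<open>Decreasing binary trees and their skeletons\<close>

text \<open>The largest label sits at the root, and the remaining labels are distributed freely over the two
  subtrees.\<close>

fun labelings :: "'b tree \<Rightarrow> nat" where
  "labelings Leaf = 1"
| "labelings (Node l u r) = (size l + size r choose size l) * (labelings l * labelings r)"

definition labelled_trees :: "unit tree \<Rightarrow> nat set \<Rightarrow> nat tree set" where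
  "labelled_trees T A = {t. set_tree t = A \<and> decreasing_tree t \<and> skeleton t = T}"

lemma skeleton_simps [simp]:
  "skeleton Leaf = Leaf" "skeleton (Node l a r) = Node (skeleton l) () (skeleton r)"
  "size (skeleton t) = size t"
  by (simp_all add: skeleton_def)

lemma decreasing_below_root:
  "decreasing_tree t \<Longrightarrow> label_below t r \<Longrightarrow> x \<in> set_tree t \<Longrightarrow> x < r"
proof (induction t arbitrary: r)
  case (Node t1 a t2)
  have "x < a \<or> x = a" using Node by auto
  then show ?case using Node.prems by auto
qed simp

lemma decreasing_tree_Node_iff:
  "decreasing_tree (Node l a r) \<longleftrightarrow>
     decreasing_tree l \<and> decreasing_tree r \<and> (\<forall>x\<in>set_tree l \<union> set_tree r. x < a)"
proof
  assume "decreasing_tree (Node l a r)"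
  then show "decreasing_tree l \<and> decreasing_tree r \<and> (\<forall>x\<in>set_tree l \<union> set_tree r. x < a)"
    using decreasing_below_root by auto
next
  assume *: "decreasing_tree l \<and> decreasing_tree r \<and> (\<forall>x\<in>set_tree l \<union> set_tree r. x < a)"
  have "label_below l a" using * by (cases l) auto
  moreover have "label_below r a" using * by (cases r) auto
  ultimately show "decreasing_tree (Node l a r)" using * by simp
qed

lemma card_set_tree_le: "card (set_tree t) \<le> size t"
proof (induction t)
  case (Node l a r)
  have "card (set_tree (Node l a r)) \<le> Suc (card (set_tree l \<union> set_tree r))"
    by (simp add: card_insert_if)
  also have "\<dots> \<le> Suc (card (set_tree l) + card (set_tree r))"
    by (simp add: card_Un_le)
  finally show ?case using Node by simp
qed simp

lemma labelled_trees_Node: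
  assumes A: "finite A" "card A = Suc (size l + size r)"
  shows "labelled_trees (Node l () r) A = (\<lambda>(B, t1, t2). Node t1 (Max A) t2) `
    (SIGMA B:{B. B \<subseteq> A - {Max A} \<and> card B = size l}.
       labelled_trees l B \<times> labelled_trees r (A - {Max A} - B))" (is "?L = ?f ` ?S")
proof (intro equalityI subsetI)
  have A_ne: "A \<noteq> {}" using A by auto
  fix t assume "t \<in> ?L"
  then have t: "set_tree t = A" "decreasing_tree t" "skeleton t = Node l () r"
    by (auto simp: labelled_trees_def)
  then obtain t1 a t2 where t_eq: "t = Node t1 a t2" by (cases t) auto
  have sk: "skeleton t1 = l" "skeleton t2 = r" using t t_eq by auto
  have sz: "size t1 = size l" "size t2 = size r" using skeleton_simps(3) sk by metis+
  have dec: "decreasing_tree t1" "decreasing_tree t2" "\<And>x. x \<in> set_tree t1 \<union> set_tree t2 \<Longrightarrow> x < a"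
    using t(2) unfolding t_eq decreasing_tree_Node_iff by auto
  have A_eq: "A = insert a (set_tree t1 \<union> set_tree t2)" using t(1) t_eq by auto
  then have a: "a = Max A"
    using dec(3) A(1) by (intro Max_eqI[symmetric]) (auto intro: less_imp_le)
  have a_notin: "a \<notin> set_tree t1 \<union> set_tree t2" using dec(3)[of a] less_irrefl[of a] by blast
  then have "card (set_tree t1 \<union> set_tree t2) = size l + size r"
    using A(2) unfolding A_eq by (simp add: card_insert_disjoint)
  moreover have "card (set_tree t1 \<union> set_tree t2) + card (set_tree t1 \<inter> set_tree t2)
      = card (set_tree t1) + card (set_tree t2)"
    by (rule card_Un_Int[symmetric]) simp_all
  moreover have "card (set_tree t1) \<le> size l" "card (set_tree t2) \<le> size r"
    using card_set_tree_le[of t1] card_set_tree_le[of t2] sz by auto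
  ultimately have "card (set_tree t1 \<inter> set_tree t2) = 0" "card (set_tree t1) = size l"
    by linarith+
  then have disj: "set_tree t1 \<inter> set_tree t2 = {}" and c1: "card (set_tree t1) = size l"
    by auto
  have "A - {Max A} - set_tree t1 = set_tree t2" "set_tree t1 \<subseteq> A - {Max A}"
    unfolding a[symmetric] using A_eq a_notin disj by auto
  then have "(set_tree t1, t1, t2) \<in> ?S"
    using c1 dec sk by (auto simp: labelled_trees_def)
  then show "t \<in> ?f ` ?S"
    unfolding t_eq a[symmetric] by (rule rev_image_eqI) simp
next
  fix t assume "t \<in> ?f ` ?S"
  then obtain B t1 t2 where *: "B \<subseteq> A - {Max A}" "t1 \<in> labelled_trees l B"
    "t2 \<in> labelled_trees r (A - {Max A} - B)" "t = Node t1 (Max A) t2" by auto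
  have "A \<noteq> {}" using A by auto
  then have "Max A \<in> A" using A by simp
  have less: "x < Max A" if "x \<in> A - {Max A}" for x
    using that A(1) Max_ge[of A x] by (simp add: order_less_le)
  have t1: "set_tree t1 = B" "decreasing_tree t1" "skeleton t1 = l"
    and t2: "set_tree t2 = A - {Max A} - B" "decreasing_tree t2" "skeleton t2 = r"
    using *(2,3) by (auto simp: labelled_trees_def)
  have "set_tree t = A"
    using *(1) \<open>Max A \<in> A\<close> unfolding *(4) by (auto simp: t1 t2)
  moreover have "decreasing_tree t"
    unfolding *(4) decreasing_tree_Node_iff t1 t2 using *(1) less t1 t2 by blast
  moreover have "skeleton t = Node l () r" unfolding *(4) by (simp add: t1 t2)
  ultimately show "t \<in> ?L" by (simp add: labelled_trees_def)
qed

lemma finite_labelled_trees_card: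
  "finite A \<Longrightarrow> card A = size T \<Longrightarrow>
    finite (labelled_trees T A) \<and> card (labelled_trees T A) = labelings T"
proof (induction T arbitrary: A)
  case Leaf
  have "labelled_trees Leaf A = {Leaf}"
    using Leaf by (auto simp: labelled_trees_def skeleton_def)
  then show ?case by simp
next
  case (Node l u r)
  let ?I = "{B. B \<subseteq> A - {Max A} \<and> card B = size l}"
  let ?S = "SIGMA B:?I. labelled_trees l B \<times> labelled_trees r (A - {Max A} - B)"
  have card_A: "card A = Suc (size l + size r)" using Node.prems by simp
  then have "A \<noteq> {}" by auto
  then have card_A': "card (A - {Max A}) = size l + size r"
    using card_A Node.prems by simp
  have finI: "finite ?I" using Node.prems by simp
  have card_I: "card ?I = (size l + size r choose size l)"
    using n_subsets[of "A - {Max A}" "size l"] Node.prems card_A' by simp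
  have sub: "finite (labelled_trees l B \<times> labelled_trees r (A - {Max A} - B))
      \<and> card (labelled_trees l B \<times> labelled_trees r (A - {Max A} - B)) = labelings l * labelings r"
    if "B \<in> ?I" for B
  proof -
    have "finite B" using that Node.prems finite_subset by auto
    then have "card (A - {Max A} - B) = size r"
      using that card_A' by (simp add: card_Diff_subset)
    then show ?thesis
      using Node.IH(1)[of B] Node.IH(2)[of "A - {Max A} - B"] that \<open>finite B\<close> Node.prems
      by (simp add: card_cartesian_product)
  qed
  have inj: "inj_on (\<lambda>(B, t1, t2). Node t1 (Max A) t2) ?S"
    by (auto intro!: inj_onI simp: labelled_trees_def)
  have "card ?S = (\<Sum>B\<in>?I. labelings l * labelings r)"
    using finI sub by (subst card_SigmaI) auto
  also have "\<dots> = labelings (Node l u r)" by (simp add: card_I)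
  finally have "card ?S = labelings (Node l u r)" .
  moreover have "finite ?S" by (rule finite_SigmaI[OF finI]) (rule conjunct1[OF sub])
  ultimately show ?case
    using labelled_trees_Node[OF Node.prems(1) card_A] card_image[OF inj] by simp
qed

definition trees :: "nat \<Rightarrow> unit tree set" where
  "trees n = {T. size T = n}"

lemma trees_0: "trees 0 = {Leaf}"
  by (auto simp: trees_def)

lemma trees_Suc:
  "trees (Suc n) = (\<lambda>(i, l, r). Node l () r) ` (SIGMA i:{..n}. trees i \<times> trees (n - i))"
proof (intro equalityI subsetI)
  fix T assume "T \<in> trees (Suc n)"
  then obtain l r where "T = Node l () r" "size l + size r = n"
    by (cases T) (auto simp: trees_def)
  then show "T \<in> (\<lambda>(i, l, r). Node l () r) ` (SIGMA i:{..n}. trees i \<times> trees (n - i))"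
    by (intro image_eqI[of _ _ "(size l, l, r)"]) (auto simp: trees_def)
qed (auto simp: trees_def)

lemma finite_trees: "finite (trees n)"
proof (induction n rule: less_induct)
  case (less n)
  then show ?case
    by (cases n) (auto simp: trees_0 trees_Suc intro!: finite_imageI finite_SigmaI)
qed

lemma sum_trees_Suc:
  "(\<Sum>T\<in>trees (Suc n). f T) = (\<Sum>i\<le>n. \<Sum>l\<in>trees i. \<Sum>r\<in>trees (n - i). f (Node l () r))"
proof -
  have "inj_on (\<lambda>(i, l, r). Node l () r) (SIGMA i:{..n}. trees i \<times> trees (n - i))"
    by (auto intro!: inj_onI simp: trees_def)
  then show ?thesis
    unfolding trees_Suc
    by (simp add: sum.reindex sum.Sigma sum.cartesian_product finite_trees split_def comp_def)
qed

text \<open>The weighted sum of the final stacks over all partial hook configurations on a tree, computed in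
  in-order: the root joins the top colour of the left subtree or ends that hook, and a nonempty
  right subtree is preceded by the hook that starts at the root.\<close>

fun tree_poly :: "(nat \<Rightarrow> 'a::comm_ring_1) \<Rightarrow> 'b tree \<Rightarrow> 'a ncpoly" where
  "tree_poly k Leaf = 1"
| "tree_poly k (Node l u r) = (tree_poly k l * wd [X] + pop k (tree_poly k l)) *
     (if r = Leaf then 1 else wd [Y] * tree_poly k r)"

definition tree_series :: "(nat \<Rightarrow> 'a::comm_ring_1) \<Rightarrow> nat \<Rightarrow> 'a ncpoly" where
  "tree_series k n = (\<Sum>T\<in>trees n. of_nat (labelings T) * tree_poly k T)"

lemma tree_series_0: "tree_series k 0 = 1"
  by (simp add: tree_series_def trees_0)

lemma pop_of_nat: "pop k (of_nat c * f) = of_nat c * pop k f"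
  using lin_ext_sc[of "pop_word k" "of_nat c" f] by (simp add: pop_def sc_simps)

lemma tree_series_Suc:
  fixes k :: "nat \<Rightarrow> 'a::comm_ring_1"
  shows "tree_series k (Suc n) = binomial_conv (\<lambda>i. tree_series k i * wd [X] + pop k (tree_series k i))
       (\<lambda>n. if n = 0 then 1 else wd [Y] * tree_series k n) n"
proof -
  define q :: "unit tree \<Rightarrow> 'a ncpoly" where "q l = tree_poly k l * wd [X] + pop k (tree_poly k l)" for l
  define p :: "unit tree \<Rightarrow> 'a ncpoly" where "p r = (if r = Leaf then 1 else wd [Y] * tree_poly k r)" for r
  have q: "tree_series k i * wd [X] + pop k (tree_series k i) = (\<Sum>l\<in>trees i. of_nat (labelings l) * q l)" for i
  proof -
    have "pop k (tree_series k i) = (\<Sum>l\<in>trees i. of_nat (labelings l) * pop k (tree_poly k l))"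
      unfolding tree_series_def pop_of_nat[symmetric] by (simp add: pop_def lin_ext_sum)
    then show ?thesis
      by (simp add: tree_series_def q_def sum_distrib_right distrib_left sum.distrib mult.assoc)
  qed
  have p: "(if i = 0 then 1 else wd [Y] * tree_series k i) = (\<Sum>r\<in>trees i. of_nat (labelings r) * p r)" for i
  proof (cases "i = 0")
    case True
    then show ?thesis by (simp add: trees_0 p_def)
  next
    case False
    then have "r \<noteq> Leaf" if "r \<in> trees i" for r using that by (auto simp: trees_def)
    moreover have "wd [Y] * (of_nat c * f) = of_nat c * (wd [Y] * f)" for c and f :: "'a ncpoly"
      by (metis mult.assoc mult_of_nat_commute)
    ultimately show ?thesis
      using False by (simp add: tree_series_def p_def sum_distrib_left)
  qed
  have "tree_series k (Suc n) = (\<Sum>i\<le>n. \<Sum>l\<in>trees i. \<Sum>r\<in>trees (n - i).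
      of_nat (labelings (Node l () r)) * (q l * p r))"
    by (simp add: tree_series_def sum_trees_Suc q_def p_def)
  also have "\<dots> = (\<Sum>i\<le>n. of_nat (n choose i) * ((\<Sum>l\<in>trees i. of_nat (labelings l) * q l) *
      (\<Sum>r\<in>trees (n - i). of_nat (labelings r) * p r)))"
  proof (intro sum.cong refl)
    fix i assume i: "i \<in> {..n}"
    have "of_nat (labelings (Node l () r)) * (q l * p r)
        = of_nat (n choose i) * ((of_nat (labelings l) * q l) * (of_nat (labelings r) * p r))"
      if "l \<in> trees i" "r \<in> trees (n - i)" for l r
    proof -
      have "size l = i" "size l + size r = n"
        using that i by (simp_all add: trees_def)
      then have "labelings (Node l () r) = (n choose i) * (labelings l * labelings r)"
        by simp
      moreover have "of_nat (labelings r) * (q l * p r) = q l * (of_nat (labelings r) * p r)"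
        by (metis mult.assoc mult_of_nat_commute)
      ultimately show ?thesis by (simp del: labelings.simps add: mult.assoc)
    qed
    then show "(\<Sum>l\<in>trees i. \<Sum>r\<in>trees (n - i). of_nat (labelings (Node l () r)) * (q l * p r))
       = of_nat (n choose i) * ((\<Sum>l\<in>trees i. of_nat (labelings l) * q l) *
           (\<Sum>r\<in>trees (n - i). of_nat (labelings r) * p r))"
      by (simp add: sum_product) (simp add: sum_distrib_left)
  qed
  also have "\<dots> = binomial_conv (\<lambda>i. tree_series k i * wd [X] + pop k (tree_series k i))
       (\<lambda>n. if n = 0 then 1 else wd [Y] * tree_series k n) n"
    unfolding binomial_conv_def q p ..
  finally show ?thesis .
qed

section \<open>Partial hook configurations on a tree\<close>

text \<open>Vertices are named by their in-order positions, shifted by \<open>b\<close>: the tree occupies the positions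
  \<open>b + 1, \<dots>, b + size t\<close>.  The vertices with a right child are the descents of the reading.\<close>

fun right_parents :: "'b tree \<Rightarrow> nat \<Rightarrow> nat set" where
  "right_parents Leaf b = {}"
| "right_parents (Node l a r) b =
     right_parents l b \<union> (if r = Leaf then {} else {b + size l + 1}) \<union>
     right_parents r (b + size l + 1)"

text \<open>The pairs of a vertex and an ancestor of it that has it in the left subtree: the possible
  endpoints of hooks.\<close>

fun left_pairs :: "'b tree \<Rightarrow> nat \<Rightarrow> (nat \<times> nat) set" where
  "left_pairs Leaf b = {}"
| "left_pairs (Node l a r) b =
     left_pairs l b \<union> {b<..b + size l} \<times> {b + size l + 1} \<union>
     left_pairs r (b + size l + 1)"

lemma right_parents_bounds': "d \<in> right_parents T b \<Longrightarrow> b < d \<and> d < b + size T"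
proof (induction T arbitrary: b)
  case (Node l a r)
  then consider "d \<in> right_parents l b" | "r \<noteq> Leaf" "d = b + size l + 1"
    | "d \<in> right_parents r (b + size l + 1)"
    by (auto split: if_splits)
  then show ?case
  proof cases
    case 2
    then show ?thesis by (cases r) simp_all
  qed (use Node.IH in force)+
qed simp

lemma right_parents_bounds: "d \<in> right_parents T b \<Longrightarrow> b < d \<and> d \<le> b + size T"
  using right_parents_bounds'[of d T b] by simp

lemma left_pairs_bounds: "(d, j) \<in> left_pairs T b \<Longrightarrow> b < d \<and> d < j \<and> j \<le> b + size T"
  by (induction T arbitrary: b) force+

text \<open>A partial hook configuration consists of the completed hooks \<open>C\<close> and the increasing list \<open>os\<close> of
  the starts of those hooks that end to the right of the tree.  Hooks that do not meet are nested or
  follow one another, so a hook that starts below another one has to end before it; in particular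
  no hook may stay open if it starts below a completed one.\<close>

definition hook_confs :: "'b tree \<Rightarrow> nat \<Rightarrow> ((nat \<times> nat) set \<times> nat list) set" where
  "hook_confs T b = {(C, os).
     C \<subseteq> left_pairs T b \<and> inj_on fst C \<and> fst ` C \<inter> set os = {} \<and>
     fst ` C \<union> set os = right_parents T b \<and> sorted_wrt (<) os \<and>
     (\<forall>d j d' j'. (d, j) \<in> C \<longrightarrow> (d', j') \<in> C \<longrightarrow> d < d' \<longrightarrow> d' < j \<longrightarrow> j' < j) \<and>
     (\<forall>d j d'. (d, j) \<in> C \<longrightarrow> d' \<in> set os \<longrightarrow> d < d' \<longrightarrow> j \<le> d')}"

lemma hook_confsI:
  assumes "C \<subseteq> left_pairs T b" "inj_on fst C" "fst ` C \<inter> set os = {}"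
    "fst ` C \<union> set os = right_parents T b" "sorted_wrt (<) os"
    "\<And>d j d' j'. (d, j) \<in> C \<Longrightarrow> (d', j') \<in> C \<Longrightarrow> d < d' \<Longrightarrow> d' < j \<Longrightarrow> j' < j"
    "\<And>d j d'. (d, j) \<in> C \<Longrightarrow> d' \<in> set os \<Longrightarrow> d < d' \<Longrightarrow> j \<le> d'"
  shows "(C, os) \<in> hook_confs T b"
  using assms unfolding hook_confs_def by blast

lemma hook_confsD:
  assumes "(C, os) \<in> hook_confs T b"
  shows "C \<subseteq> left_pairs T b" "inj_on fst C" "fst ` C \<inter> set os = {}"
    "fst ` C \<union> set os = right_parents T b" "sorted_wrt (<) os"
    "\<And>d j d' j'. (d, j) \<in> C \<Longrightarrow> (d', j') \<in> C \<Longrightarrow> d < d' \<Longrightarrow> d' < j \<Longrightarrow> j' < j"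
    "\<And>d j d'. (d, j) \<in> C \<Longrightarrow> d' \<in> set os \<Longrightarrow> d < d' \<Longrightarrow> j \<le> d'"
    "\<And>d j. (d, j) \<in> C \<Longrightarrow> b < d \<and> d < j \<and> j \<le> b + size T"
    "\<And>d. d \<in> set os \<Longrightarrow> b < d \<and> d \<le> b + size T"
proof -
  have conj: "C \<subseteq> left_pairs T b \<and> inj_on fst C \<and> fst ` C \<inter> set os = {} \<and>
     fst ` C \<union> set os = right_parents T b \<and> sorted_wrt (<) os \<and>
     (\<forall>d j d' j'. (d, j) \<in> C \<longrightarrow> (d', j') \<in> C \<longrightarrow> d < d' \<longrightarrow> d' < j \<longrightarrow> j' < j) \<and>
     (\<forall>d j d'. (d, j) \<in> C \<longrightarrow> d' \<in> set os \<longrightarrow> d < d' \<longrightarrow> j \<le> d')"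
    using assms unfolding hook_confs_def mem_Collect_eq prod.case .
  then show sub: "C \<subseteq> left_pairs T b" by (elim conjE)
  from conj show "inj_on fst C" by (elim conjE)
  from conj show "fst ` C \<inter> set os = {}" by (elim conjE)
  from conj show "sorted_wrt (<) os" by (elim conjE)
  from conj show rp: "fst ` C \<union> set os = right_parents T b" by (elim conjE)
  from conj have "\<forall>d j d' j'. (d, j) \<in> C \<longrightarrow> (d', j') \<in> C \<longrightarrow> d < d' \<longrightarrow> d' < j \<longrightarrow> j' < j"
    by (elim conjE)
  then show "\<And>d j d' j'. (d, j) \<in> C \<Longrightarrow> (d', j') \<in> C \<Longrightarrow> d < d' \<Longrightarrow> d' < j \<Longrightarrow> j' < j"
    by (elim allE impE)
  from conj have "\<forall>d j d'. (d, j) \<in> C \<longrightarrow> d' \<in> set os \<longrightarrow> d < d' \<longrightarrow> j \<le> d'"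
    by (elim conjE)
  then show "\<And>d j d'. (d, j) \<in> C \<Longrightarrow> d' \<in> set os \<Longrightarrow> d < d' \<Longrightarrow> j \<le> d'"
    by (elim allE impE)
  show "\<And>d j. (d, j) \<in> C \<Longrightarrow> b < d \<and> d < j \<and> j \<le> b + size T"
    by (rule left_pairs_bounds) (rule subsetD[OF sub])
  show "\<And>d. d \<in> set os \<Longrightarrow> b < d \<and> d \<le> b + size T"
    by (rule right_parents_bounds) (use rp in blast)
qed

fun close_hook :: "nat \<Rightarrow> (nat \<times> nat) set \<times> nat list \<Rightarrow> (nat \<times> nat) set \<times> nat list" where
  "close_hook p (C, os) = (insert (last os, p) C, butlast os)"

text \<open>Of all open hooks in the left subtree the root can end only the last one, since the hooks that
  start below its own hook have to end earlier.\<close>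

lemma hook_confs_Node_Leaf:
  "hook_confs (Node l a Leaf) b =
     hook_confs l b \<union> close_hook (b + size l + 1) ` {s \<in> hook_confs l b. snd s \<noteq> []}"
    (is "?L = ?R")
proof (intro equalityI subsetI)
  let ?p = "b + size l + 1"
  fix s assume "s \<in> ?L"
  moreover obtain C os where s: "s = (C, os)" by (cases s)
  ultimately have "(C, os) \<in> ?L" by simp
  note D = hook_confsD[OF this]
  show "s \<in> ?R"
  proof (cases "\<exists>d. (d, ?p) \<in> C")
    case False
    have "C \<subseteq> left_pairs l b"
      using D(1) False by auto
    then have "(C, os) \<in> hook_confs l b"
      by (rule hook_confsI) (use D(2-7) in simp_all)
    then show ?thesis using s by simp
  next
    case True
    then obtain d where d: "(d, ?p) \<in> C" by blast
    define C' where "C' = C - {(d, ?p)}"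
    have other: "j \<noteq> ?p" if "(d', j) \<in> C'" for d' j
    proof
      assume "j = ?p"
      then have d': "(d', ?p) \<in> C" "d' \<noteq> d" using that by (auto simp: C'_def)
      have "d' < ?p" "d < ?p" using D(8)[OF d'(1)] D(8)[OF d] by auto
      then show False
        using D(6)[OF d d'(1)] D(6)[OF d'(1) d] d'(2) by linarith
    qed
    have d_fst: "d \<notin> fst ` C'"
    proof
      assume "d \<in> fst ` C'"
      then obtain j where "(d, j) \<in> C'" by auto
      then have "(d, j) \<in> C" "(d, j) \<noteq> (d, ?p)" by (auto simp: C'_def)
      then show False using inj_onD[OF D(2), of "(d, j)" "(d, ?p)"] d by simp
    qed
    have d_os: "d \<notin> set os" using D(3) d by force
    have C: "C = insert (d, ?p) C'" using d by (auto simp: C'_def)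
    have "(C', os @ [d]) \<in> hook_confs l b"
    proof (rule hook_confsI)
      show "C' \<subseteq> left_pairs l b"
      proof
        fix c assume c: "c \<in> C'"
        moreover obtain d' j where "c = (d', j)" by (cases c)
        moreover have "C' \<subseteq> left_pairs (Node l a Leaf) b" using D(1) by (auto simp: C'_def)
        ultimately show "c \<in> left_pairs l b" using other by auto
      qed
      show "inj_on fst C'" using D(2) by (rule inj_on_subset) (auto simp: C'_def)
      show "fst ` C' \<inter> set (os @ [d]) = {}"
        using D(3) d_fst unfolding C by auto
      have "fst ` C' \<union> set (os @ [d]) = fst ` C \<union> set os" unfolding C by auto
      then show "fst ` C' \<union> set (os @ [d]) = right_parents l b" using D(4) by simp
      have "d' < d" if "d' \<in> set os" for d'
      proof -
        have "d' \<le> b + size l" using D(4) that right_parents_bounds[of d' l b] by auto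
        then show ?thesis using D(7)[OF d that] d_os that by (metis add.commute linorder_neqE_nat not_less_eq_eq plus_1_eq_Suc)
      qed
      then show "sorted_wrt (<) (os @ [d])" using D(5) by (simp add: sorted_wrt_append)
      show "j' < j" if "(d1, j) \<in> C'" "(d', j') \<in> C'" "d1 < d'" "d' < j" for d1 j d' j'
        using D(6)[of d1 j d' j'] that unfolding C by blast
      show "j \<le> d'" if "(d1, j) \<in> C'" "d' \<in> set (os @ [d])" "d1 < d'" for d1 j d'
      proof (cases "d' = d")
        case True
        have "(d1, j) \<in> C" using that(1) C by blast
        then have "j \<le> ?p" using D(8)[of d1 j] by simp
        then show ?thesis
          using D(6)[OF \<open>(d1, j) \<in> C\<close> d] that(3) True by linarith
      next
        case False
        then show ?thesis using D(7)[of d1 j d'] that C by auto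
      qed
    qed
    moreover have "s = close_hook ?p (C', os @ [d])" using s C by simp
    ultimately show ?thesis by force
  qed
next
  let ?p = "b + size l + 1"
  fix s assume "s \<in> ?R"
  then have "s \<in> hook_confs l b \<or> (\<exists>C os. (C, os) \<in> hook_confs l b \<and> os \<noteq> [] \<and> s = close_hook ?p (C, os))"
  proof
    assume "s \<in> close_hook ?p ` {s \<in> hook_confs l b. snd s \<noteq> []}"
    then obtain s' where "s' \<in> hook_confs l b" "snd s' \<noteq> []" "s = close_hook ?p s'" by blast
    moreover obtain C os where "s' = (C, os)" by (cases s')
    ultimately have "(C, os) \<in> hook_confs l b \<and> os \<noteq> [] \<and> s = close_hook ?p (C, os)" by simp
    then show ?thesis by blast
  qed blast
  then show "s \<in> ?L"
  proof (elim disjE exE conjE)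
    assume 1: "s \<in> hook_confs l b"
    obtain C os where s: "s = (C, os)" by (cases s)
    note D = hook_confsD[OF 1[unfolded s]]
    show ?thesis unfolding s
    proof (rule hook_confsI)
      show "C \<subseteq> left_pairs (Node l a Leaf) b" using D(1) by auto
      show "fst ` C \<union> set os = right_parents (Node l a Leaf) b" using D(4) by simp
    qed (use D(2,3,5,6,7) in simp_all)
  next
    fix C os'
    assume *: "(C, os') \<in> hook_confs l b" "os' \<noteq> []" "s = close_hook ?p (C, os')"
    define os d where "os = butlast os'" and "d = last os'"
    have 2: "(C, os @ [d]) \<in> hook_confs l b" "s = (insert (d, ?p) C, os)"
      using * by (simp_all add: os_def d_def)
    note D = hook_confsD[OF 2(1)]
    have d: "b < d" "d \<le> b + size l" using D(9)[of d] by auto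
    show ?thesis unfolding 2(2)
    proof (rule hook_confsI)
      show "insert (d, ?p) C \<subseteq> left_pairs (Node l a Leaf) b" using D(1) d by auto
      show "fst ` insert (d, ?p) C \<union> set os = right_parents (Node l a Leaf) b"
        using D(4) by auto
      show "inj_on fst (insert (d, ?p) C)"
      proof -
        have "d \<notin> fst ` C" using D(3) by simp
        then have "fst (d, ?p) \<notin> fst ` (C - {(d, ?p)})" by auto
        then show ?thesis using D(2) by (simp only: inj_on_insert simp_thms)
      qed
      have "d \<notin> set os" using D(5) by (auto simp: sorted_wrt_append)
      then show "fst ` insert (d, ?p) C \<inter> set os = {}" using D(3) by auto
      show "sorted_wrt (<) os" using D(5) by (simp add: sorted_wrt_append)
      show "j' < j" if *: "(d1, j) \<in> insert (d, ?p) C" "(d', j') \<in> insert (d, ?p) C" "d1 < d'" "d' < j"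
        for d1 j d' j'
      proof -
        consider "(d1, j) \<in> C" "(d', j') \<in> C" | "(d1, j) = (d, ?p)" "(d', j') \<in> C"
          | "(d', j') = (d, ?p)" "(d1, j) \<in> C"
          using * by auto
        then show ?thesis
        proof cases
          case 1 then show ?thesis using D(6) * by blast
        next
          case 2 then show ?thesis using D(8)[of d' j'] by simp
        next
          case 3
          then show ?thesis using D(7)[of d1 j d] * by simp
        qed
      qed
      show "j \<le> d'" if *: "(d1, j) \<in> insert (d, ?p) C" "d' \<in> set os" "d1 < d'" for d1 j d'
      proof (cases "(d1, j) \<in> C")
        case True
        then show ?thesis using D(7)[of d1 j d'] * by simp
      next
        case False
        then have "d < d'" using * by simp
        moreover have "d' < d" using D(5) *(2) by (simp add: sorted_wrt_append)
        ultimately show ?thesis by simp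
      qed
    qed
  qed
qed

text \<open>The root at position \<open>p\<close> starts a hook when the right subtree is nonempty; that hook lies on the
  stack between those of the two subtrees.\<close>

definition join_confs :: "nat \<Rightarrow> ((nat \<times> nat) set \<times> nat list) \<times> ((nat \<times> nat) set \<times> nat list) \<Rightarrow>
    (nat \<times> nat) set \<times> nat list" where
  "join_confs p = (\<lambda>((C1, os1), (C2, os2)). (C1 \<union> C2, os1 @ p # os2))"

text \<open>Hooks of the right subtree cannot have been started on its left, because their ends are ancestors
  within the right subtree, so the two parts are independent.\<close>

lemma hook_confs_Node:
  assumes "r \<noteq> Leaf"
  shows "hook_confs (Node l a r) b = join_confs (b + size l + 1) `
    (hook_confs (Node l a Leaf) b \<times> hook_confs r (b + size l + 1))" (is "?L = ?R")
proof (intro equalityI subsetI)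
  let ?p = "b + size l + 1"
  fix s assume "s \<in> ?L"
  moreover obtain C os where s: "s = (C, os)" by (cases s)
  ultimately have "(C, os) \<in> ?L" by simp
  note D = hook_confsD[OF this]
  have C_cases: "(d, j) \<in> left_pairs (Node l a Leaf) b \<and> d < ?p \<or> (d, j) \<in> left_pairs r ?p \<and> ?p < d"
    if "(d, j) \<in> C" for d j
    using D(1) that left_pairs_bounds[of d j l b] left_pairs_bounds[of d j r ?p] by auto
  have "?p \<in> right_parents (Node l a r) b" using assms by simp
  moreover have "?p \<notin> fst ` C" using C_cases by force
  ultimately have "?p \<in> set os" using D(4) by blast
  then obtain os1 os2 where os: "os = os1 @ ?p # os2" by (meson split_list)
  have os1: "d < ?p" if "d \<in> set os1" for d using D(5) that os by (simp add: sorted_wrt_append)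
  have os2: "?p < d" if "d \<in> set os2" for d using D(5) that os by (simp add: sorted_wrt_append)
  define C1 where "C1 = {c \<in> C. fst c < ?p}"
  define C2 where "C2 = {c \<in> C. ?p < fst c}"
  have C: "C = C1 \<union> C2" using C_cases by (force simp: C1_def C2_def)
  have rp: "d \<in> right_parents (Node l a Leaf) b \<longleftrightarrow> d \<in> right_parents (Node l a r) b \<and> d < ?p"
    "d \<in> right_parents r ?p \<longleftrightarrow> d \<in> right_parents (Node l a r) b \<and> ?p < d" for d
    using right_parents_bounds[of d l b] right_parents_bounds[of d r ?p] assms by auto
  have "(C1, os1) \<in> hook_confs (Node l a Leaf) b"
  proof (rule hook_confsI)
    show "C1 \<subseteq> left_pairs (Node l a Leaf) b"
      using C_cases by (force simp: C1_def)
    show "inj_on fst C1" using D(2) by (rule inj_on_subset) (auto simp: C1_def)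
    show "fst ` C1 \<inter> set os1 = {}" using D(3) unfolding C os by auto
    show "fst ` C1 \<union> set os1 = right_parents (Node l a Leaf) b"
    proof (rule set_eqI)
      fix d
      have "d \<in> fst ` C1 \<union> set os1 \<longleftrightarrow> d \<in> fst ` C \<union> set os \<and> d < ?p"
        using os1 os2 unfolding os C1_def by force
      then show "d \<in> fst ` C1 \<union> set os1 \<longleftrightarrow> d \<in> right_parents (Node l a Leaf) b"
        unfolding rp D(4) .
    qed
    show "sorted_wrt (<) os1" using D(5) os by (simp add: sorted_wrt_append)
    show "j' < j" if "(d, j) \<in> C1" "(d', j') \<in> C1" "d < d'" "d' < j" for d j d' j'
      using D(6)[of d j d' j'] that unfolding C by blast
    show "j \<le> d'" if "(d, j) \<in> C1" "d' \<in> set os1" "d < d'" for d j d'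
      using D(7)[of d j d'] that unfolding C os by simp
  qed
  moreover have "(C2, os2) \<in> hook_confs r ?p"
  proof (rule hook_confsI)
    show "C2 \<subseteq> left_pairs r ?p"
      using C_cases by (force simp: C2_def)
    show "inj_on fst C2" using D(2) by (rule inj_on_subset) (auto simp: C2_def)
    show "fst ` C2 \<inter> set os2 = {}" using D(3) unfolding C os by auto
    show "fst ` C2 \<union> set os2 = right_parents r ?p"
    proof (rule set_eqI)
      fix d
      have "d \<in> fst ` C2 \<union> set os2 \<longleftrightarrow> d \<in> fst ` C \<union> set os \<and> ?p < d"
        using os1 os2 unfolding os C2_def by force
      then show "d \<in> fst ` C2 \<union> set os2 \<longleftrightarrow> d \<in> right_parents r ?p"
        unfolding rp D(4) .
    qed
    show "sorted_wrt (<) os2" using D(5) os by (simp add: sorted_wrt_append)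
    show "j' < j" if "(d, j) \<in> C2" "(d', j') \<in> C2" "d < d'" "d' < j" for d j d' j'
      using D(6)[of d j d' j'] that unfolding C by blast
    show "j \<le> d'" if "(d, j) \<in> C2" "d' \<in> set os2" "d < d'" for d j d'
      using D(7)[of d j d'] that unfolding C os by simp
  qed
  moreover have "s = join_confs ?p ((C1, os1), (C2, os2))"
    using s C os by (simp add: join_confs_def)
  ultimately show "s \<in> ?R" by blast
next
  let ?p = "b + size l + 1"
  fix s assume "s \<in> ?R"
  then obtain C1 os1 C2 os2 where *: "(C1, os1) \<in> hook_confs (Node l a Leaf) b"
    "(C2, os2) \<in> hook_confs r ?p" and s: "s = (C1 \<union> C2, os1 @ ?p # os2)"
    by (auto simp: join_confs_def)
  note D1 = hook_confsD[OF *(1)] and D2 = hook_confsD[OF *(2)]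
  have C1: "d < ?p \<and> j \<le> ?p" if "(d, j) \<in> C1" for d j using D1(8)[OF that] by simp
  have C2: "?p < d" if "(d, j) \<in> C2" for d j using D2(8)[OF that] by simp
  have os1: "d < ?p" if "d \<in> set os1" for d
  proof -
    have "d \<in> right_parents (Node l a Leaf) b" using D1(4) that by blast
    then have "d \<in> right_parents l b" by simp
    from right_parents_bounds[OF this] show ?thesis by simp
  qed
  have os2: "?p < d" if "d \<in> set os2" for d using D2(9)[OF that] by simp
  have fst1: "d < ?p" if "d \<in> fst ` C1" for d using that C1 by force
  have fst2: "?p < d" if "d \<in> fst ` C2" for d using that C2 by force
  show "s \<in> ?L" unfolding s
  proof (rule hook_confsI)
    show "C1 \<union> C2 \<subseteq> left_pairs (Node l a r) b" using D1(1) D2(1) by auto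
    have "fst ` (C1 - C2) \<inter> fst ` (C2 - C1) = {}" using fst1 fst2 by (meson Diff_subset disjoint_iff image_mono in_mono order_less_asym)
    then show "inj_on fst (C1 \<union> C2)" using D1(2) D2(2) by (simp add: inj_on_Un)
    show "fst ` (C1 \<union> C2) \<inter> set (os1 @ ?p # os2) = {}"
    proof (rule ccontr)
      assume "\<not> ?thesis"
      then obtain d where d: "d \<in> fst ` C1 \<or> d \<in> fst ` C2" "d \<in> set os1 \<or> d = ?p \<or> d \<in> set os2" by auto
      then show False
        using fst1[of d] fst2[of d] os1[of d] os2[of d] D1(3) D2(3) by (metis IntI empty_iff less_asym less_irrefl)
    qed
    have "fst ` (C1 \<union> C2) \<union> set (os1 @ ?p # os2) = (fst ` C1 \<union> set os1) \<union> {?p} \<union> (fst ` C2 \<union> set os2)"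
      by auto
    then show "fst ` (C1 \<union> C2) \<union> set (os1 @ ?p # os2) = right_parents (Node l a r) b"
      unfolding D1(4) D2(4) using assms by simp
    show "sorted_wrt (<) (os1 @ ?p # os2)"
      using D1(5) D2(5) os1 os2 by (auto simp: sorted_wrt_append intro: less_trans)
    show "j' < j" if "(d, j) \<in> C1 \<union> C2" "(d', j') \<in> C1 \<union> C2" "d < d'" "d' < j" for d j d' j'
    proof (cases "(d, j) \<in> C1")
      case True
      then have "(d', j') \<notin> C2" using that C1[of d j] C2[of d' j'] by auto
      then show ?thesis using D1(6)[of d j d' j'] that True by blast
    next
      case False
      then have dC: "(d, j) \<in> C2" using that by blast
      then have "(d', j') \<notin> C1" using that C2[of d j] C1[of d' j'] by auto
      then show ?thesis using D2(6)[of d j d' j'] that dC by blast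
    qed
    show "j \<le> d'" if "(d, j) \<in> C1 \<union> C2" "d' \<in> set (os1 @ ?p # os2)" "d < d'" for d j d'
    proof (cases "(d, j) \<in> C1")
      case True
      show ?thesis
      proof (cases "d' \<in> set os1")
        case True
        then show ?thesis using D1(7)[of d j d'] that \<open>(d, j) \<in> C1\<close> by blast
      next
        case False
        then have "?p \<le> d'" using that(2) os2[of d'] by auto
        then show ?thesis using C1[OF True] by simp
      qed
    next
      case False
      then have dC: "(d, j) \<in> C2" using that by blast
      then have "d' \<in> set os2" using C2[OF dC] os1[of d'] that(2,3) by auto
      then show ?thesis using D2(7)[of d j d'] that dC by blast
    qed
  qed
qed

section \<open>Colours and weights of partial hook configurations\<close>

definition cover :: "(nat \<times> nat) set \<Rightarrow> nat list \<Rightarrow> nat \<Rightarrow> nat set" where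
  "cover C os i = {d. d < i \<and> (d \<in> set os \<or> (\<exists>j. (d, j) \<in> C \<and> i \<le> j))}"

text \<open>The hooks above a point are nested, so the lowest one is the one that starts last; it is named by
  its start, and 0, which is not a position, names the sky.  Because \<open>cover\<close> admits the end of a hook,
  the northeast endpoint gets the colour of its own hook by the same rule.\<close>

definition colour_start :: "(nat \<times> nat) set \<Rightarrow> nat list \<Rightarrow> nat \<Rightarrow> nat" where
  "colour_start C os i = Max (insert 0 (cover C os i))"

definition colour_count :: "nat \<Rightarrow> nat \<Rightarrow> (nat \<times> nat) set \<Rightarrow> nat list \<Rightarrow> nat \<Rightarrow> nat" where
  "colour_count b m C os d = card {i \<in> {b<..b + m}. colour_start C os i = d}"

lemma finite_cover: "finite (cover C os i)"
  by (rule finite_subset[of _ "{..<i}"]) (auto simp: cover_def)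

lemma colour_start_less: "0 < i \<Longrightarrow> colour_start C os i < i"
  unfolding colour_start_def using finite_cover[of C os i]
  by (subst Max_less_iff) (auto simp: cover_def)

lemma colour_count_Suc:
  "colour_count b (Suc m) C os d =
     colour_count b m C os d + (if colour_start C os (b + m + 1) = d then 1 else 0)"
proof -
  have "{i \<in> {b<..b + Suc m}. colour_start C os i = d} =
      {i \<in> {b<..b + m}. colour_start C os i = d} \<union>
      (if colour_start C os (b + m + 1) = d then {b + m + 1} else {})"
    by (auto simp: le_Suc_eq)
  then show ?thesis
    by (auto simp: colour_count_def)
qed

lemma colour_count_cong:
  assumes "\<And>i. b < i \<Longrightarrow> i \<le> b + m \<Longrightarrow> cover C os i = cover C' os' i"
  shows "colour_count b m C os d = colour_count b m C' os' d"
proof -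
  have "colour_start C os i = colour_start C' os' i" if "i \<in> {b<..b + m}" for i
    using assms[of i] that by (simp add: colour_start_def)
  then have "{i \<in> {b<..b + m}. colour_start C os i = d} = {i \<in> {b<..b + m}. colour_start C' os' i = d}"
    by (intro Collect_cong) auto
  then show ?thesis by (simp add: colour_count_def)
qed

definition start_word :: "(nat \<Rightarrow> nat) \<Rightarrow> nat list \<Rightarrow> letter list" where
  "start_word c os = replicate (c 0) X @ concat (map (\<lambda>d. Y # replicate (c d) X) os)"

text \<open>Completed hooks contribute the weight of their colour class, the sky and the open hooks remain on
  the stack with their current number of points.\<close>

fun conf_term :: "(nat \<Rightarrow> 'a::comm_ring_1) \<Rightarrow> nat \<Rightarrow> nat \<Rightarrow> (nat \<times> nat) set \<times> nat list \<Rightarrow> 'a ncpoly" where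
  "conf_term k b m (C, os) = sc (\<Prod>d\<in>fst ` C. k (colour_count b m C os d)) *
     wd (start_word (colour_count b m C os) os)"

lemma start_word_cong:
  "(\<And>d. d = 0 \<or> d \<in> set os \<Longrightarrow> c d = c' d) \<Longrightarrow> start_word c os = start_word c' os"
  unfolding start_word_def by (auto cong: map_cong)

lemma start_word_snoc: "start_word c (os @ [d]) = start_word c os @ Y # replicate (c d) X"
  by (simp add: start_word_def)

lemma start_word_increment:
  assumes "distinct os" "0 \<notin> set os" "\<And>d. c' d = c d + (if (if os = [] then 0 else last os) = d then 1 else 0)"
  shows "start_word c' os = start_word c os @ [X]"
proof (cases os rule: rev_cases)
  case Nil
  then show ?thesis using assms(3)[of 0] by (simp add: start_word_def replicate_append_same)
next
  case (snoc os' d)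
  have "start_word c' os' = start_word c os'"
    by (rule start_word_cong) (use assms snoc in auto)
  then show ?thesis
    unfolding snoc start_word_snoc using assms(3)[of d] snoc by (simp add: replicate_append_same)
qed

context
  fixes l :: "'b tree" and b :: nat and C :: "(nat \<times> nat) set" and os :: "nat list"
  assumes conf: "(C, os) \<in> hook_confs l b"
begin

lemmas conf_facts = hook_confsD[OF conf]

lemma cover_next: "cover C os (b + size l + 1) = set os"
proof (rule set_eqI)
  fix d
  have "(d, j) \<in> C \<Longrightarrow> \<not> b + size l + 1 \<le> j" for j using conf_facts(8)[of d j] by simp
  moreover have "d \<in> set os \<Longrightarrow> d < b + size l + 1" using conf_facts(9)[of d] by simp
  ultimately show "d \<in> cover C os (b + size l + 1) \<longleftrightarrow> d \<in> set os"
    unfolding cover_def by blast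
qed

lemma distinct_os: "distinct os" "0 \<notin> set os"
  using conf_facts(5) strict_sorted_iff[of os] conf_facts(9)[of 0] by auto

lemma colour_start_next:
  "colour_start C os (b + size l + 1) = (if os = [] then 0 else last os)"
proof (cases os rule: rev_cases)
  case Nil
  then show ?thesis unfolding colour_start_def cover_next by simp
next
  case (snoc os' d)
  have "Max (insert 0 (set os)) = d"
    using conf_facts(5) snoc by (intro Max_eqI) (auto simp: sorted_wrt_append intro: less_imp_le)
  then show ?thesis unfolding colour_start_def cover_next using snoc by simp
qed

lemma colour_count_next:
  "colour_count b (Suc (size l)) C os d =
     colour_count b (size l) C os d + (if (if os = [] then 0 else last os) = d then 1 else 0)"
  unfolding colour_count_Suc colour_start_next ..

lemma conf_term_keep: "conf_term k b (Suc (size l)) (C, os) = conf_term k b (size l) (C, os) * wd [X]"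
proof -
  have "colour_count b (Suc (size l)) C os d = colour_count b (size l) C os d" if "d \<in> fst ` C" for d
  proof -
    have "d \<notin> set os" using conf_facts(3) that by blast
    moreover have "d \<noteq> 0" using that conf_facts(8) by force
    ultimately show ?thesis unfolding colour_count_next using last_in_set[of os] by auto
  qed
  then have "(\<Prod>d\<in>fst ` C. k (colour_count b (Suc (size l)) C os d))
      = (\<Prod>d\<in>fst ` C. k (colour_count b (size l) C os d))"
    by simp
  moreover have "start_word (colour_count b (Suc (size l)) C os) os
      = start_word (colour_count b (size l) C os) os @ [X]"
    using distinct_os colour_count_next by (rule start_word_increment)
  ultimately show ?thesis
    by (simp only: conf_term.simps mult.assoc wd_mult)
qed

end

lemma conf_term_close:
  assumes conf: "(C, os @ [d]) \<in> hook_confs l b"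
  shows "conf_term k b (Suc (size l)) (insert (d, b + size l + 1) C, os)
       = pop k (conf_term k b (size l) (C, os @ [d]))"
proof -
  note D = hook_confsD[OF conf]
  let ?p = "b + size l + 1"
  let ?C' = "insert (d, ?p) C"
  let ?c = "colour_count b (size l) C (os @ [d])" and ?c' = "colour_count b (Suc (size l)) ?C' os"
  have d: "b < d" "d < ?p" using D(9)[of d] by auto
  have c': "?c' e = ?c e + (if d = e then 1 else 0)" for e
  proof -
    have "?c' e = colour_count b (Suc (size l)) C (os @ [d]) e"
    proof (rule colour_count_cong)
      fix i assume "b < i" "i \<le> b + Suc (size l)"
      then show "cover ?C' os i = cover C (os @ [d]) i"
        unfolding cover_def by auto
    qed
    also have "\<dots> = ?c e + (if d = e then 1 else 0)"
      unfolding colour_count_next[OF conf] by simp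
    finally show ?thesis .
  qed
  have dist: "d \<notin> set os" "0 \<notin> set (os @ [d])"
    using distinct_os[OF conf] by auto
  have d_fst: "d \<notin> fst ` C" using D(3) by simp
  have fin: "finite (fst ` C)"
  proof (rule finite_subset)
    show "fst ` C \<subseteq> {..b + size l}" using D(8) by force
  qed simp
  have "(\<Prod>e\<in>fst ` ?C'. k (?c' e)) = k (?c' d) * (\<Prod>e\<in>fst ` C. k (?c' e))"
    using d_fst fin by simp
  also have "(\<Prod>e\<in>fst ` C. k (?c' e)) = (\<Prod>e\<in>fst ` C. k (?c e))"
  proof (intro prod.cong refl)
    fix e assume "e \<in> fst ` C"
    then have "d \<noteq> e" using d_fst by blast
    then show "k (?c' e) = k (?c e)" using c'[of e] by simp
  qed
  also have "?c' d = Suc (?c d)" using c'[of d] by simp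
  finally have prod: "(\<Prod>e\<in>fst ` ?C'. k (?c' e)) = (\<Prod>e\<in>fst ` C. k (?c e)) * k (Suc (?c d))"
    by (simp only: mult.commute)
  have word: "start_word ?c' os = start_word ?c os"
  proof (rule start_word_cong)
    fix e assume "e = 0 \<or> e \<in> set os"
    then have "d \<noteq> e" using dist by auto
    then show "?c' e = ?c e" using c'[of e] by simp
  qed
  have "pop k (conf_term k b (size l) (C, os @ [d]))
     = sc (\<Prod>e\<in>fst ` C. k (?c e)) * (sc (k (Suc (?c d))) * wd (start_word ?c os))"
    by (simp only: conf_term.simps pop_def lin_ext_monom start_word_snoc pop_word_top)
  also have "\<dots> = conf_term k b (Suc (size l)) (?C', os)"
    by (simp only: conf_term.simps prod word sc_simps(4) mult.assoc)
  finally show ?thesis ..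
qed

lemma pop_conf_term_Nil: "pop k (conf_term k b m (C, [])) = 0"
proof -
  have "pop_word k (start_word (colour_count b m C []) []) = 0"
    by (rule pop_word_no_Y) (simp add: start_word_def)
  then show ?thesis by (simp only: conf_term.simps pop_def lin_ext_monom) simp
qed

text \<open>To the left of the root and at the root the colours do not see the right part.  To the right of
  the root, the hook that starts at the root replaces the sky of the right subtree and hides
  all hooks that are open on the left.\<close>

lemma conf_term_join:
  fixes k :: "nat \<Rightarrow> 'a::comm_ring_1"
  assumes conf1: "(C1, os1) \<in> hook_confs (Node l a Leaf) b"
    and conf2: "(C2, os2) \<in> hook_confs r (b + size l + 1)"
  shows "conf_term k b (Suc (size l + size r)) (C1 \<union> C2, os1 @ (b + size l + 1) # os2)
       = conf_term k b (Suc (size l)) (C1, os1) * (wd [Y] * conf_term k (b + size l + 1) (size r) (C2, os2))"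
proof -
  note D1 = hook_confsD[OF conf1] and D2 = hook_confsD[OF conf2]
  let ?p = "b + size l + 1"
  let ?C = "C1 \<union> C2" and ?os = "os1 @ ?p # os2"
  let ?K = "colour_start ?C ?os" and ?K1 = "colour_start C1 os1" and ?K2 = "colour_start C2 os2"
  let ?c = "colour_count b (Suc (size l + size r)) ?C ?os"
  let ?c1 = "colour_count b (Suc (size l)) C1 os1" and ?c2 = "colour_count ?p (size r) C2 os2"
  have C1: "d < ?p" "j \<le> ?p" if "(d, j) \<in> C1" for d j using D1(8)[OF that] by simp_all
  have C2: "?p < d" if "(d, j) \<in> C2" for d j using D2(8)[OF that] by simp
  have os1: "d < ?p" if "d \<in> set os1" for d
  proof -
    have "d \<in> right_parents (Node l a Leaf) b" using D1(4) that by blast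
    then have "d \<in> right_parents l b" by simp
    from right_parents_bounds[OF this] show ?thesis by simp
  qed
  have os2: "?p < d" if "d \<in> set os2" for d using D2(9)[OF that] by simp
  have col_low: "?K i = ?K1 i" if "i \<le> ?p" for i
  proof -
    have "(d, j) \<notin> C2" "d \<notin> set os2" "d \<noteq> ?p" if "d < i" for d j
      using that \<open>i \<le> ?p\<close> C2[of d j] os2[of d] by auto
    then have "cover ?C ?os i = cover C1 os1 i"
      unfolding cover_def by auto
    then show ?thesis by (simp add: colour_start_def)
  qed
  have col_high: "?K i = (if ?K2 i = 0 then ?p else ?K2 i)"
    if i: "?p < i" for i
  proof -
    have "d < i" if "d \<in> set os1" for d using os1[OF that] i by simp
    moreover have "\<not> i \<le> j" if "(d, j) \<in> C1" for d j using C1(2)[OF that] i by simp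
    ultimately have cov: "cover ?C ?os i = set os1 \<union> insert ?p (cover C2 os2 i)"
      unfolding cover_def using i by auto
    have gt: "?p < d" if "d \<in> cover C2 os2 i" for d
      using that C2[of d] os2[of d] unfolding cover_def by blast
    show ?thesis
    proof (cases "cover C2 os2 i = {}")
      case True
      have "Max (insert 0 (set os1 \<union> insert ?p {})) = ?p"
        using os1 by (intro Max_eqI) (auto intro: less_imp_le)
      then show ?thesis unfolding colour_start_def cov True by simp
    next
      case False
      define M where "M = Max (cover C2 os2 i)"
      have M: "M \<in> cover C2 os2 i" "\<And>d. d \<in> cover C2 os2 i \<Longrightarrow> d \<le> M"
        using False finite_cover[of C2 os2 i] by (auto simp: M_def)
      have "Max (insert 0 (cover C2 os2 i)) = M"
        using M finite_cover[of C2 os2 i] by (intro Max_eqI) auto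
      moreover have "Max (insert 0 (set os1 \<union> insert ?p (cover C2 os2 i))) = M"
      proof (rule Max_eqI)
        show "finite (insert 0 (set os1 \<union> insert ?p (cover C2 os2 i)))"
          using finite_cover[of C2 os2 i] by simp
        show "M \<in> insert 0 (set os1 \<union> insert ?p (cover C2 os2 i))" using M(1) by simp
        fix y assume "y \<in> insert 0 (set os1 \<union> insert ?p (cover C2 os2 i))"
        then consider "y \<le> ?p" | "y \<in> cover C2 os2 i" using os1[of y] by fastforce
        then show "y \<le> M" using gt[OF M(1)] M(2)[of y] by cases auto
      qed
      moreover have "M \<noteq> 0" using gt[OF M(1)] by simp
      ultimately show ?thesis unfolding colour_start_def cov by simp
    qed
  qed
  have split: "?c d = ?c1 d + card {i \<in> {?p<..?p + size r}. ?K i = d}" for d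
  proof -
    let ?I = "{b<..b + Suc (size l)}" and ?J = "{?p<..?p + size r}"
    have IJ: "{b<..b + Suc (size l + size r)} = ?I \<union> ?J" "?I \<inter> ?J = {}" by auto
    have "{i \<in> {b<..b + Suc (size l + size r)}. ?K i = d} =
        {i \<in> ?I. ?K i = d} \<union> {i \<in> ?J. ?K i = d}"
      unfolding IJ(1) by blast
    then have "?c d = card ({i \<in> ?I. ?K i = d} \<union> {i \<in> ?J. ?K i = d})"
      unfolding colour_count_def by simp
    also have "\<dots> = card {i \<in> ?I. ?K i = d} + card {i \<in> ?J. ?K i = d}"
      by (rule card_Un_disjoint) (use IJ(2) in \<open>simp, simp, blast\<close>)
    also have "{i \<in> ?I. ?K i = d} = {i \<in> ?I. ?K1 i = d}"
    proof (intro Collect_cong conj_cong refl)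
      fix i assume "i \<in> ?I"
      then show "?K i = d \<longleftrightarrow> ?K1 i = d"
        using col_low[of i] by simp
    qed
    finally show ?thesis unfolding colour_count_def .
  qed
  have low: "?c d = ?c1 d" if "d < ?p" for d
  proof -
    have "?K i \<noteq> d" if i: "i \<in> {?p<..?p + size r}" for i
    proof (cases "?K2 i = 0")
      case True
      then show ?thesis using col_high[of i] i \<open>d < ?p\<close> by simp
    next
      case False
      have "?K2 i \<in> insert 0 (cover C2 os2 i)"
        unfolding colour_start_def using finite_cover[of C2 os2 i] by (intro Max_in) auto
      then have "?K2 i \<in> cover C2 os2 i" using False by simp
      then have "?p < ?K2 i" using C2 os2 unfolding cover_def by blast
      then show ?thesis using col_high[of i] i \<open>d < ?p\<close> False by simp
    qed
    then have "{i \<in> {?p<..?p + size r}. ?K i = d} = {}" by blast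
    then show ?thesis using split[of d] by simp
  qed
  have high: "?c1 d = 0" if "?p \<le> d" for d
  proof -
    have "?K1 i \<noteq> d" if "i \<in> {b<..b + Suc (size l)}" for i
      using colour_start_less[of i C1 os1] that \<open>?p \<le> d\<close> by simp
    then have "{i \<in> {b<..b + Suc (size l)}. ?K1 i = d} = {}" by blast
    then show ?thesis unfolding colour_count_def by simp
  qed
  have at_p: "?c ?p = ?c2 0"
  proof -
    have "?K i = ?p \<longleftrightarrow> ?K2 i = 0" if "i \<in> {?p<..?p + size r}" for i
    proof -
      have "?K2 i \<in> insert 0 (cover C2 os2 i)"
        unfolding colour_start_def using finite_cover[of C2 os2 i] by (intro Max_in) auto
      moreover have "?p \<notin> cover C2 os2 i" using C2[of ?p] os2[of ?p] unfolding cover_def by blast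
      ultimately have "?K2 i \<noteq> ?p" by auto
      then show ?thesis using col_high[of i] that by simp
    qed
    then have "{i \<in> {?p<..?p + size r}. ?K i = ?p} =
        {i \<in> {?p<..?p + size r}. ?K2 i = 0}" by blast
    then show ?thesis using split[of ?p] high[of ?p] unfolding colour_count_def by simp
  qed
  have high2: "?c d = ?c2 d" if "?p < d" for d
  proof -
    have "?K i = d \<longleftrightarrow> ?K2 i = d" if "i \<in> {?p<..?p + size r}" for i
      using col_high[of i] that \<open>?p < d\<close> by auto
    then have "{i \<in> {?p<..?p + size r}. ?K i = d} =
        {i \<in> {?p<..?p + size r}. ?K2 i = d}" by blast
    then show ?thesis using split[of d] high[of d] that unfolding colour_count_def by simp
  qed
  have fst1: "d < ?p" if "d \<in> fst ` C1" for d using that C1(1) by force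
  have fst2: "?p < d" if "d \<in> fst ` C2" for d using that C2 by force
  have fin: "finite (fst ` C1)" "finite (fst ` C2)"
  proof -
    have "fst ` C1 \<subseteq> {..?p}" using fst1 by force
    then show "finite (fst ` C1)" by (rule finite_subset) simp
    have "fst ` C2 \<subseteq> {..?p + size r}" using D2(8) by force
    then show "finite (fst ` C2)" by (rule finite_subset) simp
  qed
  have "fst ` C1 \<inter> fst ` C2 = {}" using fst1 fst2 by (meson disjoint_iff less_asym)
  then have "(\<Prod>d\<in>fst ` ?C. k (?c d)) = (\<Prod>d\<in>fst ` C1. k (?c d)) * (\<Prod>d\<in>fst ` C2. k (?c d))"
    using fin by (simp add: image_Un prod.union_disjoint)
  also have "(\<Prod>d\<in>fst ` C1. k (?c d)) = (\<Prod>d\<in>fst ` C1. k (?c1 d))"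
    using fst1 low by (intro prod.cong refl) simp
  also have "(\<Prod>d\<in>fst ` C2. k (?c d)) = (\<Prod>d\<in>fst ` C2. k (?c2 d))"
    using fst2 high2 by (intro prod.cong refl) simp
  finally have prod: "(\<Prod>d\<in>fst ` ?C. k (?c d)) =
      (\<Prod>d\<in>fst ` C1. k (?c1 d)) * (\<Prod>d\<in>fst ` C2. k (?c2 d))" .
  have "start_word ?c ?os = start_word ?c os1 @ Y # replicate (?c ?p) X
      @ concat (map (\<lambda>d. Y # replicate (?c d) X) os2)"
    by (simp add: start_word_def)
  also have "start_word ?c os1 = start_word ?c1 os1"
    by (rule start_word_cong) (use low os1 in auto)
  also have "map (\<lambda>d. Y # replicate (?c d) X) os2 = map (\<lambda>d. Y # replicate (?c2 d) X) os2"
    using high2 os2 by simp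
  finally have word: "start_word ?c ?os = start_word ?c1 os1 @ Y # start_word ?c2 os2"
    unfolding at_p by (simp add: start_word_def)
  have mult: "sc x * wd u * (wd [Y] * (sc y * wd v)) = sc (x * y) * wd (u @ Y # v)" for x y :: 'a and u v
    using monom_mult[of 1 "[Y]" y v] monom_mult[of x u y "Y # v"] by (simp add: sc_simps)
  show ?thesis
    unfolding conf_term.simps mult prod word ..
qed

lemma hook_confs_Leaf: "hook_confs Leaf b = {({}, [])}"
  by (auto simp: hook_confs_def)

lemma finite_hook_confs: "finite (hook_confs T b)"
proof (induction T arbitrary: b)
  case Leaf
  then show ?case by (simp add: hook_confs_Leaf)
next
  case (Node l a r)
  have "finite (hook_confs (Node l a Leaf) b)"
    unfolding hook_confs_Node_Leaf using Node.IH(1) by simp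
  then show ?case
    using Node.IH(2) by (cases "r = Leaf") (simp_all add: hook_confs_Node)
qed

lemma sum_hook_confs_Node_Leaf:
  assumes "(\<Sum>s\<in>hook_confs l b. conf_term k b (size l) s) = f"
  shows "(\<Sum>s\<in>hook_confs (Node l a Leaf) b. conf_term k b (Suc (size l)) s) = f * wd [X] + pop k f"
proof -
  let ?p = "b + size l + 1"
  let ?S = "{s \<in> hook_confs l b. snd s \<noteq> []}"
  have mem: "s = (fst s, butlast (snd s) @ [last (snd s)]) \<and>
      (fst s, butlast (snd s) @ [last (snd s)]) \<in> hook_confs l b" if "s \<in> ?S" for s
    using that by (cases s) simp
  have disj: "hook_confs l b \<inter> close_hook ?p ` ?S = {}"
  proof (rule ccontr)
    assume "\<not> ?thesis"
    then obtain C os where "close_hook ?p (C, os) \<in> hook_confs l b" by auto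
    then have "(insert (last os, ?p) C, butlast os) \<in> hook_confs l b" by simp
    from hook_confsD(8)[OF this, of "last os" ?p] show False by simp
  qed
  have inj: "inj_on (close_hook ?p) ?S"
  proof (rule inj_onI)
    fix s t assume st: "s \<in> ?S" "t \<in> ?S" "close_hook ?p s = close_hook ?p t"
    obtain C os C' os' where s: "s = (C, os)" and t: "t = (C', os')" by (cases s, cases t)
    have eq: "insert (last os, ?p) C = insert (last os', ?p) C'" "butlast os = butlast os'"
      using st(3) s t by simp_all
    have nin: "(d, ?p) \<notin> C" "(d, ?p) \<notin> C'" for d
      using hook_confsD(8)[of C os l b d ?p] hook_confsD(8)[of C' os' l b d ?p] st s t by auto
    have "(last os, ?p) \<in> insert (last os', ?p) C'" using eq(1) by blast
    then have "last os = last os'" using nin by auto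
    moreover have "C = C'" using eq(1) nin calculation by (metis insert_ident)
    moreover have "os = os'"
      using st s t eq(2) calculation(1) by (metis (mono_tags, lifting) append_butlast_last_id mem_Collect_eq snd_conv)
    ultimately show "s = t" using s t by simp
  qed
  have "(\<Sum>s\<in>hook_confs (Node l a Leaf) b. conf_term k b (Suc (size l)) s)
      = (\<Sum>s\<in>hook_confs l b. conf_term k b (Suc (size l)) s)
        + (\<Sum>s\<in>close_hook ?p ` ?S. conf_term k b (Suc (size l)) s)"
    unfolding hook_confs_Node_Leaf
    by (rule sum.union_disjoint) (use disj finite_hook_confs[of l b] in auto)
  also have "(\<Sum>s\<in>hook_confs l b. conf_term k b (Suc (size l)) s)
      = (\<Sum>s\<in>hook_confs l b. conf_term k b (size l) s * wd [X])"
  proof (intro sum.cong refl)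
    fix s assume "s \<in> hook_confs l b"
    then show "conf_term k b (Suc (size l)) s = conf_term k b (size l) s * wd [X]"
      by (cases s) (simp only: conf_term_keep)
  qed
  also have "\<dots> = f * wd [X]" by (simp only: sum_distrib_right[symmetric] assms)
  also have "(\<Sum>s\<in>close_hook ?p ` ?S. conf_term k b (Suc (size l)) s)
      = (\<Sum>s\<in>?S. conf_term k b (Suc (size l)) (close_hook ?p s))"
    using inj by (simp only: sum.reindex comp_def)
  also have "\<dots> = (\<Sum>s\<in>?S. pop k (conf_term k b (size l) s))"
  proof (intro sum.cong refl)
    fix s assume "s \<in> ?S"
    from mem[OF this] obtain C os d where "s = (C, os @ [d])" "(C, os @ [d]) \<in> hook_confs l b" by blast
    then show "conf_term k b (Suc (size l)) (close_hook ?p s) = pop k (conf_term k b (size l) s)"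
      by (simp only: close_hook.simps last_snoc butlast_snoc conf_term_close)
  qed
  also have "\<dots> = (\<Sum>s\<in>hook_confs l b. pop k (conf_term k b (size l) s))"
  proof (rule sum.mono_neutral_left)
    show "\<forall>s\<in>hook_confs l b - ?S. pop k (conf_term k b (size l) s) = 0"
    proof
      fix s assume "s \<in> hook_confs l b - ?S"
      then have "s = (fst s, [])" by (cases s) simp
      then show "pop k (conf_term k b (size l) s) = 0" using pop_conf_term_Nil by metis
    qed
  qed (use finite_hook_confs in auto)
  also have "\<dots> = pop k f" unfolding assms[symmetric] by (simp only: pop_def lin_ext_sum)
  finally show ?thesis .
qed

text \<open>The recursion of \<open>tree_poly\<close> follows the decomposition of partial hook configurations at the root.\<close>

theorem sum_hook_confs: "(\<Sum>s\<in>hook_confs T b. conf_term k b (size T) s) = tree_poly k T"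
proof (induction T arbitrary: b)
  case Leaf
  show ?case
    by (simp add: hook_confs_Leaf colour_count_def start_word_def sc_simps)
next
  case (Node l a r)
  note left = sum_hook_confs_Node_Leaf[OF Node.IH(1), of b a]
  show ?case
  proof (cases "r = Leaf")
    case True
    then show ?thesis using left by simp
  next
    case False
    let ?p = "b + size l + 1"
    let ?L = "hook_confs (Node l a Leaf) b" and ?R = "hook_confs r ?p"
    have inj: "inj_on (join_confs ?p) (?L \<times> ?R)"
    proof (rule inj_onI)
      fix s t assume st: "s \<in> ?L \<times> ?R" "t \<in> ?L \<times> ?R" "join_confs ?p s = join_confs ?p t"
      obtain C1 os1 C2 os2 where s: "s = ((C1, os1), (C2, os2))" by (metis prod.exhaust)
      obtain C1' os1' C2' os2' where t: "t = ((C1', os1'), (C2', os2'))" by (metis prod.exhaust)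
      have "(C1, os1) \<in> ?L" "(C2, os2) \<in> ?R" "(C1', os1') \<in> ?L" "(C2', os2') \<in> ?R"
        using st(1,2) unfolding s t by simp_all
      note D1 = hook_confsD[OF this(1)] and D2 = hook_confsD[OF this(2)]
        and D1' = hook_confsD[OF this(3)] and D2' = hook_confsD[OF this(4)]
      have C_eq: "C1 \<union> C2 = C1' \<union> C2'" and os_eq: "os1 @ ?p # os2 = os1' @ ?p # os2'"
        using st(3) unfolding s t join_confs_def by simp_all
      have lt: "d < ?p" if "(d, j) \<in> C1 \<union> C1'" for d j
        using that D1(8)[of d j] D1'(8)[of d j] by auto
      have gt: "?p < d" if "(d, j) \<in> C2 \<union> C2'" for d j
        using that D2(8)[of d j] D2'(8)[of d j] by auto
      have "C1 = {c \<in> C1 \<union> C2. fst c < ?p}" "C1' = {c \<in> C1' \<union> C2'. fst c < ?p}"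
           "C2 = {c \<in> C1 \<union> C2. ?p < fst c}" "C2' = {c \<in> C1' \<union> C2'. ?p < fst c}"
        using lt gt by fastforce+
      then have C: "C1 = C1'" "C2 = C2'" using C_eq by metis+
      have "?p \<notin> set os1" "?p \<notin> set os1'"
      proof -
        have "?p \<notin> right_parents (Node l a Leaf) b"
          using right_parents_bounds[of ?p l b] by auto
        then show "?p \<notin> set os1" "?p \<notin> set os1'" using D1(4) D1'(4) by blast+
      qed
      moreover have "?p \<notin> set os2" "?p \<notin> set os2'"
        using D2(9)[of ?p] D2'(9)[of ?p] by auto
      ultimately have "os1 = os1'" "os2 = os2'"
        using os_eq by (simp_all add: append_Cons_eq_iff)
      then show "s = t" unfolding s t using C by simp
    qed
    have "(\<Sum>s\<in>hook_confs (Node l a r) b. conf_term k b (size (Node l a r)) s)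
        = (\<Sum>s\<in>?L \<times> ?R. conf_term k b (size (Node l a r)) (join_confs ?p s))"
      unfolding hook_confs_Node[OF False] using inj by (simp only: sum.reindex comp_def)
    also have "\<dots> = (\<Sum>(s, t)\<in>?L \<times> ?R. conf_term k b (Suc (size l)) s * (wd [Y] * conf_term k ?p (size r) t))"
    proof (intro sum.cong refl)
      fix st assume "st \<in> ?L \<times> ?R"
      moreover obtain C1 os1 C2 os2 where st: "st = ((C1, os1), (C2, os2))" by (metis prod.exhaust)
      ultimately have "(C1, os1) \<in> ?L" "(C2, os2) \<in> ?R" by simp_all
      from conf_term_join[OF this, of k]
      show "conf_term k b (size (Node l a r)) (join_confs ?p st)
        = (case st of (s, t) \<Rightarrow> conf_term k b (Suc (size l)) s * (wd [Y] * conf_term k ?p (size r) t))"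
        unfolding st join_confs_def by simp
    qed
    also have "\<dots> = (\<Sum>s\<in>?L. conf_term k b (Suc (size l)) s) * (wd [Y] * (\<Sum>t\<in>?R. conf_term k ?p (size r) t))"
      by (simp only: sum.cartesian_product[symmetric] sum_distrib_left[symmetric] sum_distrib_right[symmetric])
    also have "\<dots> = tree_poly k (Node l a r)"
      unfolding left Node.IH(2) using False by simp
    finally show ?thesis .
  qed
qed

section \<open>Valid hook configurations of the in-order reading\<close>

lemma nth_inorder_Node:
  assumes f: "\<And>i. i < size (Node l a r) \<Longrightarrow> f (b + i + 1) = inorder (Node l a r) ! i"
  shows "\<And>i. i < size l \<Longrightarrow> f (b + i + 1) = inorder l ! i"
    and "f (b + size l + 1) = a"
    and "\<And>i. i < size r \<Longrightarrow> f (b + size l + 1 + i + 1) = inorder r ! i"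
proof -
  show "f (b + i + 1) = inorder l ! i" if "i < size l" for i
    using f[of i] that by (simp add: nth_append)
  show "f (b + size l + 1) = a"
    using f[of "size l"] by (simp add: nth_append)
  show "f (b + size l + 1 + i + 1) = inorder r ! i" if "i < size r" for i
    using f[of "size l + 1 + i"] that by (simp add: nth_append add.assoc)
qed

lemma value_in_set_tree:
  assumes "\<And>i. i < size t \<Longrightarrow> f (b + i + 1) = inorder t ! i" "b < x" "x \<le> b + size t"
  shows "f x \<in> set_tree t"
proof -
  have "f x = inorder t ! (x - b - 1)"
    using assms(1)[of "x - b - 1"] assms(2,3) by simp
  moreover have "inorder t ! (x - b - 1) \<in> set (inorder t)"
    using assms(2,3) by (intro nth_mem) simp
  ultimately show ?thesis by simp
qed

text \<open>In a decreasing tree, vertex \<open>d\<close> lies in the left subtree of vertex \<open>j\<close> exactly if \<open>j\<close> dominates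
  all positions from \<open>d\<close> up to \<open>j\<close>: if \<open>d < j\<close> and \<open>d\<close> is not below \<open>j\<close> on the left, their lowest
  common ancestor is a position in \<open>{d..<j}\<close> with a larger label.\<close>

lemma left_pairs_iff:
  assumes "decreasing_tree t" "\<And>i. i < size t \<Longrightarrow> f (b + i + 1) = inorder t ! i"
    "b < d" "d < j" "j \<le> b + size t"
  shows "(d, j) \<in> left_pairs t b \<longleftrightarrow> (\<forall>x. d \<le> x \<longrightarrow> x < j \<longrightarrow> f x < f j)"
  using assms
proof (induction t arbitrary: b)
  case (Node l a r)
  let ?p = "b + size l + 1"
  note f = nth_inorder_Node[OF Node.prems(2)]
  have dec: "decreasing_tree l" "decreasing_tree r" "\<And>x. x \<in> set_tree l \<union> set_tree r \<Longrightarrow> x < a"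
    using Node.prems(1) unfolding decreasing_tree_Node_iff by auto
  have low: "f x < a" if "b < x" "x < ?p" for x
    using dec(3)[of "f x"] value_in_set_tree[of l f b x, OF f(1)] that by auto
  have high: "f x < a" if "?p < x" "x \<le> ?p + size r" for x
    using dec(3)[of "f x"] value_in_set_tree[of r f ?p x, OF f(3)] that by auto
  consider "j < ?p" | "j = ?p" | "?p < j" "?p < d" | "?p < j" "d \<le> ?p" by linarith
  then show ?case
  proof cases
    case 1
    have "(d, j) \<in> left_pairs (Node l a r) b \<longleftrightarrow> (d, j) \<in> left_pairs l b"
      using 1 left_pairs_bounds[of d j r ?p] Node.prems(4) by auto
    moreover have "(d, j) \<in> left_pairs l b \<longleftrightarrow> (\<forall>x. d \<le> x \<longrightarrow> x < j \<longrightarrow> f x < f j)"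
      by (rule Node.IH(1)[OF dec(1) f(1)]) (use 1 Node.prems in simp_all)
    ultimately show ?thesis by simp
  next
    case 2
    have "(d, j) \<in> left_pairs (Node l a r) b" using 2 Node.prems(3,4) by simp
    moreover have "f x < f j" if "d \<le> x" "x < j" for x
      using low[of x] that 2 f(2) Node.prems(3) by simp
    ultimately show ?thesis by blast
  next
    case 3
    have "(d, j) \<in> left_pairs (Node l a r) b \<longleftrightarrow> (d, j) \<in> left_pairs r ?p"
      using 3 left_pairs_bounds[of d j l b] by auto
    moreover have "(d, j) \<in> left_pairs r ?p \<longleftrightarrow> (\<forall>x. d \<le> x \<longrightarrow> x < j \<longrightarrow> f x < f j)"
      by (rule Node.IH(2)[OF dec(2) f(3)]) (use 3 Node.prems in simp_all)
    ultimately show ?thesis by simp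
  next
    case 4
    have "(d, j) \<notin> left_pairs (Node l a r) b"
      using 4 left_pairs_bounds[of d j l b] left_pairs_bounds[of d j r ?p] by auto
    moreover have "\<not> f ?p < f j" using high[of j] 4 f(2) Node.prems(5) by simp
    ultimately show ?thesis using 4 by blast
  qed
qed simp

lemma right_parents_iff:
  assumes "decreasing_tree t" "\<And>i. i < size t \<Longrightarrow> f (b + i + 1) = inorder t ! i"
    "b < d" "d < b + size t"
  shows "d \<in> right_parents t b \<longleftrightarrow> f (d + 1) < f d"
  using assms
proof (induction t arbitrary: b)
  case (Node l a r)
  let ?p = "b + size l + 1"
  note f = nth_inorder_Node[OF Node.prems(2)]
  have dec: "decreasing_tree l" "decreasing_tree r" "\<And>x. x \<in> set_tree l \<union> set_tree r \<Longrightarrow> x < a"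
    using Node.prems(1) unfolding decreasing_tree_Node_iff by auto
  have low: "f x < a" if "b < x" "x < ?p" for x
    using dec(3)[of "f x"] value_in_set_tree[of l f b x, OF f(1)] that by auto
  have high: "f x < a" if "?p < x" "x \<le> ?p + size r" for x
    using dec(3)[of "f x"] value_in_set_tree[of r f ?p x, OF f(3)] that by auto
  consider "d < b + size l" | "d = b + size l" | "d = ?p" | "?p < d" by linarith
  then show ?case
  proof cases
    case 1
    have "d \<in> right_parents (Node l a r) b \<longleftrightarrow> d \<in> right_parents l b"
      using 1 right_parents_bounds'[of d r ?p] by auto
    moreover have "d \<in> right_parents l b \<longleftrightarrow> f (d + 1) < f d"
      by (rule Node.IH(1)[OF dec(1) f(1)]) (use 1 Node.prems in simp_all)
    ultimately show ?thesis by simp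
  next
    case 2
    have "d \<notin> right_parents (Node l a r) b"
      using 2 right_parents_bounds'[of d r ?p] right_parents_bounds'[of d l b] by auto
    moreover have "\<not> f (d + 1) < f d"
      using low[of d] 2 f(2) Node.prems(3) by simp
    ultimately show ?thesis by simp
  next
    case 3
    have "r \<noteq> Leaf" "1 \<le> size r" using 3 Node.prems(4) by (cases r, simp_all)+
    then have "d \<in> right_parents (Node l a r) b" using 3 by simp
    moreover have "f (d + 1) < f d"
      using high[of "d + 1"] 3 f(2) \<open>1 \<le> size r\<close> by simp
    ultimately show ?thesis by simp
  next
    case 4
    have "d \<in> right_parents (Node l a r) b \<longleftrightarrow> d \<in> right_parents r ?p"
      using 4 right_parents_bounds'[of d l b] by auto
    moreover have "d \<in> right_parents r ?p \<longleftrightarrow> f (d + 1) < f d"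
      by (rule Node.IH(2)[OF dec(2) f(3)]) (use 4 Node.prems in simp_all)
    ultimately show ?thesis by simp
  qed
qed simp

context
  fixes t :: "nat tree" and \<pi> :: "nat list"
  assumes dec: "decreasing_tree t" and \<pi>: "\<pi> = inorder t"
begin

lemma entry_inorder: "i < size t \<Longrightarrow> entry \<pi> (0 + i + 1) = inorder t ! i"
  by (simp add: entry_def \<pi>)

lemma length_perm: "length \<pi> = size t"
  by (simp add: \<pi>)

lemma descents_eq: "descents \<pi> = right_parents t 0"
proof (rule set_eqI)
  fix d
  show "d \<in> descents \<pi> \<longleftrightarrow> d \<in> right_parents t 0"
  proof (cases "0 < d \<and> d < size t")
    case True
    then have "d \<in> right_parents t 0 \<longleftrightarrow> entry \<pi> (d + 1) < entry \<pi> d"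
      using right_parents_iff[OF dec entry_inorder, of d] by simp
    then show ?thesis using True length_perm by (simp add: descents_def)
  next
    case False
    then show ?thesis
      using right_parents_bounds'[of d t 0] length_perm by (auto simp: descents_def)
  qed
qed

lemma left_pairs_hook:
  "(d, j) \<in> left_pairs t 0 \<longleftrightarrow>
     is_hook \<pi> (d, j) \<and> (\<forall>x. d < x \<and> x < j \<longrightarrow> entry \<pi> x < entry \<pi> j)"
proof (cases "0 < d \<and> d < j \<and> j \<le> size t")
  case True
  then have "(d, j) \<in> left_pairs t 0 \<longleftrightarrow> (\<forall>x. d \<le> x \<longrightarrow> x < j \<longrightarrow> entry \<pi> x < entry \<pi> j)"
    using left_pairs_iff[OF dec entry_inorder, of d j] by simp
  moreover have "\<dots> \<longleftrightarrow> entry \<pi> d < entry \<pi> j \<and> (\<forall>x. d < x \<and> x < j \<longrightarrow> entry \<pi> x < entry \<pi> j)"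
    using True by (metis le_neq_implies_less less_imp_le order_refl)
  ultimately show ?thesis using True length_perm by (simp add: is_hook_def)
next
  case False
  then show ?thesis
    using left_pairs_bounds[of d j t 0] length_perm by (auto simp: is_hook_def)
qed

text \<open>The vertical segment of the hook that starts later can only meet the horizontal segment of the
  earlier one, and if it starts below that segment, it reaches it exactly if it does not end before it.\<close>

lemma hooks_disjoint_iff:
  assumes h: "(d, j) \<in> left_pairs t 0" "(d', j') \<in> left_pairs t 0" and less: "d < d'"
    and no_touch: "j \<noteq> d'"
  shows "hook_points \<pi> (d, j) \<inter> hook_points \<pi> (d', j') = {} \<longleftrightarrow> (d' < j \<longrightarrow> j' < j)"
proof -
  have b: "d < j" "d' < j'" using left_pairs_bounds[OF h(1)] left_pairs_bounds[OF h(2)] by auto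
  have e: "entry \<pi> x < entry \<pi> j" if "d \<le> x" "x < j" for x
    using h(1) that unfolding left_pairs_hook is_hook_def by (cases "x = d") auto
  have e': "entry \<pi> x < entry \<pi> j'" if "d' \<le> x" "x < j'" for x
    using h(2) that unfolding left_pairs_hook is_hook_def by (cases "x = d'") auto
  show ?thesis
  proof (cases "d' < j \<and> j \<le> j'")
    case True
    have "entry \<pi> j \<le> entry \<pi> j'" using e'[of j] True by (cases "j = j'") auto
    moreover have "entry \<pi> d' \<le> entry \<pi> j" using e[of d'] True less by simp
    ultimately have "(real d', real (entry \<pi> j)) \<in> hook_points \<pi> (d, j) \<inter> hook_points \<pi> (d', j')"
      using True less by (simp add: hook_points_def)
    then show ?thesis using True by auto
  next
    case False
    have "q \<notin> hook_points \<pi> (d', j')" if q: "q \<in> hook_points \<pi> (d, j)" for q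
    proof
      assume q': "q \<in> hook_points \<pi> (d', j')"
      obtain x y where xy: "q = (x, y)" by (cases q)
      have "real d' \<le> x" "y \<le> real (entry \<pi> j')"
        using q' b e'[of d'] unfolding xy hook_points_def by auto
      moreover from this have "x \<le> real j" "y = real (entry \<pi> j)"
        using q b less unfolding xy hook_points_def by auto
      ultimately have "d' \<le> j" "entry \<pi> j \<le> entry \<pi> j'" by linarith+
      then have "d' < j" using no_touch by simp
      then have "j' < j" using False by simp
      then show False using e[of j'] \<open>entry \<pi> j \<le> entry \<pi> j'\<close> b less by simp
    qed
    then show ?thesis using False by auto
  qed
qed

lemma hook_confs_no_open_iff:
  "(C, []) \<in> hook_confs t 0 \<longleftrightarrow> C \<subseteq> left_pairs t 0 \<and> inj_on fst C \<and> fst ` C = descents \<pi> \<and>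
     (\<forall>d j d' j'. (d, j) \<in> C \<longrightarrow> (d', j') \<in> C \<longrightarrow> d < d' \<longrightarrow> d' < j \<longrightarrow> j' < j)"
  unfolding hook_confs_def descents_eq by simp

lemma VHC_imp_conf:
  assumes "H \<in> VHC \<pi>"
  shows "(set H, []) \<in> hook_confs t 0"
proof -
  note conj = assms[unfolded VHC_def mem_Collect_eq]
  note H = conj[THEN conjunct1] conj[THEN conjunct2, THEN conjunct1]
    conj[THEN conjunct2, THEN conjunct2, THEN conjunct1]
    conj[THEN conjunct2, THEN conjunct2, THEN conjunct2]
  have "finite (descents \<pi>)"
    by (rule finite_subset[of _ "{..length \<pi>}"]) (auto simp: descents_def)
  then have fst: "fst ` set H = descents \<pi>"
    using arg_cong[OF H(2), of set] by simp
  have "distinct (map fst H)" unfolding H(2) by simp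
  then have inj: "inj_on fst (set H)" by (simp add: distinct_map)
  have sub: "set H \<subseteq> left_pairs t 0"
  proof
    fix h assume h: "h \<in> set H"
    obtain d j where hdj: "h = (d, j)" by (cases h)
    have "\<forall>x. d < x \<and> x < j \<longrightarrow> entry \<pi> x < entry \<pi> j"
      using bspec[OF H(3) h] unfolding hdj prod.case .
    moreover have "is_hook \<pi> (d, j)" using H(1) h hdj by simp
    ultimately show "h \<in> left_pairs t 0" unfolding hdj left_pairs_hook by simp
  qed
  have "j' < j" if *: "(d, j) \<in> set H" "(d', j') \<in> set H" "d < d'" "d' < j" for d j d' j'
  proof -
    obtain a b where ab: "a < length H" "H ! a = (d, j)" "b < length H" "H ! b = (d', j')"
      using *(1,2) by (metis in_set_conv_nth)
    have "a \<noteq> b" using ab *(3) by auto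
    then have "hook_points \<pi> (d, j) \<inter> hook_points \<pi> (d', j') = {} \<or> j = d' \<or> j' = d"
      using H(4)[rule_format, OF ab(1,3)] unfolding ab(2,4) by simp
    moreover have "d' < j'" using left_pairs_bounds[of d' j' t 0] sub *(2) by blast
    ultimately show ?thesis
      using hooks_disjoint_iff[of d j d' j'] sub * by auto
  qed
  then show ?thesis
    unfolding hook_confs_no_open_iff using sub inj fst by blast
qed

lemma conf_imp_VHC:
  assumes conf: "(C, []) \<in> hook_confs t 0"
  defines "H \<equiv> map (inv_into C fst) (sorted_list_of_set (descents \<pi>))"
  shows "H \<in> VHC \<pi>" and "set H = C"
proof -
  have C: "C \<subseteq> left_pairs t 0" "inj_on fst C" "fst ` C = descents \<pi>"
    and nest: "\<And>d j d' j'. (d, j) \<in> C \<Longrightarrow> (d', j') \<in> C \<Longrightarrow> d < d' \<Longrightarrow> d' < j \<Longrightarrow> j' < j"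
    using conf unfolding hook_confs_no_open_iff by blast+
  have fin: "finite (descents \<pi>)"
    by (rule finite_subset[of _ "{..length \<pi>}"]) (auto simp: descents_def)
  have "set H = inv_into C fst ` fst ` C" using fin C(3) by (simp add: H_def)
  also have "\<dots> = C" using C(2) by (simp add: inv_into_image_cancel)
  finally show set_H: "set H = C" .
  have fst_H: "map fst H = sorted_list_of_set (descents \<pi>)"
  proof -
    have "map fst H = map (\<lambda>d. fst (inv_into C fst d)) (sorted_list_of_set (descents \<pi>))"
      by (simp add: H_def)
    also have "\<dots> = map (\<lambda>d. d) (sorted_list_of_set (descents \<pi>))"
      using fin C(3) by (intro map_cong refl) (simp add: f_inv_into_f)
    finally show ?thesis by simp
  qed
  have dist: "distinct H"
    using fst_H by (metis distinct_map distinct_sorted_list_of_set)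
  have pair: "hook_points \<pi> (d, j) \<inter> hook_points \<pi> (d', j') = {} \<or> j = d'"
    if "(d, j) \<in> C" "(d', j') \<in> C" "d < d'" for d j d' j'
    using hooks_disjoint_iff[of d j d' j'] nest[OF that] C(1) that by blast
  show "H \<in> VHC \<pi>"
    unfolding VHC_def mem_Collect_eq
  proof (intro conjI fst_H)
    show "\<forall>h\<in>set H. is_hook \<pi> h"
      using C(1) left_pairs_hook unfolding set_H by (metis prod.exhaust subsetD)
    show "\<forall>(d, j)\<in>set H. \<forall>x. d < x \<and> x < j \<longrightarrow> entry \<pi> x < entry \<pi> j"
      unfolding set_H using C(1) left_pairs_hook by blast
    show "\<forall>a<length H. \<forall>b<length H. a \<noteq> b \<longrightarrow>
        hook_points \<pi> (H ! a) \<inter> hook_points \<pi> (H ! b) = {} \<or>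
        snd (H ! a) = fst (H ! b) \<or> snd (H ! b) = fst (H ! a)"
    proof (intro allI impI)
      fix a b assume ab: "a < length H" "b < length H" "a \<noteq> b"
      obtain d j where a: "H ! a = (d, j)" by (cases "H ! a")
      obtain d' j' where b: "H ! b = (d', j')" by (cases "H ! b")
      have mem: "(d, j) \<in> C" "(d', j') \<in> C" using ab a b set_H nth_mem by metis+
      have "(d, j) \<noteq> (d', j')" using ab a b dist nth_eq_iff_index_eq by metis
      then have "d \<noteq> d'" using inj_onD[OF C(2) _ mem] by auto
      then consider "d < d'" | "d' < d" by linarith
      then show "hook_points \<pi> (H ! a) \<inter> hook_points \<pi> (H ! b) = {} \<or>
        snd (H ! a) = fst (H ! b) \<or> snd (H ! b) = fst (H ! a)"
      proof cases
        case 1 then show ?thesis using pair[OF mem] unfolding a b fst_conv snd_conv by blast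
      next
        case 2 then show ?thesis using pair[OF mem(2,1)] unfolding a b fst_conv snd_conv by blast
      qed
    qed
  qed
qed

lemma bij_VHC: "bij_betw set (VHC \<pi>) {C. (C, []) \<in> hook_confs t 0}"
proof (rule bij_betw_byWitness[where f' = "\<lambda>C. map (inv_into C fst) (sorted_list_of_set (descents \<pi>))"])
  show "\<forall>H\<in>VHC \<pi>. map (inv_into (set H) fst) (sorted_list_of_set (descents \<pi>)) = H"
  proof
    fix H assume H: "H \<in> VHC \<pi>"
    have "inj_on fst (set H)"
      using VHC_imp_conf[OF H] unfolding hook_confs_no_open_iff by blast
    then have "map (inv_into (set H) fst) (map fst H) = H"
      by (auto simp: map_idI)
    moreover have "map fst H = sorted_list_of_set (descents \<pi>)"
      using H unfolding VHC_def by blast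
    ultimately show "map (inv_into (set H) fst) (sorted_list_of_set (descents \<pi>)) = H" by simp
  qed
qed (use VHC_imp_conf conf_imp_VHC in auto)

end

section \<open>The partition of a valid hook configuration\<close>

context
  fixes t :: "nat tree" and \<pi> :: "nat list" and H :: "(nat \<times> nat) list"
  assumes dec: "decreasing_tree t" and \<pi>: "\<pi> = inorder t" and H: "H \<in> VHC \<pi>"
begin

lemmas VHC_conf = VHC_imp_conf[OF dec \<pi> H]

lemmas VHC_conf_facts = hook_confsD[OF VHC_conf]

lemma entry_below_end:
  assumes "(d, j) \<in> set H" "d \<le> x" "x < j"
  shows "entry \<pi> x < entry \<pi> j"
proof -
  have "(d, j) \<in> left_pairs t 0" using VHC_conf_facts(1) assms(1) by blast
  then show ?thesis
    using assms(2,3) left_pairs_hook[OF dec \<pi>] by (cases "x = d") (auto simp: is_hook_def)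
qed

lemma hook_of_start: "(d, j) \<in> set H \<Longrightarrow> inv_into (set H) fst d = (d, j)"
  using inv_into_f_f[OF VHC_conf_facts(2), of "(d, j)"] by simp

lemma colour_start_eq_iff:
  assumes "(d, j) \<in> set H" "d < i" "i \<le> j"
    "\<And>d' j'. (d', j') \<in> set H \<Longrightarrow> d' < i \<Longrightarrow> i \<le> j' \<Longrightarrow> d' \<le> d"
  shows "colour_start (set H) [] i = d"
  unfolding colour_start_def
proof (rule Max_eqI)
  show "finite (insert 0 (cover (set H) [] i))" using finite_cover by simp
  show "d \<in> insert 0 (cover (set H) [] i)" using assms(1-3) by (auto simp: cover_def)
  fix y assume "y \<in> insert 0 (cover (set H) [] i)"
  then show "y \<le> d" using assms(4)[of y] by (auto simp: cover_def)
qed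

text \<open>At the end of a hook that hook is the last one started among those covering the point, and
  elsewhere the covering hook that starts last ends first and therefore at the lowest height.\<close>

lemma colour_eq:
  "colour \<pi> H i = (if colour_start (set H) [] i = 0 then None
     else Some (inv_into (set H) fst (colour_start (set H) [] i)))"
proof (cases "\<exists>h\<in>set H. snd h = i")
  case True
  then obtain d where h: "(d, i) \<in> set H" by force
  have less: "d < i" "0 < d" using VHC_conf_facts(8)[OF h] by auto
  have max: "d' \<le> d" if "(d', j') \<in> set H" "d' < i" "i \<le> j'" for d' j'
    using VHC_conf_facts(6)[OF h that(1)] that by linarith
  have "(THE h. h \<in> set H \<and> snd h = i) = (d, i)"
  proof (rule the_equality)
    fix h' assume "h' \<in> set H \<and> snd h' = i"
    then obtain d' where h': "h' = (d', i)" "(d', i) \<in> set H" by (cases h') auto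
    have "d' < i" using VHC_conf_facts(8)[OF h'(2)] by simp
    then have "d' \<le> d" using max[OF h'(2)] by simp
    moreover have "\<not> d' < d" using VHC_conf_facts(6)[OF h'(2) h] less by linarith
    ultimately show "h' = (d, i)" using h' by simp
  qed (use h in simp)
  moreover have "colour_start (set H) [] i = d"
    by (rule colour_start_eq_iff[OF h less(1) order_refl max])
  ultimately show ?thesis
    using True less(2) hook_of_start[OF h] by (simp add: colour_def)
next
  case no_end: False
  show ?thesis
  proof (cases "\<exists>h\<in>set H. fst h < i \<and> i < snd h")
    case True
    let ?K = "cover (set H) [] i"
    define d where "d = Max ?K"
    have "?K \<noteq> {}" using True by (force simp: cover_def)
    then have d: "d \<in> ?K" and max: "\<And>d'. d' \<in> ?K \<Longrightarrow> d' \<le> d"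
      using finite_cover by (auto simp: d_def)
    obtain j where h: "(d, j) \<in> set H" "d < i" "i \<le> j" using d by (auto simp: cover_def)
    then have j: "i < j" using no_end by force
    have min: "entry \<pi> j < entry \<pi> (snd h')" if "h' \<in> set H" "fst h' < i" "i < snd h'" "h' \<noteq> (d, j)" for h'
    proof -
      obtain d' j' where h': "h' = (d', j')" by (cases h')
      have "d' \<in> ?K" using that unfolding h' cover_def by auto
      moreover have "d' \<noteq> d"
        using that hook_of_start[OF h(1)] hook_of_start[of d' j'] unfolding h' by auto
      ultimately have less: "d' < d" using max[of d'] by simp
      have "j < j'"
        using VHC_conf_facts(6)[of d' j' d j] that(1,3) h less unfolding h' by simp
      then show ?thesis
        using entry_below_end[of d' j' j] that(1) less h(2,3) unfolding h' by simp
    qed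
    have "(ARG_MIN (\<lambda>h. entry \<pi> (snd h)) h. h \<in> set H \<and> fst h < i \<and> i < snd h) = (d, j)"
      unfolding arg_min_def is_arg_min_def
    proof (rule some_equality)
      show "((d, j) \<in> set H \<and> fst (d, j) < i \<and> i < snd (d, j)) \<and>
          (\<nexists>y. (y \<in> set H \<and> fst y < i \<and> i < snd y) \<and> entry \<pi> (snd y) < entry \<pi> (snd (d, j)))"
        using h j min by (metis fst_conv less_asym less_irrefl snd_conv)
    next
      fix h' assume h': "(h' \<in> set H \<and> fst h' < i \<and> i < snd h') \<and>
          (\<nexists>y. (y \<in> set H \<and> fst y < i \<and> i < snd y) \<and> entry \<pi> (snd y) < entry \<pi> (snd h'))"
      show "h' = (d, j)"
      proof (rule ccontr)
        assume "h' \<noteq> (d, j)"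
        then have "entry \<pi> (snd (d, j)) < entry \<pi> (snd h')" using min[of h'] h' by simp
        moreover have "(d, j) \<in> set H \<and> fst (d, j) < i \<and> i < snd (d, j)" using h j by simp
        ultimately show False using h' by blast
      qed
    qed
    moreover have "colour_start (set H) [] i = d"
      using h max by (intro colour_start_eq_iff[of d j]) (auto simp: cover_def)
    moreover have "0 < d" using VHC_conf_facts(8)[OF h(1)] by simp
    ultimately show ?thesis
      using True no_end hook_of_start[OF h(1)] by (simp add: colour_def)
  next
    case False
    have "cover (set H) [] i = {}"
    proof (rule ccontr)
      assume "cover (set H) [] i \<noteq> {}"
      then obtain d j where h: "(d, j) \<in> set H" "d < i" "i \<le> j" by (auto simp: cover_def)
      have "i \<noteq> j" using h(1) no_end by force
      then show False using False h by force
    qed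
    then have "colour_start (set H) [] i = 0" by (simp add: colour_start_def)
    then show ?thesis using False no_end by (simp add: colour_def)
  qed
qed

lemma colour_start_range: "colour_start (set H) [] i \<in> insert 0 (fst ` set H)"
proof -
  have "colour_start (set H) [] i \<in> insert 0 (cover (set H) [] i)"
    unfolding colour_start_def using finite_cover by (intro Max_in) auto
  moreover have "cover (set H) [] i \<subseteq> fst ` set H" by (force simp: cover_def)
  ultimately show ?thesis by blast
qed

lemma colour_eq_colour_iff:
  "colour \<pi> H i = colour \<pi> H i' \<longleftrightarrow> colour_start (set H) [] i = colour_start (set H) [] i'"
  "colour \<pi> H i = None \<longleftrightarrow> colour_start (set H) [] i = 0"
proof -
  have "inj_on (inv_into (set H) fst) (fst ` set H)" by (rule inj_on_inv_into) simp
  then show "colour \<pi> H i = colour \<pi> H i' \<longleftrightarrow> colour_start (set H) [] i = colour_start (set H) [] i'"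
    unfolding colour_eq using colour_start_range[of i] colour_start_range[of i']
    by (auto dest: inj_onD)
  show "colour \<pi> H i = None \<longleftrightarrow> colour_start (set H) [] i = 0"
    unfolding colour_eq by simp
qed

text \<open>The blocks are the fibres of the colouring, one for the sky and one for each hook, since a hook
  colours at least its end.  The point added to the sky explains the successor.\<close>

lemma weight_hook_partition:
  fixes k :: "nat \<Rightarrow> 'a::field"
  defines "c \<equiv> colour_count 0 (size t) (set H) []"
  shows "partition_weight k (hook_partition \<pi> H) = k (Suc (c 0)) * (\<Prod>d\<in>fst ` set H. k (c d))"
proof -
  let ?K = "colour_start (set H) []"
  define n where "n = Suc (size t)"
  define g where "g i = (if i = n then 0 else ?K i)" for i
  define F where "F d = {i \<in> {1..n}. g i = d}" for d
  have col: "(if i = n then None else colour \<pi> H i) = (if i' = n then None else colour \<pi> H i') \<longleftrightarrow> g i = g i'"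
    for i i'
  proof -
    have "None = colour \<pi> H j \<longleftrightarrow> 0 = ?K j" for j
      using colour_eq_colour_iff(2)[of j] by metis
    then show ?thesis
      using colour_eq_colour_iff unfolding g_def by (cases "i = n"; cases "i' = n") simp_all
  qed
  have len: "length \<pi> + 1 = n" by (simp add: n_def \<pi>)
  have F_image: "{1..n} // {(i, i'). i \<in> {1..n} \<and> i' \<in> {1..n} \<and> g i = g i'} = F ` g ` {1..n}"
  proof -
    have "{(i, i'). i \<in> {1..n} \<and> i' \<in> {1..n} \<and> g i = g i'} `` {i} = F (g i)" if "i \<in> {1..n}" for i
      using that unfolding F_def by auto
    then show ?thesis unfolding quotient_def by (auto simp: image_iff)
  qed
  have part: "hook_partition \<pi> H = F ` g ` {1..n}"
    unfolding hook_partition_def Let_def len col F_image ..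
  have range: "g ` {1..n} = insert 0 (fst ` set H)"
  proof (intro equalityI subsetI)
    fix d assume "d \<in> g ` {1..n}"
    then show "d \<in> insert 0 (fst ` set H)"
      using colour_start_range unfolding g_def by (auto split: if_splits)
  next
    fix d assume "d \<in> insert 0 (fst ` set H)"
    then consider "d = 0" | j where "(d, j) \<in> set H" by auto
    then show "d \<in> g ` {1..n}"
    proof cases
      case 1
      then have "d = g n" "n \<in> {1..n}" by (auto simp: g_def n_def)
      then show ?thesis by blast
    next
      case (2 j)
      have j: "d < j" "j \<le> size t" using VHC_conf_facts(8)[OF 2] by auto
      have "?K j = d"
      proof (rule colour_start_eq_iff[OF 2 j(1) order_refl])
        fix d' j' assume *: "(d', j') \<in> set H" "d' < j" "j \<le> j'"
        then show "d' \<le> d" using VHC_conf_facts(6)[OF 2 *(1)] by linarith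
      qed
      then have "d = g j" "j \<in> {1..n}" using j by (auto simp: g_def n_def)
      then show ?thesis by blast
    qed
  qed
  have inj: "inj_on F (g ` {1..n})"
  proof (rule inj_onI)
    fix d d' assume "d \<in> g ` {1..n}" "F d = F d'"
    then obtain i where "i \<in> {1..n}" "d = g i" by blast
    then have "i \<in> F d" by (simp add: F_def)
    then have "i \<in> F d'" using \<open>F d = F d'\<close> by simp
    then show "d = d'" using \<open>d = g i\<close> by (simp add: F_def)
  qed
  have card_F: "card (F d) = c d + (if d = 0 then 1 else 0)" for d
  proof -
    have "F d = {i \<in> {0<..0 + size t}. ?K i = d} \<union> (if d = 0 then {n} else {})"
      unfolding F_def g_def n_def by (auto split: if_splits)
    moreover have "n \<notin> {i \<in> {0<..0 + size t}. ?K i = d}" by (simp add: n_def)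
    ultimately show ?thesis unfolding c_def colour_count_def by auto
  qed
  have zero: "0 \<notin> fst ` set H" using VHC_conf_facts(8) by force
  have "partition_weight k (hook_partition \<pi> H) = (\<Prod>d\<in>g ` {1..n}. k (card (F d)))"
    unfolding partition_weight_def part using inj by (simp add: prod.reindex)
  also have "\<dots> = k (card (F 0)) * (\<Prod>d\<in>fst ` set H. k (card (F d)))"
    unfolding range using zero by simp
  also have "(\<Prod>d\<in>fst ` set H. k (card (F d))) = (\<Prod>d\<in>fst ` set H. k (c d))"
  proof (intro prod.cong refl)
    fix d assume "d \<in> fst ` set H"
    then have "d \<noteq> 0" using zero by metis
    then show "k (card (F d)) = k (c d)" by (simp add: card_F)
  qed
  finally show ?thesis by (simp add: card_F)
qed

end

lemma start_word_no_Y: "Y \<in> set (start_word c os) \<longleftrightarrow> os \<noteq> []"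
  by (cases os) (auto simp: start_word_def)

lemma eps_tree_poly:
  fixes k :: "nat \<Rightarrow> 'a::field"
  assumes "decreasing_tree t"
  shows "eps k (tree_poly k t) =
    sc (\<Sum>H\<in>VHC (inorder t). partition_weight k (hook_partition (inorder t) H))"
proof -
  define w where "w C = k (Suc (colour_count 0 (size t) C [] 0)) *
      (\<Prod>d\<in>fst ` C. k (colour_count 0 (size t) C [] d))" for C
  let ?S = "hook_confs t 0"
  have eps_term: "eps k (conf_term k 0 (size t) s) = sc (if snd s = [] then w (fst s) else 0)" for s
  proof (cases s)
    case (Pair C os)
    have word: "eps_word k (start_word c os) = (if os = [] then k (Suc (c 0)) else 0)" for c
      by (auto simp: eps_word_def start_word_no_Y) (simp add: start_word_def)
    have "eps k (conf_term k 0 (size t) s) = sc ((\<Prod>d\<in>fst ` C. k (colour_count 0 (size t) C os d)) *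
        (if os = [] then k (Suc (colour_count 0 (size t) C os 0)) else 0))"
      unfolding Pair conf_term.simps eps_def lin_ext_monom word sc_simps(4) ..
    also have "(\<Prod>d\<in>fst ` C. k (colour_count 0 (size t) C os d)) *
        (if os = [] then k (Suc (colour_count 0 (size t) C os 0)) else 0) = (if os = [] then w C else 0)"
      by (cases "os = []") (simp_all add: w_def)
    finally show ?thesis unfolding Pair by simp
  qed
  have "eps k (tree_poly k t) = (\<Sum>s\<in>?S. eps k (conf_term k 0 (size t) s))"
    unfolding sum_hook_confs[of k 0 t, symmetric] by (simp only: eps_def lin_ext_sum)
  also have "\<dots> = sc (\<Sum>s\<in>?S. if snd s = [] then w (fst s) else 0)"
    unfolding sc_sum eps_term ..
  also have "(\<Sum>s\<in>?S. if snd s = [] then w (fst s) else 0) = (\<Sum>s\<in>{s \<in> ?S. snd s = []}. w (fst s))"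
    by (rule sum.inter_filter[symmetric]) (rule finite_hook_confs)
  also have "{s \<in> ?S. snd s = []} = (\<lambda>C. (C, [])) ` {C. (C, []) \<in> ?S}"
    by (auto simp: image_iff)
  also have "(\<Sum>s\<in>\<dots>. w (fst s)) = (\<Sum>C\<in>{C. (C, []) \<in> ?S}. w C)"
    by (subst sum.reindex) (auto intro: inj_onI)
  also have "\<dots> = (\<Sum>H\<in>VHC (inorder t). w (set H))"
    by (rule sum.reindex_bij_betw[symmetric]) (rule bij_VHC[OF assms refl])
  also have "\<dots> = (\<Sum>H\<in>VHC (inorder t). partition_weight k (hook_partition (inorder t) H))"
    by (intro sum.cong refl) (simp add: weight_hook_partition[OF assms refl] w_def)
  finally show ?thesis .
qed

section \<open>Permutations avoiding 231 and the cumulant formula\<close>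

definition avoids_231 :: "nat list \<Rightarrow> bool" where
  "avoids_231 xs \<longleftrightarrow> (\<forall>i j k. i < j \<longrightarrow> j < k \<longrightarrow> k < length xs \<longrightarrow> \<not> (xs ! k < xs ! i \<and> xs ! i < xs ! j))"

lemma Av231_iff: "\<pi> \<in> Av231 n \<longleftrightarrow> \<pi> \<in> permutations_of_set {1..n} \<and> avoids_231 \<pi>"
proof (cases "\<pi> \<in> permutations_of_set {1..n}")
  case True
  then have len: "length \<pi> = n" using length_finite_permutations_of_set by fastforce
  have "(\<exists>i1 i2 i3. 1 \<le> i1 \<and> i1 < i2 \<and> i2 < i3 \<and> i3 \<le> n \<and>
          entry \<pi> i3 < entry \<pi> i1 \<and> entry \<pi> i1 < entry \<pi> i2) \<longleftrightarrow> \<not> avoids_231 \<pi>" (is "?L \<longleftrightarrow> ?R")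
  proof
    assume ?L
    then obtain i1 i2 i3 where i: "1 \<le> i1" "i1 < i2" "i2 < i3" "i3 \<le> n"
      "entry \<pi> i3 < entry \<pi> i1" "entry \<pi> i1 < entry \<pi> i2" by blast
    then have "i1 - 1 < i2 - 1" "i2 - 1 < i3 - 1" "i3 - 1 < length \<pi>" using len by auto
    then show ?R using i(5,6) unfolding avoids_231_def entry_def by blast
  next
    assume ?R
    then obtain i j k where i: "i < j" "j < k" "k < length \<pi>" "\<pi> ! k < \<pi> ! i" "\<pi> ! i < \<pi> ! j"
      unfolding avoids_231_def by blast
    show ?L
      by (rule exI[of _ "Suc i"], rule exI[of _ "Suc j"], rule exI[of _ "Suc k"])
        (use i len in \<open>simp add: entry_def\<close>)
  qed
  then show ?thesis using True unfolding Av231_def mem_Collect_eq by blast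
next
  case False
  then show ?thesis unfolding Av231_def by simp
qed

lemma nth_in_set_obtain:
  assumes "x \<in> set xs" obtains i where "i < length xs" "x = xs ! i"
  using assms in_set_conv_nth[of x xs] by blast

text \<open>The maximum can only be the middle entry of a pattern 231.\<close>

lemma avoids_231_append_Max:
  assumes "\<And>x. x \<in> set ls \<union> set rs \<Longrightarrow> x < M"
  shows "avoids_231 (ls @ M # rs) \<longleftrightarrow>
    avoids_231 ls \<and> avoids_231 rs \<and> (\<forall>x\<in>set ls. \<forall>y\<in>set rs. x \<le> y)" (is "avoids_231 ?xs \<longleftrightarrow> ?R")
proof
  let ?p = "length ls"
  assume av: "avoids_231 ?xs"
  have "avoids_231 ls"
    unfolding avoids_231_def
  proof (intro allI impI)
    fix i j k assume "i < j" "j < k" "k < length ls"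
    then show "\<not> (ls ! k < ls ! i \<and> ls ! i < ls ! j)"
      using av[unfolded avoids_231_def, rule_format, of i j k] by (simp add: nth_append)
  qed
  moreover have "avoids_231 rs"
    unfolding avoids_231_def
  proof (intro allI impI)
    fix i j k assume "i < j" "j < k" "k < length rs"
    then show "\<not> (rs ! k < rs ! i \<and> rs ! i < rs ! j)"
      using av[unfolded avoids_231_def, rule_format, of "?p + Suc i" "?p + Suc j" "?p + Suc k"]
      by (simp add: nth_append)
  qed
  moreover have "x \<le> y" if "x \<in> set ls" "y \<in> set rs" for x y
  proof -
    from that(1) obtain i where i: "i < length ls" "x = ls ! i" by (rule nth_in_set_obtain)
    from that(2) obtain k where k: "k < length rs" "y = rs ! k" by (rule nth_in_set_obtain)
    have "\<not> (?xs ! (?p + Suc k) < ?xs ! i \<and> ?xs ! i < ?xs ! ?p)"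
      by (rule av[unfolded avoids_231_def, rule_format]) (use i k in simp_all)
    moreover have "?xs ! (?p + Suc k) = y" "?xs ! i = x" "?xs ! ?p = M"
      using i k by (simp_all add: nth_append)
    ultimately have "\<not> (y < x \<and> x < M)" by simp
    then show ?thesis using assms[of x] that by simp
  qed
  ultimately show ?R by blast
next
  let ?p = "length ls"
  assume R: ?R
  have le: "?xs ! i \<le> M" if "i < length ?xs" for i
  proof -
    have "?xs ! i \<in> set ?xs" using that by (rule nth_mem)
    then show ?thesis using assms[of "?xs ! i"] by auto
  qed
  show "avoids_231 ?xs"
    unfolding avoids_231_def
  proof (intro allI impI notI)
    fix i j k assume ijk: "i < j" "j < k" "k < length ?xs" and pat: "?xs ! k < ?xs ! i \<and> ?xs ! i < ?xs ! j"
    have nth_rs: "?xs ! q = rs ! (q - ?p - 1)" if "?p < q" for q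
      using that by (simp add: nth_append nth_Cons')
    consider "k < ?p" | "k = ?p" | "?p < k" "i < ?p" | "i = ?p" | "?p < i" using ijk by linarith
    then show False
    proof cases
      case 1
      have av: "avoids_231 ls" using R by blast
      have "\<not> (ls ! k < ls ! i \<and> ls ! i < ls ! j)"
        by (rule av[unfolded avoids_231_def, rule_format]) (use 1 ijk in auto)
      then show False using pat 1 ijk by (simp add: nth_append)
    next
      case 2
      then show False using pat le[of i] ijk by simp
    next
      case 3
      have "?xs ! i \<in> set ls" using 3(2) by (simp add: nth_append)
      moreover have "?xs ! k \<in> set rs" using nth_rs[OF 3(1)] 3(1) ijk(3) by simp
      ultimately have "?xs ! i \<le> ?xs ! k" using R by blast
      then show False using pat by simp
    next
      case 4
      then have "?xs ! i = M" by simp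
      moreover have "?xs ! j \<le> M" by (rule le) (use ijk in simp)
      ultimately show False using pat by simp
    next
      case 5
      have av: "avoids_231 rs" using R by blast
      have "\<not> (rs ! (k - ?p - 1) < rs ! (i - ?p - 1) \<and> rs ! (i - ?p - 1) < rs ! (j - ?p - 1))"
        by (rule av[unfolded avoids_231_def, rule_format]) (use 5 ijk in auto)
      then show False using pat nth_rs 5 ijk by simp
    qed
  qed
qed

text \<open>Labels \<open>b + 1, b + 2, \<dots>\<close> in postorder.  All labels of a left subtree are then smaller than those
  of the right subtree, which is what avoidance of 231 demands at the root.\<close>

fun postorder_labelling :: "nat \<Rightarrow> unit tree \<Rightarrow> nat tree" where
  "postorder_labelling b Leaf = Leaf"
| "postorder_labelling b (Node l u r) =
     Node (postorder_labelling b l) (b + size l + size r + 1) (postorder_labelling (b + size l) r)"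

lemma size_postorder: "size (postorder_labelling b T) = size T"
  by (induction T arbitrary: b) auto

lemma skeleton_postorder: "skeleton (postorder_labelling b T) = T"
  by (induction T arbitrary: b) auto

lemma set_postorder: "set_tree (postorder_labelling b T) = {b<..b + size T}"
  by (induction T arbitrary: b) auto

lemma decreasing_postorder: "decreasing_tree (postorder_labelling b T)"
proof (induction T arbitrary: b)
  case (Node l u r)
  then show ?case
    unfolding postorder_labelling.simps decreasing_tree_Node_iff set_postorder by auto
qed simp

lemma avoids_231_postorder: "avoids_231 (inorder (postorder_labelling b T))"
proof (induction T arbitrary: b)
  case Leaf
  then show ?case by (simp add: avoids_231_def)
next
  case (Node l u r)
  have "avoids_231 (inorder (postorder_labelling b l) @ (b + size l + size r + 1) #
      inorder (postorder_labelling (b + size l) r))"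
    by (subst avoids_231_append_Max) (use Node in \<open>auto simp: set_postorder\<close>)
  then show ?case by simp
qed

text \<open>In a permutation avoiding 231 this forces the entries to the left of the maximum to be the
  smallest ones.\<close>

lemma initial_interval:
  assumes un: "A \<union> B = {b<..b + n}" and less: "\<And>x y. x \<in> A \<Longrightarrow> y \<in> B \<Longrightarrow> x < (y::nat)"
  shows "A = {b<..b + card A}"
proof (cases "A = {}")
  case False
  have "A \<subseteq> {b<..b + n}" using un by blast
  then have fin: "finite A" by (rule finite_subset) simp
  define M where "M = Max A"
  have M: "M \<in> A" "\<And>x. x \<in> A \<Longrightarrow> x \<le> M" using fin False by (auto simp: M_def)
  have "b < M" "M \<le> b + n" using M(1) un by auto
  have "A = {b<..M}"
  proof (intro equalityI subsetI)
    fix x assume "x \<in> A"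
    then show "x \<in> {b<..M}" using M(2)[of x] un by auto
  next
    fix x assume x: "x \<in> {b<..M}"
    then have "x \<in> A \<union> B" unfolding un using \<open>M \<le> b + n\<close> by simp
    moreover have "x \<notin> B" using less[OF M(1), of x] x by auto
    ultimately show "x \<in> A" by blast
  qed
  moreover from this have "b + card A = M" using \<open>b < M\<close> by simp
  ultimately show ?thesis by simp
qed simp

lemma avoids_231_imp_postorder:
  "distinct xs \<Longrightarrow> set xs = {b<..b + length xs} \<Longrightarrow> avoids_231 xs \<Longrightarrow>
    \<exists>T. size T = length xs \<and> inorder (postorder_labelling b T) = xs"
proof (induction xs arbitrary: b rule: length_induct)
  case (1 xs)
  show ?case
  proof (cases "xs = []")
    case True
    then show ?thesis by (intro exI[of _ Leaf]) simp
  next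
    case False
    define M where "M = b + length xs"
    have "M \<in> set xs" unfolding "1.prems"(2) M_def using False by simp
    then obtain ls rs where xs: "xs = ls @ M # rs" by (meson split_list)
    have "distinct (ls @ M # rs)" using "1.prems"(1) xs by simp
    then have dist: "distinct ls" "distinct rs" "set ls \<inter> set rs = {}" "M \<notin> set ls \<union> set rs"
      by auto
    have len: "length xs = Suc (length ls + length rs)"
      using arg_cong[OF xs, of length] by simp
    have set_xs: "insert M (set ls \<union> set rs) = {b<..M}"
      using "1.prems"(2) arg_cong[OF xs, of set] by (simp add: M_def)
    have un: "set ls \<union> set rs = {b<..b + (length ls + length rs)}"
    proof -
      have "set ls \<union> set rs = {b<..M} - {M}" using set_xs dist(4) by blast
      also have "\<dots> = {b<..b + (length ls + length rs)}"
        unfolding M_def len by (intro set_eqI) (simp, linarith)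
      finally show ?thesis .
    qed
    have "x < M" if "x \<in> set ls \<union> set rs" for x using that unfolding un M_def len by simp
    from avoids_231_append_Max[OF this]
    have av: "avoids_231 ls" "avoids_231 rs" "\<And>x y. x \<in> set ls \<Longrightarrow> y \<in> set rs \<Longrightarrow> x \<le> y"
      using "1.prems"(3) xs by auto
    have less: "x < y" if "x \<in> set ls" "y \<in> set rs" for x y
      using av(3)[OF that] that dist(3) by (metis IntI empty_iff order_less_le)
    have ls: "set ls = {b<..b + length ls}"
      using initial_interval[OF un less] distinct_card[OF dist(1)] by simp
    have "set rs = (set ls \<union> set rs) - set ls" using dist(3) by blast
    also have "\<dots> = {b<..b + (length ls + length rs)} - set ls" by (subst un) (rule refl)
    also have "\<dots> = {b + length ls<..b + length ls + length rs}" by (subst ls) auto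
    finally have rs: "set rs = {b + length ls<..b + length ls + length rs}" .
    obtain L where L: "size L = length ls" "inorder (postorder_labelling b L) = ls"
      using "1.IH"[rule_format, of ls b] dist(1) ls av(1) len by auto
    obtain R where R: "size R = length rs" "inorder (postorder_labelling (b + length ls) R) = rs"
      using "1.IH"[rule_format, of rs "b + length ls"] dist(2) rs av(2) len by auto
    have "size (Node L () R) = length xs" using L R len by simp
    moreover have "inorder (postorder_labelling b (Node L () R)) = ls @ M # rs"
      using L R len by (simp add: M_def)
    ultimately show ?thesis using xs by metis
  qed
qed

text \<open>The root of a decreasing tree is the largest entry of its reading, which determines both subtrees.\<close>

lemma inorder_decreasing_inj:
  "decreasing_tree t \<Longrightarrow> decreasing_tree t' \<Longrightarrow> inorder t = inorder t' \<Longrightarrow> t = t'"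
proof (induction t arbitrary: t')
  case Leaf
  then show ?case by (cases t') simp_all
next
  case (Node l a r)
  obtain l' a' r' where t': "t' = Node l' a' r'" using Node.prems(3) by (cases t') simp_all
  have dec: "decreasing_tree l" "decreasing_tree r" "\<And>x. x \<in> set_tree l \<union> set_tree r \<Longrightarrow> x < a"
    using Node.prems(1) unfolding decreasing_tree_Node_iff by auto
  have dec': "decreasing_tree l'" "decreasing_tree r'" "\<And>x. x \<in> set_tree l' \<union> set_tree r' \<Longrightarrow> x < a'"
    using Node.prems(2) unfolding t' decreasing_tree_Node_iff by auto
  have eq: "inorder l @ a # inorder r = inorder l' @ a' # inorder r'"
    using Node.prems(3) t' by simp
  have "set (inorder l @ a # inorder r) = set (inorder l' @ a' # inorder r')"
    by (simp only: eq)
  then have sets: "insert a (set_tree l \<union> set_tree r) = insert a' (set_tree l' \<union> set_tree r')"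
    unfolding set_append list.set set_inorder Un_insert_right .
  have "a = a'"
  proof (rule ccontr)
    assume "a \<noteq> a'"
    then have "a \<in> set_tree l' \<union> set_tree r'" "a' \<in> set_tree l \<union> set_tree r"
      using sets by (metis insertE insertI1)+
    then show False using dec(3)[of a'] dec'(3)[of a] by simp
  qed
  moreover have "a \<notin> set_tree l" "a \<notin> set_tree r"
    using dec(3)[of a] by auto
  ultimately have "inorder l = inorder l'" "inorder r = inorder r'"
    using eq by (simp_all add: append_Cons_eq_iff)
  then show ?case
    using Node.IH(1)[OF dec(1) dec'(1)] Node.IH(2)[OF dec(2) dec'(2)] t' \<open>a = a'\<close> by blast
qed

abbreviation tree_perm :: "unit tree \<Rightarrow> nat list" where
  "tree_perm T \<equiv> inorder (postorder_labelling 0 T)"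

lemma tree_perm_skeleton: "perm_skeleton (tree_perm T) = T"
proof -
  have "inj_on inorder (std_decreasing_trees (size T))"
    using inorder_decreasing_inj by (intro inj_onI) (auto simp: std_decreasing_trees_def)
  moreover have "postorder_labelling 0 T \<in> std_decreasing_trees (size T)"
    by (auto simp: std_decreasing_trees_def size_postorder set_postorder decreasing_postorder)
  ultimately have "inv_into (std_decreasing_trees (size T)) inorder (tree_perm T) = postorder_labelling 0 T"
    by (rule inv_into_f_f)
  then show ?thesis
    by (simp add: perm_skeleton_def size_postorder skeleton_postorder)
qed

lemma tree_number_tree_perm: "tree_number (tree_perm T) = labelings T"
proof -
  have "{t \<in> std_decreasing_trees (size T). skeleton t = T} = labelled_trees T {1..size T}"
    unfolding std_decreasing_trees_def labelled_trees_def by auto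
  then show ?thesis
    using finite_labelled_trees_card[of "{1..size T}" T]
    by (simp add: tree_number_def tree_perm_skeleton size_postorder)
qed

lemma bij_tree_perm: "bij_betw tree_perm (trees n) (Av231 n)"
proof (rule bij_betwI')
  show "tree_perm S = tree_perm T \<longleftrightarrow> S = T" for S T
    using tree_perm_skeleton by metis
  show "tree_perm T \<in> Av231 n" if "T \<in> trees n" for T
  proof -
    have s: "size T = n" using that by (simp add: trees_def)
    have "{0<..0 + n} = {1..n}" by auto
    then have set: "set (tree_perm T) = {1..n}" by (simp add: set_postorder s)
    have "card (set (tree_perm T)) = length (tree_perm T)"
      unfolding set using s by (simp add: size_postorder)
    then have "distinct (tree_perm T)" by (rule card_distinct)
    then show ?thesis
      unfolding Av231_iff using set avoids_231_postorder by (blast intro: permutations_of_setI)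
  qed
  show "\<exists>T\<in>trees n. \<pi> = tree_perm T" if "\<pi> \<in> Av231 n" for \<pi>
  proof -
    have \<pi>: "set \<pi> = {1..n}" "distinct \<pi>" "avoids_231 \<pi>"
      using that unfolding Av231_iff by (auto dest: permutations_of_setD)
    have "length \<pi> = n" using distinct_card[OF \<pi>(2)] unfolding \<pi>(1) by simp
    then have "set \<pi> = {0<..0 + length \<pi>}" unfolding \<pi>(1) by auto
    from avoids_231_imp_postorder[OF \<pi>(2) this \<pi>(3)]
    show ?thesis using \<open>length \<pi> = n\<close> unfolding trees_def by auto
  qed
qed

lemma tree_poly_skeleton: "tree_poly k (skeleton t) = tree_poly k t"
proof (induction t)
  case (Node l a r)
  have "skeleton r = Leaf \<longleftrightarrow> r = Leaf" by (cases r) simp_all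
  then show ?case using Node by simp
qed simp

lemma finite_VHC:
  assumes "decreasing_tree t"
  shows "finite (VHC (inorder t))"
proof -
  have "{C. (C, []) \<in> hook_confs t 0} = fst ` {s \<in> hook_confs t 0. snd s = []}" by force
  then have "finite {C. (C, []) \<in> hook_confs t 0}" using finite_hook_confs[of t 0] by simp
  then show ?thesis using bij_betw_finite[OF bij_VHC[OF assms refl]] by simp
qed

definition VHC_sum :: "(nat \<Rightarrow> 'a::field) \<Rightarrow> nat \<Rightarrow> 'a" where
  "VHC_sum k n = (\<Sum>(\<pi>, H)\<in>VHC_on (Av231 n).
     of_nat (tree_number \<pi>) * partition_weight k (hook_partition \<pi> H))"

text \<open>Only configurations without open hooks survive \<open>eps\<close>, which closes the block of the sky with the
  extra last point.\<close>

lemma eps_tree_series: "eps k (tree_series k n) = sc (VHC_sum k n)"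
proof -
  let ?w = "\<lambda>\<pi>. \<Sum>H\<in>VHC \<pi>. partition_weight k (hook_partition \<pi> H)"
  have fin: "finite (Av231 n)"
    using bij_betw_finite[OF bij_tree_perm] finite_trees by blast
  have finV: "\<forall>\<pi>\<in>Av231 n. finite (VHC \<pi>)"
  proof
    fix \<pi> assume "\<pi> \<in> Av231 n"
    then obtain T where "\<pi> = tree_perm T" using bij_betw_imp_surj_on[OF bij_tree_perm] by blast
    then show "finite (VHC \<pi>)" using finite_VHC[OF decreasing_postorder] by simp
  qed
  have "VHC_sum k n = (\<Sum>\<pi>\<in>Av231 n. of_nat (tree_number \<pi>) * ?w \<pi>)"
    unfolding VHC_sum_def VHC_on_def sum_distrib_left by (rule sum.Sigma[OF fin finV, symmetric])
  also have "\<dots> = (\<Sum>T\<in>trees n. of_nat (tree_number (tree_perm T)) * ?w (tree_perm T))"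
    by (rule sum.reindex_bij_betw[OF bij_tree_perm, symmetric])
  finally have V: "VHC_sum k n = (\<Sum>T\<in>trees n. of_nat (labelings T) * ?w (tree_perm T))"
    unfolding tree_number_tree_perm .
  have "eps k (tree_series k n) = (\<Sum>T\<in>trees n. eps k (of_nat (labelings T) * tree_poly k T))"
    unfolding tree_series_def eps_def by (rule lin_ext_sum)
  also have "\<dots> = (\<Sum>T\<in>trees n. sc (of_nat (labelings T) * ?w (tree_perm T)))"
  proof (intro sum.cong refl)
    fix T :: "unit tree"
    have "eps k (of_nat (labelings T) * tree_poly k T) = sc (of_nat (labelings T)) * eps k (tree_poly k T)"
      unfolding eps_def sc_simps(7)[symmetric] by (rule lin_ext_sc)
    also have "eps k (tree_poly k T) = sc (?w (tree_perm T))"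
      using eps_tree_poly[OF decreasing_postorder, of k 0 T]
        tree_poly_skeleton[of k "postorder_labelling 0 T"] by (simp only: skeleton_postorder)
    finally show "eps k (of_nat (labelings T) * tree_poly k T) = sc (of_nat (labelings T) * ?w (tree_perm T))"
      by (simp only: sc_simps(4))
  qed
  finally show ?thesis unfolding V sc_sum .
qed

lemma free_moment_recursion:
  fixes \<kappa> :: "nat \<Rightarrow> 'a::field"
  shows "free_moment \<kappa> (Suc n) = - binomial_conv (VHC_sum (\<lambda>j. - \<kappa> j)) (free_moment \<kappa>) n"
  by (rule free_moment_convolution[where \<Phi> = "tree_series (\<lambda>j. - \<kappa> j)" and \<Upsilon> = "open_series \<kappa>" and k = "\<lambda>j. - \<kappa> j"])
    (simp_all only: tree_series_0 tree_series_Suc open_series_0 open_series_Suc lookup_open_series_0 eps_tree_series)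

lemma free_moment_0: "free_moment \<kappa> 0 = 1"
  using lookup_open_series_0[of \<kappa> 0] by (simp add: open_series_0)

theorem theorem8p4:
  fixes \<kappa> c :: "nat \<Rightarrow> 'a::field" and n :: nat
  assumes "corresponding_cumulants \<kappa> c" and "n \<ge> 1"
  shows "- c n = (\<Sum>(\<pi>, H)\<in>VHC_on (Av231 (n - 1)).
           of_nat (tree_number \<pi>) * partition_weight (\<lambda>k. - \<kappa> k) (hook_partition \<pi> H))"
proof -
  let ?e = "VHC_sum (\<lambda>j. - \<kappa> j)"
  obtain m where m: "free_cumulants_of m \<kappa>" "classical_cumulants_of m c"
    using assms(1) unfolding corresponding_cumulants_def by blast
  have moments: "moment c j = free_moment \<kappa> j" for j
  proof (cases j)
    case 0
    then show ?thesis by (simp add: free_moment_0)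
  next
    case (Suc i)
    then have "m j = moment c j" "m j = free_moment \<kappa> j"
      using classical_moment[OF m(2), of j] m(1)
      by (simp_all add: free_cumulants_of_def free_moment_def)
    then show ?thesis by simp
  qed
  have "c (Suc j) = - ?e j" for j
  proof (induction j rule: less_induct)
    case (less j)
    let ?f = "\<lambda>u i. of_nat (j choose i) * (u i * moment c (j - i))"
    have "moment c (Suc j) = (\<Sum>i<j. ?f (\<lambda>i. c (Suc i)) i) + c (Suc j)"
      by (simp add: lessThan_Suc_atMost[symmetric])
    moreover have "moment c (Suc j) = - ((\<Sum>i<j. ?f ?e i) + ?e j)"
      using free_moment_recursion[of \<kappa> j]
      by (simp del: moment.simps(2) add: moments binomial_conv_def lessThan_Suc_atMost[symmetric] free_moment_0)
    moreover have "(\<Sum>i<j. ?f (\<lambda>i. c (Suc i)) i) = - (\<Sum>i<j. ?f ?e i)"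
      unfolding sum_negf[symmetric] by (intro sum.cong refl) (simp add: less)
    ultimately show ?case by simp
  qed
  from this[of "n - 1"] show ?thesis
    using assms(2) by (simp add: VHC_sum_def)
qed

end
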